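(* Let $\mathcal K$ be a separable Hilbert space, let $\{A_{(\boldsymbol\alpha,\boldsymbol\beta)}\}_{(\boldsymbol\alpha,\boldsymbol\beta)\in\mathcal J}$ be a family of operators in $B(\mathcal K)$ and let $$\varphi(\mathbf W,\mathbf W^* ):=\sum_{(\boldsymbol\alpha,\boldsymbol\beta)\in\mathcal J}A_{(\boldsymbol\alpha,\boldsymbol\beta)}\otimes\mathbf W_{\boldsymbol\alpha}\mathbf W_{\boldsymbol\beta}^*=\sum_{s_1\in\mathbb Z}\cdots\sum_{s_k\in\mathbb Z}q_{s_1,\ldots,s_k}(\mathbf W,\mathbf W^* )$$ be a formal series. Then the following statements are equivalent. (i) For each $\boldsymbol\gamma\in\mathbf F_{\mathbf n}^+$, the series $\sum_{\boldsymbol\omega\in\mathbf F_{\mathbf n}^+:(\boldsymbol\omega,\boldsymbol\gamma)\in\mathcal C}\tau_{(\boldsymbol\omega,\boldsymbol\gamma)}^2A_{\mathbf s(\boldsymbol\omega,\boldsymbol\gamma)}^*A_{\mathbf s(\boldsymbol\omega,\boldsymbol\gamma)}$ is WOT-convergent, and $$\sup_{r\in[0,1)}\ \sup_{p\in\mathcal P_{\mathcal K},\|p\|\le1}\|\varphi(r\mathbf W,r\mathbf W^* )p\|<\infty.$$ (ii) $\varphi(\mathbf W,\mathbf W^* )$ is the formal Fourier representation of a weighted multi-Toeplitz operator $T\in B(\mathcal K\otimes\bigotimes_{s=1}^kF^2(H_{n_s}))$. (iii) For each $r\in[0,1)$, the series $\varphi(r\mathbf W,r\mathbf W^* ):=\sum_{s_1\in\mathbb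 Z}\cdots\sum_{s_k\in\mathbb Z}r^{|s_1|+\cdots+|s_k|}q_{s_1,\ldots,s_k}(\mathbf W,\mathbf W^* )$ converges in the operator norm topology and $\sup_{r\in[0,1)}\|\varphi(r\mathbf W,r\mathbf W^* )\|<\infty$. (iv) There is $M>0$ such that $\|q_{s_1,\ldots,s_k}(\mathbf W,\mathbf W^* )\|\le M$ for all $(s_1,\ldots,s_k)\in\mathbb Z^k$, and $\sup_{r\in[0,1)}\|\varphi(r\mathbf W,r\mathbf W^* )\|<\infty$. In this case, $T=\text{SOT-}\lim_{r\to1}\varphi(r\mathbf W,r\mathbf W^* )$ and $\|T\|=\sup_{r\in[0,1)}\|\varphi(r\mathbf W,r\mathbf W^* )\|$.
   Context: Fix $k\in\mathbb N=\{1,2,\ldots\}$ and $\mathbf m=(m_1,\ldots,m_k)$, $\mathbf n=(n_1,\ldots,n_k)$ with $m_i,n_i\in\mathbb N$. For each $i$, $\mathbb F_{n_i}^+$ is the unital free semigroup with generators $g_1^i,\ldots,g_{n_i}^i$ and identity $g_0^i$; $|\alpha|$ is the length of $\alpha$. $F^2(H_{n_i})=\bigoplus_{p\ge0}H_{n_i}^{\otimes p}$ is the full Fock space of the Hilbert space $H_{n_i}$ with orthonormal basis $e_1^i,\ldots,e_{n_i}^i$; it has orthonormal basis $\{e_\alpha^i\}_{\alpha\in\mathbb F_{n_i}^+}$, $e^i_\alpha=e^i_{j_1}\otimes\cdots\otimes e^i_{j_p}$ for $\alpha=g^i_{j_1}\cdots g^i_{j_p}$, $e^i_{g_0^i}=1$.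 $\mathbf F_{\mathbf n}^+:=\mathbb F_{n_1}^+\times\cdots\times\mathbb F_{n_k}^+$ and $e_{\boldsymbol\alpha}:=e_{\alpha_1}^1\otimes\cdots\otimes e^k_{\alpha_k}$. Let $D_{i,j}e_\alpha^i:=\sqrt{\frac{|\alpha|+1}{|\alpha|+m_i}}\,e_\alpha^i$, $S_{i,j}f:=e_j^i\otimes f$, $W_{i,j}:=S_{i,j}D_{i,j}$ on $F^2(H_{n_i})$, and let $\mathbf W_{i,j}$ act on $\bigotimes_{s=1}^kF^2(H_{n_s})$ as $W_{i,j}$ on the $i$th factor and as the identity on the others; $\mathbf W_{i,\alpha}:=\mathbf W_{i,j_1}\cdots\mathbf W_{i,j_p}$ for $\alpha=g^i_{j_1}\cdots g^i_{j_p}$, $\mathbf W_{i,g_0^i}:=I$; $\mathbf W_{\boldsymbol\alpha}:=\mathbf W_{1,\alpha_1}\cdots\mathbf W_{k,\alpha_k}$. For $s\in\mathbb Z$, $s^+:=\max\{s,0\}$, $s^-:=\max\{-s,0\}$. Put $b_{i,\alpha}^{(m_i)}:=\binom{|\alpha|+m_i-1}{m_i-1}$. For $\omega,\gamma\in\mathbb F_{n_i}^+$ write $\omega\ge_r\gamma$ if $\omega=\sigma\gamma$ for some $\sigma\in\mathbb F_{n_i}^+$, and then $\omega\backslash_r\gamma:=\sigma$. $\boldsymbol\omega,\boldsymbol\gamma\in\mathbf F_{\mathbf n}^+$ are comparable if for each $i$ either $\omega_i\ge_r\gamma_i$ or $\gamma_i\ge_r\omega_i$ (max and min of $\omega_i,\gamma_i$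 refer to $\ge_r$). $\mathcal C$ is the set of all comparable pairs. $\mathcal J\subset\mathcal C$ is the set of $(\boldsymbol\sigma,\boldsymbol\beta)$ for which there are $s_i\in\mathbb Z$ with $|\sigma_i|=s_i^+$, $|\beta_i|=s_i^-$ for all $i$. $\mathbf s:\mathcal C\to\mathcal J$ is $\mathbf s(\boldsymbol\omega,\boldsymbol\gamma):=(\boldsymbol\sigma,\boldsymbol\beta)$ with $\sigma_i:=\omega_i\backslash_r\gamma_i$ if $\omega_i\ge_r\gamma_i$ and $g_0^i$ otherwise, $\beta_i:=\gamma_i\backslash_r\omega_i$ if $\gamma_i\ge_r\omega_i$ and $g_0^i$ otherwise. $\tau_{(\boldsymbol\omega,\boldsymbol\gamma)}:=\prod_{i=1}^k\sqrt{b^{(m_i)}_{i,\min\{\omega_i,\gamma_i\}}/b^{(m_i)}_{i,\max\{\omega_i,\gamma_i\}}}$ for $(\boldsymbol\omega,\boldsymbol\gamma)\in\mathcal C$. An operator $T\in B(\mathcal K\otimes\bigotimes_sF^2(H_{n_s}))$ is weighted (right) multi-Toeplitz if there are operators $\{B_{(\boldsymbol\sigma,\boldsymbol\beta)}\}_{(\boldsymbol\sigma,\boldsymbol\beta)\in\mathcal J}\subset B(\mathcal K)$ such that for all $\boldsymbol\omega,\boldsymbol\gamma\in\mathbf F_{\mathbf n}^+$ and $x,y\in\mathcal K$, $\langle T(x\otimes e_{\boldsymbol\gamma}),y\otimes e_{\boldsymbol\omega}\rangle$ equals $\tau_{(\boldsymbol\omega,\boldsymbol\gamma)}\langle B_{\mathbf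 s(\boldsymbol\omega,\boldsymbol\gamma)}x,y\rangle$ if $(\boldsymbol\omega,\boldsymbol\gamma)\in\mathcal C$ and $0$ otherwise. $\mathcal P_{\mathcal K}$ is the linear span of the vectors $h\otimes e_{\boldsymbol\alpha}$, $h\in\mathcal K$, $\boldsymbol\alpha\in\mathbf F_{\mathbf n}^+$. For $(s_1,\ldots,s_k)\in\mathbb Z^k$, $q_{s_1,\ldots,s_k}(\mathbf W,\mathbf W^* ):=\sum A_{(\boldsymbol\alpha,\boldsymbol\beta)}\otimes\mathbf W_{\boldsymbol\alpha}\mathbf W_{\boldsymbol\beta}^*$, the (finite) sum over all $(\boldsymbol\alpha,\boldsymbol\beta)$ with $|\alpha_i|=s_i^+$, $|\beta_i|=s_i^-$ for all $i$. A formal series $\varphi$ is applied to vectors of $\mathcal P_{\mathcal K}$ termwise: $\varphi(\mathbf W,\mathbf W^* )(x\otimes e_{\boldsymbol\gamma})=\sum_{(\boldsymbol\alpha,\boldsymbol\beta)\in\mathcal J}A_{(\boldsymbol\alpha,\boldsymbol\beta)}x\otimes\mathbf W_{\boldsymbol\alpha}\mathbf W_{\boldsymbol\beta}^*e_{\boldsymbol\gamma}$ (norm convergence; the terms are pairwise orthogonal), and $\varphi(r\mathbf W,r\mathbf W^* )$ is the series $\sum r^{|s_1|+\cdots+|s_k|}q_{s_1,\ldots,s_k}(\mathbf W,\mathbf W^* )$. $\varphi(\mathbf W,\mathbf W^* )$ is the formal Fourier representation of $T$ if $Tp=\varphi(\mathbf W,\mathbf W^* )p$ for all $p\in\mathcal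 P_{\mathcal K}$. SOT and WOT denote the strong and weak operator topologies. *)

theory Defs
  imports "HOL-Analysis.Analysis" "HOL-Library.Sublist"
begin

section \<open>Complex Hilbert spaces\<close>

text \<open>The inner product is linear in its first argument. Positivity and definiteness of it
  follow from \<open>norm_eq_sqrt_cinner\<close> and the axioms for the norm.\<close>

class complex_inner = real_normed_vector +
  fixes scaleC :: "complex \<Rightarrow> 'a \<Rightarrow> 'a" (infixr \<open>*\<^sub>C\<close> 75)
    and cinner :: "'a \<Rightarrow> 'a \<Rightarrow> complex"
  assumes scaleC_add_right: "c *\<^sub>C (x + y) = c *\<^sub>C x + c *\<^sub>C y"
    and scaleC_add_left: "(c + d) *\<^sub>C x = c *\<^sub>C x + d *\<^sub>C x"
    and scaleC_scaleC: "c *\<^sub>C d *\<^sub>C x = (c * d) *\<^sub>C x"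
    and scaleR_scaleC: "r *\<^sub>R x = complex_of_real r *\<^sub>C x"
    and cinner_commute: "cinner x y = cnj (cinner y x)"
    and cinner_add_left: "cinner (x + y) z = cinner x z + cinner y z"
    and cinner_scaleC_left: "cinner (c *\<^sub>C x) y = c * cinner x y"
    and norm_eq_sqrt_cinner: "norm x = sqrt (Re (cinner x x))"

class chilbert_space = complex_inner + complete_space

instantiation complex :: chilbert_space
begin

definition scaleC_complex :: "complex \<Rightarrow> complex \<Rightarrow> complex"
  where "scaleC_complex c x = c * x"

definition cinner_complex :: "complex \<Rightarrow> complex \<Rightarrow> complex"
  where "cinner_complex x y = x * cnj y"

instance
proof
  fix x :: complex
  show "norm x = sqrt (Re (cinner x x))"
    by (simp add: cinner_complex_def cmod_def power2_eq_square)
qed (auto simp: scaleC_complex_def cinner_complex_def algebra_simps scaleR_conv_of_real)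

end

definition bounded_clinear :: "('a::complex_inner \<Rightarrow> 'a) \<Rightarrow> bool"
  where "bounded_clinear A \<longleftrightarrow> bounded_linear A \<and> (\<forall>c x. A (c *\<^sub>C x) = c *\<^sub>C A x)"

definition cadjoint :: "('a::chilbert_space \<Rightarrow> 'a) \<Rightarrow> 'a \<Rightarrow> 'a"
  where "cadjoint A = (SOME B. \<forall>x y. cinner (A x) y = cinner x (B y))"

definition wot_summable_on :: "('i \<Rightarrow> 'a::chilbert_space \<Rightarrow> 'a) \<Rightarrow> 'i set \<Rightarrow> bool"
  where "wot_summable_on G I \<longleftrightarrow>
    (\<exists>S. bounded_clinear S \<and>
      (\<forall>x y. ((\<lambda>i. cinner (G i x) y) has_sum cinner (S x) y) I))"


section \<open>The spaces \<open>\<ell>\<^sup>2(F; K) = K \<otimes> \<ell>\<^sup>2(F)\<close> and their operators\<close>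

text \<open>Vectors are functions vanishing outside the index set \<open>F\<close>. Operators are functions
  whose values matter only on the carrier \<open>l2 F\<close>.\<close>

definition l2 :: "'i set \<Rightarrow> ('i \<Rightarrow> 'a::complex_inner) set"
  where "l2 F = {f. (\<forall>\<omega>. \<omega> \<notin> F \<longrightarrow> f \<omega> = 0) \<and> (\<lambda>\<omega>. (norm (f \<omega>))\<^sup>2) summable_on F}"

definition l2_inner :: "'i set \<Rightarrow> ('i \<Rightarrow> 'a::complex_inner) \<Rightarrow> ('i \<Rightarrow> 'a) \<Rightarrow> complex"
  where "l2_inner F f g = (\<Sum>\<^sub>\<infinity>\<omega>\<in>F. cinner (f \<omega>) (g \<omega>))"

definition l2_norm :: "'i set \<Rightarrow> ('i \<Rightarrow> 'a::complex_inner) \<Rightarrow> real"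
  where "l2_norm F f = sqrt (\<Sum>\<^sub>\<infinity>\<omega>\<in>F. (norm (f \<omega>))\<^sup>2)"

definition l2_basis :: "'i \<Rightarrow> 'i \<Rightarrow> complex"
  where "l2_basis \<gamma> = (\<lambda>\<omega>. if \<omega> = \<gamma> then 1 else 0)"

definition elem_tensor :: "'a::complex_inner \<Rightarrow> ('i \<Rightarrow> complex) \<Rightarrow> 'i \<Rightarrow> 'a"
  where "elem_tensor x f = (\<lambda>\<omega>. f \<omega> *\<^sub>C x)"

definition l2_bounded_op :: "'i set \<Rightarrow> (('i \<Rightarrow> 'a::complex_inner) \<Rightarrow> 'i \<Rightarrow> 'a) \<Rightarrow> bool"
  where "l2_bounded_op F T \<longleftrightarrow>
    (\<forall>f\<in>l2 F. T f \<in> l2 F) \<and>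
    (\<forall>f\<in>l2 F. \<forall>g\<in>l2 F. T (\<lambda>\<omega>. f \<omega> + g \<omega>) = (\<lambda>\<omega>. T f \<omega> + T g \<omega>)) \<and>
    (\<forall>c. \<forall>f\<in>l2 F. T (\<lambda>\<omega>. c *\<^sub>C f \<omega>) = (\<lambda>\<omega>. c *\<^sub>C T f \<omega>)) \<and>
    (\<exists>M. \<forall>f\<in>l2 F. l2_norm F (T f) \<le> M * l2_norm F f)"

definition l2_opnorm :: "'i set \<Rightarrow> (('i \<Rightarrow> 'a::complex_inner) \<Rightarrow> 'i \<Rightarrow> 'a) \<Rightarrow> real"
  where "l2_opnorm F T = (SUP f\<in>{f \<in> l2 F. l2_norm F f \<le> 1}. l2_norm F (T f))"

definition l2_adjoint ::
    "'i set \<Rightarrow> (('i \<Rightarrow> 'a::complex_inner) \<Rightarrow> 'i \<Rightarrow> 'a) \<Rightarrow> ('i \<Rightarrow> 'a) \<Rightarrow> 'i \<Rightarrow> 'a"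
  where "l2_adjoint F T =
    (SOME S. l2_bounded_op F S \<and>
      (\<forall>f\<in>l2 F. \<forall>g\<in>l2 F. l2_inner F (T f) g = l2_inner F f (S g)))"

definition tensor_op ::
    "'i set \<Rightarrow> ('a::complex_inner \<Rightarrow> 'a) \<Rightarrow> (('i \<Rightarrow> complex) \<Rightarrow> 'i \<Rightarrow> complex) \<Rightarrow>
      ('i \<Rightarrow> 'a) \<Rightarrow> 'i \<Rightarrow> 'a"
  where "tensor_op F A B =
    (SOME R. l2_bounded_op F R \<and>
      (\<forall>x. \<forall>f\<in>l2 F. R (elem_tensor x f) = elem_tensor (A x) (B f)))"

text \<open>Unordered summation in the norm of \<open>l2 F\<close> and in the operator norm, in the style of
  \<open>has_sum\<close>.\<close>

definition l2_has_sum ::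
    "'i set \<Rightarrow> ('j \<Rightarrow> 'i \<Rightarrow> 'a::complex_inner) \<Rightarrow> 'j set \<Rightarrow> ('i \<Rightarrow> 'a) \<Rightarrow> bool"
  where "l2_has_sum F t J f \<longleftrightarrow> f \<in> l2 F \<and>
    ((\<lambda>X. l2_norm F (\<lambda>\<omega>. f \<omega> - (\<Sum>j\<in>X. t j \<omega>))) \<longlongrightarrow> 0) (finite_subsets_at_top J)"

definition l2_op_has_sum ::
    "'i set \<Rightarrow> ('j \<Rightarrow> ('i \<Rightarrow> 'a::complex_inner) \<Rightarrow> 'i \<Rightarrow> 'a) \<Rightarrow> 'j set \<Rightarrow>
      (('i \<Rightarrow> 'a) \<Rightarrow> 'i \<Rightarrow> 'a) \<Rightarrow> bool"
  where "l2_op_has_sum F G J L \<longleftrightarrow> l2_bounded_op F L \<and>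
    ((\<lambda>X. l2_opnorm F (\<lambda>f \<omega>. L f \<omega> - (\<Sum>j\<in>X. G j f \<omega>))) \<longlongrightarrow> 0) (finite_subsets_at_top J)"

text \<open>Iterated series over \<open>\<int>\<close>, convergent in the operator norm: for a list \<open>[i\<^sub>1, \<dots>, i\<^sub>p]\<close> of
  indices, \<open>L\<close> is the sum over \<open>s i\<^sub>1\<close> of the sums over \<open>s i\<^sub>2\<close> of \dots of the sums over \<open>s i\<^sub>p\<close>
  of \<open>t s\<close>; the other entries of \<open>s\<close> are kept.\<close>

fun l2_op_iter_sum ::
    "'i set \<Rightarrow> nat list \<Rightarrow> ((nat \<Rightarrow> int) \<Rightarrow> ('i \<Rightarrow> 'a::complex_inner) \<Rightarrow> 'i \<Rightarrow> 'a) \<Rightarrow>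
      (nat \<Rightarrow> int) \<Rightarrow> (('i \<Rightarrow> 'a) \<Rightarrow> 'i \<Rightarrow> 'a) \<Rightarrow> bool"
  where
    "l2_op_iter_sum F [] t s L \<longleftrightarrow> L = t s"
  | "l2_op_iter_sum F (i # is) t s L \<longleftrightarrow>
      (\<exists>G. (\<forall>j. l2_op_iter_sum F is t (s(i := j)) (G j)) \<and> l2_op_has_sum F G (UNIV :: int set) L)"

definition l2_sot_tendsto ::
    "'i set \<Rightarrow> ('j \<Rightarrow> ('i \<Rightarrow> 'a::complex_inner) \<Rightarrow> 'i \<Rightarrow> 'a) \<Rightarrow>
      (('i \<Rightarrow> 'a) \<Rightarrow> 'i \<Rightarrow> 'a) \<Rightarrow> 'j filter \<Rightarrow> bool"
  where "l2_sot_tendsto F G T net \<longleftrightarrow>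
    (\<forall>f\<in>l2 F. ((\<lambda>r. l2_norm F (\<lambda>\<omega>. G r f \<omega> - T f \<omega>)) \<longlongrightarrow> 0) net)"


section \<open>Words and weights\<close>

text \<open>The free semigroup on \<open>n\<close> generators is \<open>lists {1..n}\<close>, with \<open>[]\<close> as identity and \<open>@\<close> as
  product. The relation \<open>\<omega> \<ge>\<^sub>r \<gamma>\<close> is \<open>suffix \<gamma> \<omega>\<close>.\<close>

type_synonym multiword = "nat \<Rightarrow> nat list"

definition Fn :: "nat \<Rightarrow> (nat \<Rightarrow> nat) \<Rightarrow> multiword set"
  where "Fn k n = (\<Pi>\<^sub>E i\<in>{1..k}. lists {1..n i})"

definition rdiff :: "nat list \<Rightarrow> nat list \<Rightarrow> nat list"
  where "rdiff \<omega> \<gamma> = (THE \<sigma>. \<omega> = \<sigma> @ \<gamma>)"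

definition rmax :: "nat list \<Rightarrow> nat list \<Rightarrow> nat list"
  where "rmax \<omega> \<gamma> = (if suffix \<gamma> \<omega> then \<omega> else \<gamma>)"

definition rmin :: "nat list \<Rightarrow> nat list \<Rightarrow> nat list"
  where "rmin \<omega> \<gamma> = (if suffix \<gamma> \<omega> then \<gamma> else \<omega>)"

definition comparable_pairs :: "nat \<Rightarrow> (nat \<Rightarrow> nat) \<Rightarrow> (multiword \<times> multiword) set"
  where "comparable_pairs k n =
    {(\<omega>, \<gamma>). \<omega> \<in> Fn k n \<and> \<gamma> \<in> Fn k n \<and>
      (\<forall>i\<in>{1..k}. suffix (\<gamma> i) (\<omega> i) \<or> suffix (\<omega> i) (\<gamma> i))}"

definition degree_pairs ::
    "nat \<Rightarrow> (nat \<Rightarrow> nat) \<Rightarrow> (nat \<Rightarrow> int) \<Rightarrow> (multiword \<times> multiword) set"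
  where "degree_pairs k n s =
    {(\<alpha>, \<beta>). \<alpha> \<in> Fn k n \<and> \<beta> \<in> Fn k n \<and>
      (\<forall>i\<in>{1..k}. int (length (\<alpha> i)) = max (s i) 0 \<and> int (length (\<beta> i)) = max (- s i) 0)}"

definition J_pairs :: "nat \<Rightarrow> (nat \<Rightarrow> nat) \<Rightarrow> (multiword \<times> multiword) set"
  where "J_pairs k n = (\<Union>s. degree_pairs k n s)"

definition simplify_pair :: "nat \<Rightarrow> multiword \<times> multiword \<Rightarrow> multiword \<times> multiword"
  where "simplify_pair k = (\<lambda>(\<omega>, \<gamma>).
    (\<lambda>i\<in>{1..k}. if suffix (\<gamma> i) (\<omega> i) then rdiff (\<omega> i) (\<gamma> i) else [],
     \<lambda>i\<in>{1..k}. if suffix (\<omega> i) (\<gamma> i) then rdiff (\<gamma> i) (\<omega> i) else []))"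

definition bcoeff :: "nat \<Rightarrow> nat list \<Rightarrow> real"
  where "bcoeff m \<alpha> = real ((length \<alpha> + m - 1) choose (m - 1))"

definition tau :: "nat \<Rightarrow> (nat \<Rightarrow> nat) \<Rightarrow> multiword \<times> multiword \<Rightarrow> real"
  where "tau k m = (\<lambda>(\<omega>, \<gamma>).
    \<Prod>i\<in>{1..k}. sqrt (bcoeff (m i) (rmin (\<omega> i) (\<gamma> i)) / bcoeff (m i) (rmax (\<omega> i) (\<gamma> i))))"


section \<open>The universal model\<close>

text \<open>The full Fock space \<open>F\<^sup>2(H\<^sub>n)\<close> is \<open>l2 (lists {1..n})\<close>, a vector being identified with the
  family of its coordinates in the orthonormal basis \<open>e\<^sub>\<alpha>\<close>. The tensor product of the Fock spaces
  is \<open>l2 (Fn k n)\<close>, where \<open>f\<^sub>1 \<otimes> \<dots> \<otimes> f\<^sub>k\<close> is \<open>\<omega> \<mapsto> f\<^sub>1 (\<omega> 1) * \<dots> * f\<^sub>k (\<omega> k)\<close>,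
  and its tensor product with \<open>K\<close> is the space \<open>l2 (Fn k n)\<close> of \<open>K\<close>-valued functions.\<close>

definition Dop :: "nat \<Rightarrow> (nat list \<Rightarrow> complex) \<Rightarrow> nat list \<Rightarrow> complex"
  where "Dop m f = (\<lambda>\<alpha>. complex_of_real (sqrt ((length \<alpha> + 1) / (length \<alpha> + m))) * f \<alpha>)"

text \<open>\<open>f \<mapsto> e\<^sub>j \<otimes> f\<close>, that is \<open>e\<^sub>\<alpha> \<mapsto> e\<^sub>\<omega>\<close> with \<open>\<omega> = g\<^sub>j \<alpha>\<close>\<close>

definition Sop :: "nat \<Rightarrow> (nat list \<Rightarrow> complex) \<Rightarrow> nat list \<Rightarrow> complex"
  where "Sop j f = (\<lambda>\<omega>. case \<omega> of [] \<Rightarrow> 0 | j' # \<alpha> \<Rightarrow> if j' = j then f \<alpha> else 0)"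

definition Wop :: "nat \<Rightarrow> nat \<Rightarrow> (nat list \<Rightarrow> complex) \<Rightarrow> nat list \<Rightarrow> complex"
  where "Wop m j = Sop j \<circ> Dop m"

text \<open>The operator acting as \<open>B\<close> on the \<open>i\<close>-th tensor factor and as the identity on the others:
  \<open>B\<close> is applied to \<open>f\<close> as a function of the \<open>i\<close>-th coordinate.\<close>

definition ampliation ::
    "nat \<Rightarrow> (nat \<Rightarrow> nat) \<Rightarrow> nat \<Rightarrow> ((nat list \<Rightarrow> complex) \<Rightarrow> nat list \<Rightarrow> complex) \<Rightarrow>
      (multiword \<Rightarrow> complex) \<Rightarrow> multiword \<Rightarrow> complex"
  where "ampliation k n i B f =
    (\<lambda>w. if w \<in> Fn k n then B (\<lambda>u. f (w(i := u))) (w i) else 0)"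

definition bW ::
    "nat \<Rightarrow> (nat \<Rightarrow> nat) \<Rightarrow> (nat \<Rightarrow> nat) \<Rightarrow> nat \<Rightarrow> nat \<Rightarrow>
      (multiword \<Rightarrow> complex) \<Rightarrow> multiword \<Rightarrow> complex"
  where "bW k m n i j = ampliation k n i (Wop (m i) j)"

definition bW_word ::
    "nat \<Rightarrow> (nat \<Rightarrow> nat) \<Rightarrow> (nat \<Rightarrow> nat) \<Rightarrow> nat \<Rightarrow> nat list \<Rightarrow>
      (multiword \<Rightarrow> complex) \<Rightarrow> multiword \<Rightarrow> complex"
  where "bW_word k m n i \<alpha> = foldr (\<lambda>j R. bW k m n i j \<circ> R) \<alpha> id"

definition bW_multi ::
    "nat \<Rightarrow> (nat \<Rightarrow> nat) \<Rightarrow> (nat \<Rightarrow> nat) \<Rightarrow> multiword \<Rightarrow>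
      (multiword \<Rightarrow> complex) \<Rightarrow> multiword \<Rightarrow> complex"
  where "bW_multi k m n \<alpha> = foldr (\<lambda>i R. bW_word k m n i (\<alpha> i) \<circ> R) [1..<Suc k] id"


section \<open>Formal series and weighted multi-Toeplitz operators\<close>

type_synonym 'a coeffs = "multiword \<times> multiword \<Rightarrow> 'a \<Rightarrow> 'a"

type_synonym 'a l2_op = "(multiword \<Rightarrow> 'a) \<Rightarrow> multiword \<Rightarrow> 'a"

definition series_term ::
    "nat \<Rightarrow> (nat \<Rightarrow> nat) \<Rightarrow> (nat \<Rightarrow> nat) \<Rightarrow> 'a::chilbert_space coeffs \<Rightarrow>
      multiword \<times> multiword \<Rightarrow> 'a l2_op"
  where "series_term k m n A = (\<lambda>(\<alpha>, \<beta>).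
    tensor_op (Fn k n) (A (\<alpha>, \<beta>))
      (bW_multi k m n \<alpha> \<circ> l2_adjoint (Fn k n) (bW_multi k m n \<beta>)))"

definition q_op ::
    "nat \<Rightarrow> (nat \<Rightarrow> nat) \<Rightarrow> (nat \<Rightarrow> nat) \<Rightarrow> 'a::chilbert_space coeffs \<Rightarrow>
      (nat \<Rightarrow> int) \<Rightarrow> 'a l2_op"
  where "q_op k m n A s = (\<lambda>f \<omega>. \<Sum>p\<in>degree_pairs k n s. series_term k m n A p f \<omega>)"

text \<open>The linear span of the vectors \<open>h \<otimes> e\<^sub>\<alpha>\<close>\<close>

definition poly_space :: "nat \<Rightarrow> (nat \<Rightarrow> nat) \<Rightarrow> (multiword \<Rightarrow> 'a::chilbert_space) set"
  where "poly_space k n =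
    {\<lambda>\<omega>. \<Sum>(h, \<alpha>)\<in>X. c (h, \<alpha>) *\<^sub>C elem_tensor h (l2_basis \<alpha>) \<omega> | c X.
      finite X \<and> X \<subseteq> UNIV \<times> Fn k n}"

text \<open>The sum is unique because vectors vanish outside the index set; the value is meaningful only
  when the series converges. In the equivalence theorem, convergence for the coefficients scaled
  by powers of \<open>r\<close> follows from the WOT-convergence assumed next to it.\<close>

definition series_apply ::
    "nat \<Rightarrow> (nat \<Rightarrow> nat) \<Rightarrow> (nat \<Rightarrow> nat) \<Rightarrow> 'a::chilbert_space coeffs \<Rightarrow>
      (multiword \<Rightarrow> 'a) \<Rightarrow> multiword \<Rightarrow> 'a"
  where "series_apply k m n A p =
    (THE f. l2_has_sum (Fn k n) (\<lambda>j. series_term k m n A j p) (J_pairs k n) f)"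

text \<open>The coefficients of \<open>\<phi>(r W, r W\<^sup>*)\<close>: if \<open>\<bar>\<alpha>\<^sub>i\<bar> = s\<^sub>i\<^sup>+\<close> and \<open>\<bar>\<beta>\<^sub>i\<bar> = s\<^sub>i\<^sup>-\<close>, then
  \<open>\<bar>\<alpha>\<^sub>i\<bar> + \<bar>\<beta>\<^sub>i\<bar> = \<bar>s\<^sub>i\<bar>\<close>.\<close>

definition radial_coeffs :: "nat \<Rightarrow> real \<Rightarrow> 'a::chilbert_space coeffs \<Rightarrow> 'a coeffs"
  where "radial_coeffs k r A = (\<lambda>(\<alpha>, \<beta>) x.
    r ^ (\<Sum>i\<in>{1..k}. length (\<alpha> i) + length (\<beta> i)) *\<^sub>R A (\<alpha>, \<beta>) x)"

definition radial_has_limit ::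
    "nat \<Rightarrow> (nat \<Rightarrow> nat) \<Rightarrow> (nat \<Rightarrow> nat) \<Rightarrow> 'a::chilbert_space coeffs \<Rightarrow> real \<Rightarrow>
      'a l2_op \<Rightarrow> bool"
  where "radial_has_limit k m n A r L \<longleftrightarrow>
    l2_op_iter_sum (Fn k n) [1..<Suc k]
      (\<lambda>s f \<omega>. r ^ (\<Sum>i\<in>{1..k}. nat \<bar>s i\<bar>) *\<^sub>R q_op k m n A s f \<omega>) (\<lambda>_. 0) L"

text \<open>When the series converges, its limit is determined on \<open>l2 (Fn k n)\<close>; it does converge if the
  norms of the \<open>q_op k m n A s\<close> are bounded and \<open>0 \<le> r < 1\<close>.\<close>

definition radial_op ::
    "nat \<Rightarrow> (nat \<Rightarrow> nat) \<Rightarrow> (nat \<Rightarrow> nat) \<Rightarrow> 'a::chilbert_space coeffs \<Rightarrow> real \<Rightarrow> 'a l2_op"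
  where "radial_op k m n A r = (SOME L. radial_has_limit k m n A r L)"

definition multi_toeplitz ::
    "nat \<Rightarrow> (nat \<Rightarrow> nat) \<Rightarrow> (nat \<Rightarrow> nat) \<Rightarrow> 'a::chilbert_space l2_op \<Rightarrow> bool"
  where "multi_toeplitz k m n T \<longleftrightarrow> l2_bounded_op (Fn k n) T \<and>
    (\<exists>B. (\<forall>p\<in>J_pairs k n. bounded_clinear (B p)) \<and>
      (\<forall>\<omega>\<in>Fn k n. \<forall>\<gamma>\<in>Fn k n. \<forall>x y.
        l2_inner (Fn k n) (T (elem_tensor x (l2_basis \<gamma>))) (elem_tensor y (l2_basis \<omega>)) =
          (if (\<omega>, \<gamma>) \<in> comparable_pairs k n
           then complex_of_real (tau k m (\<omega>, \<gamma>)) * cinner (B (simplify_pair k (\<omega>, \<gamma>)) x) y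
           else 0)))"

definition fourier_representation ::
    "nat \<Rightarrow> (nat \<Rightarrow> nat) \<Rightarrow> (nat \<Rightarrow> nat) \<Rightarrow> 'a::chilbert_space coeffs \<Rightarrow> 'a l2_op \<Rightarrow> bool"
  where "fourier_representation k m n A T \<longleftrightarrow>
    (\<forall>p\<in>poly_space k n.
      l2_has_sum (Fn k n) (\<lambda>j. series_term k m n A j p) (J_pairs k n) (T p))"

end

theory Submission
  imports Defs
begin

text \<open>With respect to the orthonormal basis \<open>e\<^sub>\<gamma>\<close>, an operator on \<open>K \<otimes> F\<^sup>2\<close> is a matrix of operators
  on \<open>K\<close>. The formal series \<open>\<phi>\<close> has the matrix with entries \<open>\<tau> A\<^bsub>s(\<omega>, \<gamma>)\<^esub>\<close> at comparable pairs, because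
  \<open>W\<^sub>\<alpha> W\<^sub>\<beta>\<^sup>*\<close> is a weighted partial shift with at most one nonzero entry per row and column. Each of the
  four conditions says that this matrix is bounded, uniformly on finite supports.

  Passing from the matrix to \<open>q\<^sub>s\<close> or to \<open>\<phi>(r W, r W\<^sup>*)\<close> is, one coordinate at a time, a Schur
  multiplication by the indicator of \<open>\<bar>\<omega>\<^sub>i\<bar> - \<bar>\<gamma>\<^sub>i\<bar> = s\<^sub>i\<close> or by \<open>r\<close> to the power \<open>\<bar> \<bar>\<omega>\<^sub>i\<bar> - \<bar>\<gamma>\<^sub>i\<bar> \<bar>\<close>; both
  are contractive since the kernels are inner products of vectors of norm at most one. In the opposite
  direction a uniform bound for the matrices of \<open>\<phi>(r W, r W\<^sup>*)\<close> passes to the limit \<open>r \<rightarrow> 1\<close> on finite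
  supports.\<close>

section \<open>Complex inner products\<close>

text \<open>Many objects here are choices or limits: \<open>tensor_op\<close>,
  \<open>l2_adjoint\<close>, \<open>cadjoint\<close> and \<open>radial_op\<close> are selected by
  \<open>SOME\<close>, \<open>series_apply\<close> by \<open>THE\<close>, and a formal series need
  not converge. They can be computed with only after being pinned down, and what pins down the
  operators is their entries. Boundedness is therefore stated for the matrix alone
  (\<open>mat_bounded\<close>), as an estimate of a sesquilinear form, which makes sense before any
  convergence is known. The constant stays explicit because the norm identity needs the very same
  \<open>C\<close> on both sides of the passage \<open>r -> 1\<close>. The radial series needs two
  different estimates. Convergence comes from summing diagonals: each coordinate costs the factor
  \<open>c\<close>, the sum of \<open>r ^ nat \<bar>j\<bar>\<close> over all integers
  \<open>j\<close>, which equals \<open>(1 + r) / (1 - r)\<close> and so is no uniform bound. The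
  uniform bound comes from the Schur multipliers, which keep \<open>C\<close>. The WOT condition in
  \<open>stmt_i\<close> says that every column of the matrix is square summable; this is what gives
  \<open>series_apply\<close> a meaning there.\<close>

lemma cinner_add_right: "cinner x (y + z) = cinner x y + cinner (x::'a::complex_inner) z"
  by (metis cinner_add_left cinner_commute complex_cnj_add)

lemma cinner_scaleC_right: "cinner x (c *\<^sub>C y) = cnj c * cinner (x::'a::complex_inner) y"
  by (metis cinner_commute cinner_scaleC_left complex_cnj_mult)

lemma cinner_scaleR_left: "cinner (r *\<^sub>R x) y = of_real r * cinner (x::'a::complex_inner) y"
  by (simp add: scaleR_scaleC cinner_scaleC_left)

lemma cinner_scaleR_right: "cinner x (r *\<^sub>R y) = of_real r * cinner (x::'a::complex_inner) y"
  by (simp add: scaleR_scaleC cinner_scaleC_right)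

lemma cinner_zero_left [simp]: "cinner 0 (y::'a::complex_inner) = 0"
  using cinner_scaleR_left[of 0 0 y] by simp

lemma cinner_zero_right [simp]: "cinner (x::'a::complex_inner) 0 = 0"
  using cinner_scaleR_right[of x 0 0] by simp

lemma cinner_diff_left: "cinner (x - y) z = cinner x z - cinner (y::'a::complex_inner) z"
  using cinner_add_left[of "x - y" y z] by simp

lemma cinner_diff_right: "cinner z (x - y) = cinner z x - cinner z (y::'a::complex_inner)"
  using cinner_add_right[of z "x - y" y] by simp

lemma cinner_sum_left: "cinner (sum f I) y = (\<Sum>i\<in>I. cinner (f i) (y::'a::complex_inner))"
  by (induction I rule: infinite_finite_induct) (auto simp: cinner_add_left)

lemma cinner_self: "cinner x x = complex_of_real ((norm (x::'a::complex_inner))\<^sup>2)"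
proof -
  have "Im (cinner x x) = 0"
    using arg_cong[OF cinner_commute[of x x], of Im] by simp
  moreover have "Re (cinner x x) \<ge> 0"
    using norm_ge_zero[of x] unfolding norm_eq_sqrt_cinner by simp
  ultimately show ?thesis
    by (simp add: complex_eq_iff norm_eq_sqrt_cinner)
qed

lemma scaleC_zero_left [simp]: "0 *\<^sub>C (x::'a::complex_inner) = 0"
  using scaleR_scaleC[of 0 x] by simp

lemma scaleC_one [simp]: "1 *\<^sub>C (x::'a::complex_inner) = x"
  using scaleR_scaleC[of 1 x] by simp

lemma scaleC_zero_right [simp]: "c *\<^sub>C (0::'a::complex_inner) = 0"
  using scaleC_add_right[of c 0 "0::'a"] by simp

lemma norm_scaleC: "norm (c *\<^sub>C x) = cmod c * norm (x::'a::complex_inner)"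
proof -
  have "complex_of_real ((norm (c *\<^sub>C x))\<^sup>2) = of_real ((cmod c * norm x)\<^sup>2)"
    unfolding cinner_self[symmetric] cinner_scaleC_left cinner_scaleC_right
    by (simp add: cinner_self power_mult_distrib complex_norm_square del: of_real_power)
  then have "(norm (c *\<^sub>C x))\<^sup>2 = (cmod c * norm x)\<^sup>2" by (simp only: of_real_eq_iff)
  then show ?thesis by simp
qed

lemma scaleC_sum_right: "c *\<^sub>C sum f I = (\<Sum>i\<in>I. c *\<^sub>C (f i::'a::complex_inner))"
  by (induction I rule: infinite_finite_induct) (auto simp: scaleC_add_right)

lemma scaleC_scaleR_commute: "c *\<^sub>C (r *\<^sub>R x) = r *\<^sub>R (c *\<^sub>C (x::'a::complex_inner))"
  by (simp add: scaleR_scaleC scaleC_scaleC mult.commute)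

lemma norm_add_square:
  "(norm (x + y))\<^sup>2 = (norm x)\<^sup>2 + 2 * Re (cinner x y) + (norm (y::'a::complex_inner))\<^sup>2"
proof -
  have "complex_of_real ((norm (x + y))\<^sup>2) = of_real ((norm x)\<^sup>2) + (cinner x y + cnj (cinner x y)) + of_real ((norm y)\<^sup>2)"
    unfolding cinner_self[symmetric] cinner_add_left cinner_add_right
    by (simp add: cinner_commute[of y x])
  then have "Re (complex_of_real ((norm (x + y))\<^sup>2)) = (norm x)\<^sup>2 + 2 * Re (cinner x y) + (norm y)\<^sup>2"
    by (simp del: of_real_power)
  then show ?thesis by (simp del: of_real_power)
qed

lemma cinner_Cauchy_Schwarz: "cmod (cinner x y) \<le> norm x * norm (y::'a::complex_inner)"
proof (cases "y = 0")
  case False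
  define c where "c = cinner x y"
  \<comment> \<open>For this \<open>t\<close> the vector \<open>x - t c y\<close> is orthogonal to
    \<open>y\<close>; that its square norm is nonnegative is the claim.\<close>
  define t where "t = 1 / (norm y)\<^sup>2"
  have "Re (cinner x ((- of_real t * c) *\<^sub>C y)) = - t * (cmod c)\<^sup>2"
    unfolding cinner_scaleC_right c_def[symmetric] cmod_power2 by (simp add: power2_eq_square algebra_simps)
  moreover have "norm ((- of_real t * c) *\<^sub>C y) = t * cmod c * norm y"
    by (simp add: norm_scaleC norm_mult norm_divide norm_power t_def)
  moreover have "0 \<le> (norm (x + (- of_real t * c) *\<^sub>C y))\<^sup>2" by simp
  ultimately have "0 \<le> (norm x)\<^sup>2 - 2 * t * (cmod c)\<^sup>2 + (t * cmod c * norm y)\<^sup>2"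
    by (simp add: norm_add_square)
  also have "\<dots> = (norm x)\<^sup>2 - (cmod c)\<^sup>2 / (norm y)\<^sup>2"
    using False by (simp add: t_def field_simps power2_eq_square)
  finally have "(cmod c)\<^sup>2 / (norm y)\<^sup>2 \<le> (norm x)\<^sup>2" by simp
  then have "(cmod c)\<^sup>2 \<le> (norm x * norm y)\<^sup>2"
    using False by (simp add: divide_le_eq power_mult_distrib)
  then show ?thesis unfolding c_def by (rule power2_le_imp_le) simp
qed simp

lemma cinner_eqI:
  assumes "\<And>y. cinner x y = cinner x' (y::'a::complex_inner)"
  shows "x = x'"
proof -
  have "cinner (x - x') (x - x') = 0" by (simp add: cinner_diff_left assms)
  then show ?thesis by (simp add: cinner_self)
qed

lemma bounded_linear_scaleC: "bounded_linear (\<lambda>x::'a::complex_inner. c *\<^sub>C x)"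
  by (rule bounded_linear_intro[where K = "cmod c"])
     (auto simp: scaleC_add_right scaleC_scaleR_commute norm_scaleC mult.commute)

section \<open>Riesz representation and adjoints\<close>

text \<open>The representing vector is the minimiser of \<open>x \<mapsto> \<parallel>x\<parallel>\<^sup>2 - 2 f x\<close>; a minimising sequence is
  Cauchy by the parallelogram law.\<close>

lemma Riesz_real:
  fixes f :: "'a::chilbert_space \<Rightarrow> real"
  assumes "bounded_linear f"
  obtains u where "\<And>y. f y = Re (cinner y u)"
proof -
  interpret bounded_linear f by fact
  obtain K where K: "\<And>x. norm (f x) \<le> norm x * K" using bounded by blast
  define P where "P x = (norm x)\<^sup>2 - 2 * f x" for x
  have lower: "P x \<ge> - K\<^sup>2" for x
  proof -
    have "2 * f x \<le> 2 * (norm x * K)" using K[of x] by simp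
    moreover have "0 \<le> (norm x - K)\<^sup>2" by simp
    ultimately show ?thesis unfolding P_def by (simp add: power2_eq_square algebra_simps)
  qed
  define I where "I = (INF x. P x)"
  have bdd: "bdd_below (range P)" using lower by (auto intro!: bdd_belowI)
  have I_le: "I \<le> P x" for x unfolding I_def by (rule cINF_lower[OF bdd]) simp
  have par: "(norm (x - y))\<^sup>2 \<le> 2 * (P x - I) + 2 * (P y - I)" for x y
  proof -
    \<comment> \<open>The midpoint competes for the infimum too; this converts near-minimality of
      \<open>x\<close> and \<open>y\<close> into closeness.\<close>
    have "4 * I \<le> 4 * P ((1/2) *\<^sub>R (x + y))" using I_le by simp
    also have "\<dots> = (norm (x + y))\<^sup>2 - 4 * f x - 4 * f y"
    proof -
      define w where "w = (1/2) *\<^sub>R (x + y)"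
      have "4 * (norm w)\<^sup>2 = (norm (x + y))\<^sup>2"
        unfolding w_def by (simp only: norm_scaleR power_mult_distrib) (simp add: power2_eq_square)
      moreover have "8 * f w = 4 * f x + 4 * f y"
        unfolding w_def by (simp only: scale add) simp
      ultimately show ?thesis unfolding P_def w_def[symmetric] by (simp add: algebra_simps)
    qed
    finally have 1: "4 * I \<le> (norm (x + y))\<^sup>2 - 4 * f x - 4 * f y" .
    have "(norm (x - y))\<^sup>2 = 2 * (norm x)\<^sup>2 + 2 * (norm y)\<^sup>2 - (norm (x + y))\<^sup>2"
      using norm_add_square[of x "-y"] norm_add_square[of x y] cinner_diff_right[of x 0 y] by simp
    then show ?thesis using 1 by (simp add: P_def)
  qed
  have ex: "\<exists>x. P x < I + 1 / Suc j" for j :: nat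
    using cINF_less_iff[OF _ bdd, of "I + 1 / Suc j"] unfolding I_def by simp
  then obtain z where z: "\<And>j. P (z j) < I + 1 / Suc j" by metis
  have "Cauchy z"
  proof (rule metric_CauchyI)
    fix e :: real assume e: "e > 0"
    obtain M where M: "1 / Suc M < e\<^sup>2 / 4"
      using reals_Archimedean[of "e\<^sup>2 / 4"] e by (auto simp: inverse_eq_divide)
    show "\<exists>M. \<forall>m\<ge>M. \<forall>n\<ge>M. dist (z m) (z n) < e"
    proof (intro exI allI impI)
      fix m n assume mn: "M \<le> m" "M \<le> n"
      have "1 / Suc m \<le> 1 / Suc M" "1 / Suc n \<le> 1 / Suc M"
        using mn by (auto intro!: divide_left_mono)
      then have "(norm (z m - z n))\<^sup>2 < e\<^sup>2"
        using par[of "z m" "z n"] z[of m] z[of n] M by argo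
      then show "dist (z m) (z n) < e"
        unfolding dist_norm by (rule power2_less_imp_less) (use e in simp)
    qed
  qed
  then obtain u where u: "z \<longlonglongrightarrow> u" using Cauchy_convergent convergent_def by blast
  have "(\<lambda>j. P (z j)) \<longlonglongrightarrow> P u"
    unfolding P_def by (intro tendsto_intros u tendsto)
  moreover have "(\<lambda>j. I + 1 / Suc j) \<longlonglongrightarrow> I + 0"
    by (intro tendsto_intros LIMSEQ_Suc[OF lim_1_over_n])
  ultimately have "P u \<le> I + 0"
    by (rule LIMSEQ_le) (use z in \<open>auto intro: less_imp_le\<close>)
  then have min: "P u \<le> P x" for x using I_le[of x] by simp
  have "f y = Re (cinner y u)" for y
  proof (rule ccontr)
    define d where "d = f y - Re (cinner y u)"
    assume "f y \<noteq> Re (cinner y u)"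
    then have d: "d \<noteq> 0" by (simp add: d_def)
    have yn: "norm y > 0" using d unfolding d_def by (auto simp: zero)
    \<comment> \<open>The quadratic polynomial \<open>t \<mapsto> P (u + t y)\<close> is smallest at
      this \<open>t\<close>; the decrease \<open>d\<^sup>2 / (norm y)\<^sup>2\<close> contradicts
      the minimality of \<open>u\<close>.\<close>
    define t where "t = d / (norm y)\<^sup>2"
    have "P (u + t *\<^sub>R y) = P u - 2 * t * d + t\<^sup>2 * (norm y)\<^sup>2"
      unfolding P_def norm_add_square d_def cinner_commute[of y u]
      by (simp add: add scale cinner_scaleR_right power_mult_distrib algebra_simps)
    also have "\<dots> = P u - d\<^sup>2 / (norm y)\<^sup>2"
      using yn by (simp add: t_def field_simps power2_eq_square)
    also have "\<dots> < P u" using d yn by simp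
    finally show False using min[of "u + t *\<^sub>R y"] by simp
  qed
  then show thesis by (rule that)
qed

text \<open>Riesz representation of \<open>Re (Q x y)\<close> as a functional of \<open>y\<close>
  yields the candidate \<open>S x\<close>. The real part determines everything: \<open>Q\<close> is
  conjugate linear in \<open>y\<close>, so \<open>Re (Q x (\<i> y))\<close> is the imaginary part of
  \<open>Q x y\<close>.\<close>

lemma bounded_sesquilinear_representation:
  fixes Q :: "'a::chilbert_space \<Rightarrow> 'a \<Rightarrow> complex"
  assumes addl: "\<And>x x' y. Q (x + x') y = Q x y + Q x' y"
    and scl: "\<And>c x y. Q (c *\<^sub>C x) y = c * Q x y"
    and addr: "\<And>x y y'. Q x (y + y') = Q x y + Q x y'"
    and scr: "\<And>c x y. Q x (c *\<^sub>C y) = cnj c * Q x y"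
    and bd: "\<And>x y. cmod (Q x y) \<le> C * norm x * norm y"
  obtains S where "bounded_clinear S" "\<And>x y. cinner (S x) y = Q x y"
proof -
  have "\<exists>u. \<forall>y. cinner u y = Q x y" for x
  proof -
    have "bounded_linear (\<lambda>y. Re (Q x y))"
    proof (rule bounded_linear_intro[where K = "C * norm x"])
      fix y show "norm (Re (Q x y)) \<le> norm y * (C * norm x)"
        using bd[of x y] abs_Re_le_cmod[of "Q x y"] by (simp add: algebra_simps)
    qed (auto simp: addr scr scaleR_scaleC)
    then obtain u where u: "\<And>y. Re (Q x y) = Re (cinner y u)" using Riesz_real by blast
    have "cinner u y = Q x y" for y
    proof -
      have "Re (cinner u y) = Re (Q x y)" using u[of y] cinner_commute[of u y] by simp
      moreover have "Im (cinner u y) = Im (Q x y)"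
        using u[of "\<i> *\<^sub>C y"] cinner_commute[of u y] by (simp add: scr cinner_scaleC_left)
      ultimately show ?thesis by (rule complex_eqI)
    qed
    then show ?thesis by blast
  qed
  then obtain S where S: "\<And>x y. cinner (S x) y = Q x y" by metis
  have bC: "norm (S x) \<le> norm x * C" for x
  proof (cases "S x = 0")
    case True
    \<comment> \<open>\<open>C\<close> is not assumed nonnegative, so even this trivial case uses
      the bound, at \<open>y = x\<close>.\<close>
    have "0 \<le> C * norm x * norm x" using bd[of x x] norm_ge_zero order_trans by blast
    then have "0 \<le> C * norm x" by (cases "x = 0") (auto simp: zero_le_mult_iff)
    then show ?thesis using True by (simp add: mult.commute)
  next
    case False
    have "(norm (S x))\<^sup>2 = cmod (Q x (S x))" by (simp add: S[symmetric] cinner_self norm_power)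
    also have "\<dots> \<le> (norm x * C) * norm (S x)" using bd[of x "S x"] by (simp add: mult.commute)
    finally show ?thesis using False by (simp add: power2_eq_square)
  qed
  have sc: "S (c *\<^sub>C x) = c *\<^sub>C S x" for c x
    by (rule cinner_eqI) (simp add: S cinner_scaleC_left scl)
  have ad: "S (x + y) = S x + S y" for x y
    by (rule cinner_eqI) (simp add: S cinner_add_left addl)
  have "bounded_linear S"
    by (rule bounded_linear_intro[where K = C]) (simp_all add: bC scaleR_scaleC sc ad)
  then show thesis using that S sc unfolding bounded_clinear_def by blast
qed

text \<open>\<open>cadjoint\<close> is a choice, so its defining identity requires that an adjoint
  exists. The form \<open>cinner y (A x)\<close> is linear in \<open>y\<close> and conjugate linear
  in \<open>x\<close>; its representing operator is one.\<close>

lemma cinner_cadjoint: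
  fixes A :: "'a::chilbert_space \<Rightarrow> 'a"
  assumes "bounded_clinear A"
  shows "cinner (A x) y = cinner x (cadjoint A y)"
proof -
  have bl: "bounded_linear A" and sc: "\<And>c x. A (c *\<^sub>C x) = c *\<^sub>C A x"
    using assms by (auto simp: bounded_clinear_def)
  obtain K where K: "\<And>x. norm (A x) \<le> norm x * K" using bounded_linear.bounded[OF bl] by blast
  obtain B where B: "\<And>y x. cinner (B y) x = cinner y (A x)"
  proof (rule bounded_sesquilinear_representation[where Q = "\<lambda>y x. cinner y (A x)" and C = K])
    fix x y show "cmod (cinner x (A y)) \<le> K * norm x * norm y"
      using cinner_Cauchy_Schwarz[of x "A y"] mult_left_mono[OF K[of y] norm_ge_zero[of x]]
      by (simp add: algebra_simps)
  qed (auto simp: cinner_add_left cinner_scaleC_left cinner_add_right cinner_scaleC_right sc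
      linear_add[OF bounded_linear.linear[OF bl]])
  have "\<exists>B. \<forall>x y. cinner (A x) y = cinner x (B y)"
    using B by (metis cinner_commute)
  from someI_ex[OF this] show ?thesis unfolding cadjoint_def by blast
qed

section \<open>Square-summable families\<close>

abbreviation "fnorm f X \<equiv> L2_set (\<lambda>i. norm (f i)) X"

lemma L2_set_norm_triangle:
  "L2_set (\<lambda>i. norm (f i + g i)) A \<le> L2_set (\<lambda>i. norm (f i)) A + L2_set (\<lambda>i. norm (g i)) A"
  by (rule order_trans[OF L2_set_mono L2_set_triangle_ineq]) (auto intro: norm_triangle_ineq)

lemma l2_outside: "f \<in> l2 F \<Longrightarrow> \<omega> \<notin> F \<Longrightarrow> f \<omega> = 0"
  by (simp add: l2_def)

lemma l2_summable: "f \<in> l2 F \<Longrightarrow> (\<lambda>\<omega>. (norm (f \<omega>))\<^sup>2) summable_on F"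
  by (simp add: l2_def)

lemma l2_norm_nonneg [simp]: "0 \<le> l2_norm F f"
  unfolding l2_norm_def by (simp add: infsum_nonneg)

lemma l2_norm_square: "(l2_norm F f)\<^sup>2 = (\<Sum>\<^sub>\<infinity>\<omega>\<in>F. (norm (f \<omega>))\<^sup>2)"
  unfolding l2_norm_def by (simp add: infsum_nonneg)

lemma L2_set_le_l2_norm:
  assumes "f \<in> l2 F" "finite X" "X \<subseteq> F"
  shows "fnorm f X \<le> l2_norm F f"
  unfolding L2_set_def l2_norm_def
  by (intro real_sqrt_le_mono finite_sum_le_infsum) (use assms l2_summable in auto)

text \<open>Sums of squares have nonnegative terms, so bounds on finite partial sums suffice.
  Estimates in \<open>l2 F\<close> are thereby reduced to \<open>L2_set\<close>, where the triangle
  inequality and Cauchy-Schwarz are at hand.\<close>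

lemma l2_bounded_finite:
  assumes "\<And>\<omega>. \<omega> \<notin> F \<Longrightarrow> f \<omega> = 0"
    and bd: "\<And>X. finite X \<Longrightarrow> X \<subseteq> F \<Longrightarrow> fnorm f X \<le> B"
  shows "f \<in> l2 F" "l2_norm F f \<le> B"
proof -
  have B: "0 \<le> B" using bd[of "{}"] by simp
  have le: "(\<Sum>\<omega>\<in>X. (norm (f \<omega>))\<^sup>2) \<le> B\<^sup>2" if "finite X" "X \<subseteq> F" for X
    using bd[OF that] B unfolding L2_set_def by (metis real_sqrt_le_iff real_sqrt_abs abs_of_nonneg)
  have s: "(\<lambda>\<omega>. (norm (f \<omega>))\<^sup>2) summable_on F"
    by (rule nonneg_bdd_above_summable_on) (auto intro!: bdd_aboveI le)
  then show "f \<in> l2 F" using assms(1) by (simp add: l2_def)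
  have "(l2_norm F f)\<^sup>2 \<le> B\<^sup>2" unfolding l2_norm_square by (rule infsum_le_finite_sums[OF s le])
  then show "l2_norm F f \<le> B" using B by (simp add: power2_le_iff_abs_le)
qed

lemma norm_le_l2_norm:
  assumes "f \<in> l2 F"
  shows "norm (f \<omega>) \<le> l2_norm F f"
proof (cases "\<omega> \<in> F")
  case True
  then show ?thesis using L2_set_le_l2_norm[OF assms, of "{\<omega>}"] by (simp add: L2_set_def)
qed (simp add: l2_outside[OF assms])

lemma l2_add:
  assumes "f \<in> l2 F" "g \<in> l2 F"
  shows "(\<lambda>\<omega>. f \<omega> + g \<omega>) \<in> l2 F" (is ?A) "l2_norm F (\<lambda>\<omega>. f \<omega> + g \<omega>) \<le> l2_norm F f + l2_norm F g" (is ?B)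
proof -
  have "L2_set (\<lambda>\<omega>. norm (f \<omega> + g \<omega>)) X \<le> l2_norm F f + l2_norm F g" if "finite X" "X \<subseteq> F" for X
    using L2_set_norm_triangle[of f g X] L2_set_le_l2_norm[OF assms(1) that] L2_set_le_l2_norm[OF assms(2) that]
    by linarith
  from l2_bounded_finite[of F "\<lambda>\<omega>. f \<omega> + g \<omega>", OF _ this]
  show ?A ?B
    by (simp_all add: l2_outside[OF assms(1)] l2_outside[OF assms(2)])
qed

lemma l2_zero [simp]: "(\<lambda>_. 0) \<in> l2 F" "l2_norm F (\<lambda>_. 0) = 0"
  by (auto simp: l2_def l2_norm_def)

lemma l2_norm_scaleC: "l2_norm F (\<lambda>\<omega>. c *\<^sub>C f \<omega>) = cmod c * l2_norm F f"
  unfolding l2_norm_def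
  by (simp add: norm_scaleC power_mult_distrib infsum_cmult_right' real_sqrt_mult)

lemma l2_scaleC: "f \<in> l2 F \<Longrightarrow> (\<lambda>\<omega>. c *\<^sub>C f \<omega>) \<in> l2 F"
  by (auto simp: l2_def norm_scaleC power_mult_distrib intro: summable_on_cmult_right)

lemma l2_norm_scaleR: "l2_norm F (\<lambda>\<omega>. r *\<^sub>R f \<omega>) = \<bar>r\<bar> * l2_norm F f"
  by (simp add: scaleR_scaleC l2_norm_scaleC)

lemma l2_scaleR: "f \<in> l2 F \<Longrightarrow> (\<lambda>\<omega>. r *\<^sub>R f \<omega>) \<in> l2 F"
  by (simp add: scaleR_scaleC l2_scaleC)

lemma l2_diff:
  assumes "f \<in> l2 F" "g \<in> l2 F"
  shows "(\<lambda>\<omega>. f \<omega> - g \<omega>) \<in> l2 F" "l2_norm F (\<lambda>\<omega>. f \<omega> - g \<omega>) \<le> l2_norm F f + l2_norm F g"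
  using l2_add[OF assms(1) l2_scaleR[OF assms(2), of "-1"]] l2_norm_scaleR[of F "-1" g] by simp_all

lemma l2_sum:
  assumes "\<And>i. i \<in> I \<Longrightarrow> f i \<in> l2 F"
  shows "(\<lambda>\<omega>. \<Sum>i\<in>I. f i \<omega>) \<in> l2 F"
    "l2_norm F (\<lambda>\<omega>. \<Sum>i\<in>I. f i \<omega>) \<le> (\<Sum>i\<in>I. l2_norm F (f i))"
proof -
  have "(\<lambda>\<omega>. \<Sum>i\<in>I. f i \<omega>) \<in> l2 F \<and> l2_norm F (\<lambda>\<omega>. \<Sum>i\<in>I. f i \<omega>) \<le> (\<Sum>i\<in>I. l2_norm F (f i))"
    using assms
  proof (induction I rule: infinite_finite_induct)
    case (insert i I)
    have 1: "(\<lambda>\<omega>. \<Sum>i\<in>I. f i \<omega>) \<in> l2 F" "l2_norm F (\<lambda>\<omega>. \<Sum>i\<in>I. f i \<omega>) \<le> (\<Sum>i\<in>I. l2_norm F (f i))"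
      using insert by auto
    show ?case
      using l2_add[OF insert.prems[of i] 1(1)] 1(2) insert.hyps by auto
  qed auto
  then show "(\<lambda>\<omega>. \<Sum>i\<in>I. f i \<omega>) \<in> l2 F"
    "l2_norm F (\<lambda>\<omega>. \<Sum>i\<in>I. f i \<omega>) \<le> (\<Sum>i\<in>I. l2_norm F (f i))" by auto
qed

lemma l2_norm_eq_0: "f \<in> l2 F \<Longrightarrow> l2_norm F f = 0 \<Longrightarrow> f = (\<lambda>_. 0)"
  using norm_le_l2_norm[of f F] by auto

lemma l2_cut:
  assumes "f \<in> l2 F"
  shows "(\<lambda>\<omega>. if P \<omega> then f \<omega> else 0) \<in> l2 F" (is ?A) "l2_norm F (\<lambda>\<omega>. if P \<omega> then f \<omega> else 0) \<le> l2_norm F f" (is ?B)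
proof -
  have "L2_set (\<lambda>\<omega>. norm (if P \<omega> then f \<omega> else 0)) X \<le> l2_norm F f" if "finite X" "X \<subseteq> F" for X
    by (rule order_trans[OF L2_set_mono L2_set_le_l2_norm[OF assms that]]) auto
  from l2_bounded_finite[of F "\<lambda>\<omega>. if P \<omega> then f \<omega> else 0", OF _ this]
  show ?A ?B
    by (simp_all add: l2_outside[OF assms])
qed

lemma l2_cut_compl:
  assumes "f \<in> l2 F"
  shows "(\<lambda>\<omega>. if P \<omega> then 0 else f \<omega>) \<in> l2 F"
proof -
  have "(\<lambda>\<omega>. if P \<omega> then 0 else f \<omega>) = (\<lambda>\<omega>. if \<not> P \<omega> then f \<omega> else 0)" by auto
  then show ?thesis using l2_cut(1)[OF assms, of "\<lambda>\<omega>. \<not> P \<omega>"] by simp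
qed

lemma l2_finite_support:
  assumes "finite X" "X \<subseteq> F" "\<And>\<omega>. \<omega> \<notin> X \<Longrightarrow> f \<omega> = 0"
  shows "f \<in> l2 F" "l2_norm F f = fnorm f X"
proof -
  have s: "((\<lambda>\<omega>. (norm (f \<omega>))\<^sup>2) has_sum (\<Sum>\<omega>\<in>X. (norm (f \<omega>))\<^sup>2)) F"
    by (rule has_sum_finite_neutralI) (use assms in auto)
  then show "f \<in> l2 F" unfolding l2_def summable_on_def using assms by blast
  show "l2_norm F f = fnorm f X"
    unfolding l2_norm_def L2_set_def infsumI[OF s] ..
qed

text \<open>The square norm of the tail is the total sum minus a finite partial sum.\<close>

lemma l2_norm_cofinite_tendsto_0:
  assumes "f \<in> l2 F"
  shows "((\<lambda>X. l2_norm F (\<lambda>\<omega>. if \<omega> \<in> X then 0 else f \<omega>)) \<longlongrightarrow> 0) (finite_subsets_at_top F)"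
proof -
  let ?g = "\<lambda>\<omega>. (norm (f \<omega>))\<^sup>2"
  let ?S = "infsum ?g F"
  have s: "?g summable_on F" using assms by (rule l2_summable)
  have "((\<lambda>X. sum ?g X) \<longlongrightarrow> ?S) (finite_subsets_at_top F)"
    using has_sum_infsum[OF s] unfolding has_sum_def .
  then have "((\<lambda>X. sqrt (?S - sum ?g X)) \<longlongrightarrow> sqrt (?S - ?S)) (finite_subsets_at_top F)"
    by (intro tendsto_intros)
  moreover have "\<forall>\<^sub>F X in finite_subsets_at_top F.
      sqrt (?S - sum ?g X) = l2_norm F (\<lambda>\<omega>. if \<omega> \<in> X then 0 else f \<omega>)"
  proof (rule eventually_finite_subsets_at_top_weakI)
    fix X assume X: "finite X" "X \<subseteq> F"
    have "?S - sum ?g X = infsum ?g (F - X)"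
      using infsum_Diff[OF s _ X(2)] X by simp
    also have "\<dots> = infsum (\<lambda>\<omega>. (norm (if \<omega> \<in> X then 0 else f \<omega>))\<^sup>2) F"
      by (rule infsum_cong_neutral) auto
    finally show "sqrt (?S - sum ?g X) = l2_norm F (\<lambda>\<omega>. if \<omega> \<in> X then 0 else f \<omega>)"
      by (simp add: l2_norm_def)
  qed
  ultimately show ?thesis using Lim_transform_eventually by fastforce
qed

lemma l2_norm_cofinite_less:
  assumes "f \<in> l2 F" "e > 0"
  obtains X where "finite X" "X \<subseteq> F" "l2_norm F (\<lambda>\<omega>. if \<omega> \<in> X then 0 else f \<omega>) < e"
  using order_tendstoD(2)[OF l2_norm_cofinite_tendsto_0[OF assms(1)] assms(2)]
  unfolding eventually_finite_subsets_at_top by blast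

section \<open>Inner products and vectors supported at one index\<close>

lemma l2_abs_summable_inner:
  assumes "f \<in> l2 F" "g \<in> l2 F"
  shows "(\<lambda>\<omega>. norm (f \<omega>) * norm (g \<omega>)) summable_on F"
    "infsum (\<lambda>\<omega>. norm (f \<omega>) * norm (g \<omega>)) F \<le> l2_norm F f * l2_norm F g"
proof -
  have le: "(\<Sum>\<omega>\<in>X. norm (f \<omega>) * norm (g \<omega>)) \<le> l2_norm F f * l2_norm F g"
    if "finite X" "X \<subseteq> F" for X
    using L2_set_mult_ineq[of "\<lambda>\<omega>. norm (f \<omega>)" "\<lambda>\<omega>. norm (g \<omega>)" X]
      mult_mono[OF L2_set_le_l2_norm[OF assms(1) that] L2_set_le_l2_norm[OF assms(2) that]] by simp
  show 1: "(\<lambda>\<omega>. norm (f \<omega>) * norm (g \<omega>)) summable_on F"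
    by (rule nonneg_bdd_above_summable_on) (auto intro!: bdd_aboveI le)
  show "infsum (\<lambda>\<omega>. norm (f \<omega>) * norm (g \<omega>)) F \<le> l2_norm F f * l2_norm F g"
    by (rule infsum_le_finite_sums[OF 1 le])
qed

lemma l2_inner_has_sum:
  assumes "f \<in> l2 F" "g \<in> l2 F"
  shows "((\<lambda>\<omega>. cinner (f \<omega>) (g \<omega>)) has_sum l2_inner F f g) F"
    "cmod (l2_inner F f g) \<le> l2_norm F f * l2_norm F g"
proof -
  have a: "(\<lambda>\<omega>. norm (cinner (f \<omega>) (g \<omega>))) summable_on F"
    by (rule Infinite_Sum.abs_summable_on_comparison_test'[OF l2_abs_summable_inner(1)[OF assms]])
       (rule cinner_Cauchy_Schwarz)
  show 1: "((\<lambda>\<omega>. cinner (f \<omega>) (g \<omega>)) has_sum l2_inner F f g) F"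
    unfolding l2_inner_def by (rule has_sum_infsum[OF Infinite_Sum.abs_summable_summable[OF a]])
  have "cmod (l2_inner F f g) \<le> infsum (\<lambda>\<omega>. norm (f \<omega>) * norm (g \<omega>)) F"
    by (rule norm_infsum_le[OF 1 has_sum_infsum[OF l2_abs_summable_inner(1)[OF assms]]])
       (rule cinner_Cauchy_Schwarz)
  then show "cmod (l2_inner F f g) \<le> l2_norm F f * l2_norm F g"
    using l2_abs_summable_inner(2)[OF assms] by linarith
qed

definition l2_single :: "'i \<Rightarrow> 'a::complex_inner \<Rightarrow> 'i \<Rightarrow> 'a"
  where "l2_single \<gamma> x = (\<lambda>\<omega>. if \<omega> = \<gamma> then x else 0)"

lemma elem_tensor_l2_basis: "elem_tensor x (l2_basis \<gamma>) = l2_single \<gamma> x"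
  by (auto simp: elem_tensor_def l2_basis_def l2_single_def)

lemma l2_single:
  assumes "\<gamma> \<in> F"
  shows "l2_single \<gamma> x \<in> l2 F" "l2_norm F (l2_single \<gamma> x) = norm x"
  using l2_finite_support[of "{\<gamma>}" F "l2_single \<gamma> x"] assms
  by (auto simp: l2_single_def L2_set_def)

lemma l2_inner_single_right:
  assumes "\<omega> \<in> F"
  shows "l2_inner F f (l2_single \<omega> y) = cinner (f \<omega>) y"
  unfolding l2_inner_def
  by (rule infsumI, rule has_sum_finite_neutralI[of "{\<omega>}"]) (use assms in \<open>auto simp: l2_single_def\<close>)

lemma finite_support_sum_single:
  assumes "finite X" "\<And>\<omega>. \<omega> \<notin> X \<Longrightarrow> f \<omega> = 0"
  shows "f = (\<lambda>\<omega>. \<Sum>\<gamma>\<in>X. l2_single \<gamma> (f \<gamma>) \<omega>)"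
  using assms by (auto simp: l2_single_def fun_eq_iff)

section \<open>Bounded operators on square-summable families\<close>

lemma l2_bounded_opD:
  assumes "l2_bounded_op F T"
  shows "f \<in> l2 F \<Longrightarrow> T f \<in> l2 F"
    and "f \<in> l2 F \<Longrightarrow> g \<in> l2 F \<Longrightarrow> T (\<lambda>\<omega>. f \<omega> + g \<omega>) = (\<lambda>\<omega>. T f \<omega> + T g \<omega>)"
    and "f \<in> l2 F \<Longrightarrow> T (\<lambda>\<omega>. c *\<^sub>C f \<omega>) = (\<lambda>\<omega>. c *\<^sub>C T f \<omega>)"
  using assms unfolding l2_bounded_op_def by blast+

lemma l2_bounded_op_zero:
  assumes "l2_bounded_op F T"
  shows "T (\<lambda>_. 0) = (\<lambda>_. 0)"
  using l2_bounded_opD(3)[OF assms l2_zero(1), of 0] by simp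

lemma l2_bounded_op_sum:
  assumes T: "l2_bounded_op F T" and f: "\<And>i. i \<in> I \<Longrightarrow> f i \<in> l2 F"
  shows "T (\<lambda>\<omega>. \<Sum>i\<in>I. f i \<omega>) = (\<lambda>\<omega>. \<Sum>i\<in>I. T (f i) \<omega>)"
  using f
proof (induction I rule: infinite_finite_induct)
  case (insert i I)
  then show ?case
    using l2_bounded_opD(2)[OF T, of "f i" "\<lambda>\<omega>. \<Sum>i\<in>I. f i \<omega>"] l2_sum(1)[of I f F] by simp
qed (simp_all add: l2_bounded_op_zero[OF T])

lemma l2_bounded_op_bound:
  assumes "l2_bounded_op F T"
  obtains M where "0 \<le> M" "\<And>f. f \<in> l2 F \<Longrightarrow> l2_norm F (T f) \<le> M * l2_norm F f"
proof -
  obtain M where M: "\<And>f. f \<in> l2 F \<Longrightarrow> l2_norm F (T f) \<le> M * l2_norm F f"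
    using assms unfolding l2_bounded_op_def by blast
  have "l2_norm F (T f) \<le> \<bar>M\<bar> * l2_norm F f" if "f \<in> l2 F" for f
    using order_trans[OF M[OF that] mult_right_mono[OF abs_ge_self[of M] l2_norm_nonneg]] .
  then show thesis using that[of "\<bar>M\<bar>"] by simp
qed

text \<open>A supremum of reals is informative only over a set that is bounded above; this makes
  \<open>l2_opnorm\<close> a genuine operator norm.\<close>

lemma bdd_above_l2_opnorm:
  assumes "l2_bounded_op F T"
  shows "bdd_above ((\<lambda>f. l2_norm F (T f)) ` {f \<in> l2 F. l2_norm F f \<le> 1})"
proof -
  obtain M where M: "0 \<le> M" "\<And>f. f \<in> l2 F \<Longrightarrow> l2_norm F (T f) \<le> M * l2_norm F f"
    using l2_bounded_op_bound[OF assms] by blast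
  show ?thesis
  proof (rule bdd_aboveI2)
    fix f :: "'a \<Rightarrow> 'b" assume "f \<in> {f \<in> l2 F. l2_norm F f \<le> 1}"
    then show "l2_norm F (T f) \<le> M"
      using M(2)[of f] mult_left_mono[of "l2_norm F f" 1 M] M(1) by simp
  qed
qed

lemma l2_opnorm_nonneg:
  assumes "l2_bounded_op F T"
  shows "0 \<le> l2_opnorm F T"
  unfolding l2_opnorm_def
  by (rule cSUP_upper2[OF bdd_above_l2_opnorm[OF assms], of "\<lambda>_. 0"]) auto

lemma l2_norm_le_opnorm:
  assumes T: "l2_bounded_op F T" and f: "f \<in> l2 F"
  shows "l2_norm F (T f) \<le> l2_opnorm F T * l2_norm F f"
proof (cases "l2_norm F f = 0")
  case True
  then show ?thesis using l2_norm_eq_0[OF f] l2_bounded_op_zero[OF T] by simp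
next
  case False
  define c where "c = complex_of_real (1 / l2_norm F f)"
  have c: "cmod c = 1 / l2_norm F f" by (simp add: c_def norm_divide)
  have "l2_norm F (T (\<lambda>\<omega>. c *\<^sub>C f \<omega>)) \<le> l2_opnorm F T"
    unfolding l2_opnorm_def
    by (rule cSUP_upper[OF _ bdd_above_l2_opnorm[OF T]])
       (use False in \<open>simp add: l2_scaleC[OF f] l2_norm_scaleC c\<close>)
  moreover have "l2_norm F (T (\<lambda>\<omega>. c *\<^sub>C f \<omega>)) = l2_norm F (T f) / l2_norm F f"
    by (simp add: l2_bounded_opD(3)[OF T f] l2_norm_scaleC c)
  moreover have "l2_norm F f > 0" using False l2_norm_nonneg[of F f] by linarith
  ultimately show ?thesis by (simp add: divide_le_eq)
qed

lemma l2_opnorm_least: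
  assumes "0 \<le> C" "\<And>f. f \<in> l2 F \<Longrightarrow> l2_norm F (T f) \<le> C * l2_norm F f"
  shows "l2_opnorm F T \<le> C"
  unfolding l2_opnorm_def
proof (rule cSUP_least)
  fix f :: "'a \<Rightarrow> 'b" assume "f \<in> {f \<in> l2 F. l2_norm F f \<le> 1}"
  then show "l2_norm F (T f) \<le> C"
    using assms(2)[of f] mult_left_mono[of "l2_norm F f" 1 C] assms(1) by simp
qed (auto intro: exI[of _ "\<lambda>_. 0"])

lemma l2_bounded_op_finite_sum:
  assumes "\<And>i. i \<in> I \<Longrightarrow> l2_bounded_op F (T i)"
  shows "l2_bounded_op F (\<lambda>f \<omega>. \<Sum>i\<in>I. T i f \<omega>)"
  unfolding l2_bounded_op_def
proof (intro conjI ballI allI)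
  show "\<exists>M. \<forall>f\<in>l2 F. l2_norm F (\<lambda>\<omega>. \<Sum>i\<in>I. T i f \<omega>) \<le> M * l2_norm F f"
  proof (intro exI[of _ "\<Sum>i\<in>I. l2_opnorm F (T i)"] ballI)
    fix f :: "'b \<Rightarrow> 'c" assume f: "f \<in> l2 F"
    have "l2_norm F (\<lambda>\<omega>. \<Sum>i\<in>I. T i f \<omega>) \<le> (\<Sum>i\<in>I. l2_norm F (T i f))"
      by (rule l2_sum(2)) (use assms f l2_bounded_opD(1) in blast)
    also have "\<dots> \<le> (\<Sum>i\<in>I. l2_opnorm F (T i) * l2_norm F f)"
      by (rule sum_mono) (use l2_norm_le_opnorm assms f in blast)
    finally show "l2_norm F (\<lambda>\<omega>. \<Sum>i\<in>I. T i f \<omega>) \<le> (\<Sum>i\<in>I. l2_opnorm F (T i)) * l2_norm F f"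
      by (simp add: sum_distrib_right)
  qed
  fix f :: "'b \<Rightarrow> 'c" assume f: "f \<in> l2 F"
  show "(\<lambda>\<omega>. \<Sum>i\<in>I. T i f \<omega>) \<in> l2 F"
    by (rule l2_sum(1)) (use assms f l2_bounded_opD(1) in blast)
  { fix g :: "'b \<Rightarrow> 'c" assume g: "g \<in> l2 F"
    show "(\<lambda>\<omega>. \<Sum>i\<in>I. T i (\<lambda>\<omega>. f \<omega> + g \<omega>) \<omega>) = (\<lambda>\<omega>. (\<Sum>i\<in>I. T i f \<omega>) + (\<Sum>i\<in>I. T i g \<omega>))"
      unfolding sum.distrib[symmetric]
      by (intro ext sum.cong refl) (simp add: l2_bounded_opD(2)[OF assms f g]) }
  show "(\<lambda>\<omega>. \<Sum>i\<in>I. T i (\<lambda>\<omega>. c *\<^sub>C f \<omega>) \<omega>) = (\<lambda>\<omega>. c *\<^sub>C (\<Sum>i\<in>I. T i f \<omega>))" for c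
    unfolding scaleC_sum_right
    by (intro ext sum.cong refl) (simp add: l2_bounded_opD(3)[OF assms f])
qed

lemma l2_bounded_op_scaleR:
  assumes T: "l2_bounded_op F T"
  shows "l2_bounded_op F (\<lambda>f \<omega>. r *\<^sub>R T f \<omega>)"
  unfolding l2_bounded_op_def
proof (intro conjI ballI allI)
  show "\<exists>M. \<forall>f\<in>l2 F. l2_norm F (\<lambda>\<omega>. r *\<^sub>R T f \<omega>) \<le> M * l2_norm F f"
  proof (intro exI[of _ "\<bar>r\<bar> * l2_opnorm F T"] ballI)
    fix f :: "'a \<Rightarrow> 'b" assume "f \<in> l2 F"
    then show "l2_norm F (\<lambda>\<omega>. r *\<^sub>R T f \<omega>) \<le> \<bar>r\<bar> * l2_opnorm F T * l2_norm F f"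
      using mult_left_mono[OF l2_norm_le_opnorm[OF T], of f "\<bar>r\<bar>"]
      by (simp add: l2_norm_scaleR mult.assoc)
  qed
qed (auto simp: l2_scaleR l2_bounded_opD[OF T] scaleR_add_right scaleC_scaleR_commute)

lemma l2_bounded_op_minus:
  assumes S: "l2_bounded_op F S" and T: "l2_bounded_op F T"
  shows "l2_bounded_op F (\<lambda>f \<omega>. S f \<omega> - T f \<omega>)"
proof -
  have "l2_bounded_op F (\<lambda>f \<omega>. \<Sum>i\<in>UNIV. (if i then S else (\<lambda>f \<omega>. (-1) *\<^sub>R T f \<omega>)) f \<omega>)"
    by (rule l2_bounded_op_finite_sum) (use S l2_bounded_op_scaleR[OF T, of "-1"] in auto)
  then show ?thesis by (simp add: UNIV_bool)
qed

section \<open>Density of the finitely supported vectors\<close>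

text \<open>The operators are bounded uniformly in \<open>r\<close>: a tail of \<open>f\<close>
  costs at most \<open>C\<close> times its small norm, and the rest of \<open>f\<close> is a finite
  sum of vectors \<open>l2_single \<gamma> (f \<gamma>)\<close>. This gives the strong limit later
  and, for a constant family, uniqueness.\<close>

lemma l2_tendsto_0_dense:
  assumes T: "\<forall>\<^sub>F r in net. l2_bounded_op F (T r) \<and> (\<forall>f\<in>l2 F. l2_norm F (T r f) \<le> C * l2_norm F f)"
    and z: "\<And>\<gamma> x. \<gamma> \<in> F \<Longrightarrow> ((\<lambda>r. l2_norm F (T r (l2_single \<gamma> x))) \<longlongrightarrow> 0) net"
    and f: "f \<in> l2 F"
  shows "((\<lambda>r. l2_norm F (T r f)) \<longlongrightarrow> 0) net"
proof (rule tendstoI)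
  fix e :: real assume e: "e > 0"
  \<comment> \<open>The shift by 1 makes the constant positive, so that \<open>e\<close> may be
    divided by it.\<close>
  define C' where "C' = \<bar>C\<bar> + 1"
  have C': "C' > 0" "C \<le> C'" by (auto simp: C'_def)
  obtain X where X: "finite X" "X \<subseteq> F" "l2_norm F (\<lambda>\<omega>. if \<omega> \<in> X then 0 else f \<omega>) < e / (2 * C')"
    using l2_norm_cofinite_less[OF f, of "e / (2 * C')"] e C' by auto
  have "((\<lambda>r. \<Sum>\<gamma>\<in>X. l2_norm F (T r (l2_single \<gamma> (f \<gamma>)))) \<longlongrightarrow> (\<Sum>\<gamma>\<in>X. 0)) net"
    by (intro tendsto_sum z) (use X in auto)
  then have "\<forall>\<^sub>F r in net. (\<Sum>\<gamma>\<in>X. l2_norm F (T r (l2_single \<gamma> (f \<gamma>)))) < e / 2"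
    by (rule order_tendstoD) (use e in simp)
  with T show "\<forall>\<^sub>F r in net. dist (l2_norm F (T r f)) 0 < e"
  proof eventually_elim
    case (elim r)
    let ?g = "\<lambda>\<omega>. if \<omega> \<in> X then 0 else f \<omega>"
    let ?h = "\<lambda>\<omega>. \<Sum>\<gamma>\<in>X. l2_single \<gamma> (f \<gamma>) \<omega>"
    have Tr: "l2_bounded_op F (T r)" using elim by blast
    have g: "?g \<in> l2 F" by (rule l2_cut_compl[OF f])
    have s: "l2_single \<gamma> (f \<gamma>) \<in> l2 F" if "\<gamma> \<in> X" for \<gamma>
      by (rule l2_single(1)) (use X that in auto)
    have h: "?h \<in> l2 F" by (rule l2_sum(1)[OF s])
    have "f = (\<lambda>\<omega>. ?g \<omega> + ?h \<omega>)"
      using X(1) by (auto simp: fun_eq_iff l2_single_def)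
    then have "T r f = (\<lambda>\<omega>. T r ?g \<omega> + T r ?h \<omega>)"
      using l2_bounded_opD(2)[OF Tr g h] by simp
    then have "l2_norm F (T r f) \<le> l2_norm F (T r ?g) + l2_norm F (T r ?h)"
      using l2_add(2)[OF l2_bounded_opD(1)[OF Tr g] l2_bounded_opD(1)[OF Tr h]] by simp
    moreover have "l2_norm F (T r ?g) \<le> e / 2"
    proof -
      have "l2_norm F (T r ?g) \<le> C * l2_norm F ?g" using elim g by blast
      also have "\<dots> \<le> C' * l2_norm F ?g" using C' by (intro mult_right_mono) auto
      also have "\<dots> \<le> C' * (e / (2 * C'))" using X C' by (intro mult_left_mono) auto
      finally show ?thesis using C' by simp
    qed
    moreover have "l2_norm F (T r ?h) < e / 2"
    proof -
      have "l2_norm F (\<lambda>\<omega>. \<Sum>\<gamma>\<in>X. T r (l2_single \<gamma> (f \<gamma>)) \<omega>) \<le> (\<Sum>\<gamma>\<in>X. l2_norm F (T r (l2_single \<gamma> (f \<gamma>))))"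
        by (rule l2_sum(2)[OF l2_bounded_opD(1)[OF Tr s]])
      then show ?thesis
        using elim(2) l2_bounded_op_sum[OF Tr, of X "\<lambda>\<gamma>. l2_single \<gamma> (f \<gamma>)", OF s] by simp
    qed
    ultimately show ?case by (simp add: dist_real_def)
  qed
qed

lemma l2_bounded_op_eqI:
  assumes S: "l2_bounded_op F S" and T: "l2_bounded_op F T"
    and eq: "\<And>\<gamma> x. \<gamma> \<in> F \<Longrightarrow> S (l2_single \<gamma> x) = T (l2_single \<gamma> x)"
    and f: "f \<in> l2 F"
  shows "S f = T f"
proof -
  let ?D = "\<lambda>f \<omega>. S f \<omega> - T f \<omega>"
  have D: "l2_bounded_op F ?D" by (rule l2_bounded_op_minus[OF S T])
  \<comment> \<open>A constant family: its convergence to 0 means that the difference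
    vanishes.\<close>
  have "((\<lambda>r::nat. l2_norm F (?D f)) \<longlongrightarrow> 0) sequentially"
    by (rule l2_tendsto_0_dense[where C = "l2_opnorm F ?D"])
       (use D l2_norm_le_opnorm[OF D] eq f in auto)
  then have "l2_norm F (?D f) = 0" by (simp add: tendsto_const_iff)
  from l2_norm_eq_0[OF l2_bounded_opD(1)[OF D f] this] show ?thesis
    by (metis (no_types, lifting) ext right_minus_eq)
qed

section \<open>Operator matrices\<close>

lemma bounded_clinearD:
  assumes "bounded_clinear A"
  shows "bounded_linear A" "A 0 = 0" "A (x + y) = A x + A y" "A (c *\<^sub>C x) = c *\<^sub>C A x"
    "A (r *\<^sub>R x) = r *\<^sub>R A x" "A (\<Sum>i\<in>I. f i) = (\<Sum>i\<in>I. A (f i))"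
proof -
  show bl: "bounded_linear A" using assms by (simp add: bounded_clinear_def)
  interpret bounded_linear A by fact
  show "A 0 = 0" "A (x + y) = A x + A y" "A (r *\<^sub>R x) = r *\<^sub>R A x"
    "A (\<Sum>i\<in>I. f i) = (\<Sum>i\<in>I. A (f i))"
    by (rule zero add scale sum)+
  show "A (c *\<^sub>C x) = c *\<^sub>C A x" using assms by (simp add: bounded_clinear_def)
qed

lemma bounded_clinear_zero: "bounded_clinear (\<lambda>_. 0)"
  by (simp add: bounded_clinear_def)

lemma bounded_clinear_scaleR: "bounded_clinear A \<Longrightarrow> bounded_clinear (\<lambda>x. r *\<^sub>R A x)"
  by (simp add: bounded_clinear_def bounded_linear_const_scaleR scaleC_scaleR_commute)

abbreviation "mform N X Y f g \<equiv> \<Sum>\<omega>\<in>Y. \<Sum>\<gamma>\<in>X. cinner (N \<omega> \<gamma> (f \<gamma>)) (g \<omega>)"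

text \<open>Only finite supports enter, so boundedness is meaningful before any infinite sum is
  known to converge. \<open>C\<close> is a parameter and not hidden by an existential quantifier,
  because exact norms have to be carried through every construction. Entries outside
  \<open>F\<close> are unconstrained.\<close>

definition mat_bounded :: "'i set \<Rightarrow> ('i \<Rightarrow> 'i \<Rightarrow> 'a::chilbert_space \<Rightarrow> 'a) \<Rightarrow> real \<Rightarrow> bool"
  where "mat_bounded F N C \<longleftrightarrow> 0 \<le> C \<and> (\<forall>\<omega>\<in>F. \<forall>\<gamma>\<in>F. bounded_clinear (N \<omega> \<gamma>)) \<and>
    (\<forall>X Y f g. finite X \<longrightarrow> X \<subseteq> F \<longrightarrow> finite Y \<longrightarrow> Y \<subseteq> F \<longrightarrow>
      cmod (mform N X Y f g) \<le>
        C * fnorm f X * fnorm g Y)"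

lemma mat_boundedI:
  assumes "0 \<le> C" "\<And>\<omega> \<gamma>. \<omega> \<in> F \<Longrightarrow> \<gamma> \<in> F \<Longrightarrow> bounded_clinear (N \<omega> \<gamma>)"
    "\<And>X Y f g. finite X \<Longrightarrow> X \<subseteq> F \<Longrightarrow> finite Y \<Longrightarrow> Y \<subseteq> F \<Longrightarrow>
      cmod (mform N X Y f g) \<le>
        C * fnorm f X * fnorm g Y"
  shows "mat_bounded F N C"
  using assms unfolding mat_bounded_def by blast

lemma mat_boundedD:
  assumes "mat_bounded F N C"
  shows "0 \<le> C" "\<omega> \<in> F \<Longrightarrow> \<gamma> \<in> F \<Longrightarrow> bounded_clinear (N \<omega> \<gamma>)"
    "finite X \<Longrightarrow> X \<subseteq> F \<Longrightarrow> finite Y \<Longrightarrow> Y \<subseteq> F \<Longrightarrow>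
      cmod (mform N X Y f g) \<le>
        C * fnorm f X * fnorm g Y"
  using assms unfolding mat_bounded_def by blast+

lemma mat_bounded_cong:
  assumes "\<And>\<omega> \<gamma>. \<omega> \<in> F \<Longrightarrow> \<gamma> \<in> F \<Longrightarrow> N \<omega> \<gamma> = N' \<omega> \<gamma>" "mat_bounded F N C"
  shows "mat_bounded F N' C"
proof (rule mat_boundedI)
  show "0 \<le> C" using mat_boundedD(1)[OF assms(2)] .
  show "bounded_clinear (N' \<omega> \<gamma>)" if "\<omega> \<in> F" "\<gamma> \<in> F" for \<omega> \<gamma>
    using mat_boundedD(2)[OF assms(2) that] assms(1)[OF that] by simp
  fix X Y f g assume XY: "finite X" "X \<subseteq> F" "finite Y" "Y \<subseteq> F"
  have "(mform N' X Y f g) = (mform N X Y f g)"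
    by (intro sum.cong refl) (use XY assms(1) in \<open>auto simp: subset_iff\<close>)
  then show "cmod (mform N' X Y f g) \<le>
        C * fnorm f X * fnorm g Y"
    using mat_boundedD(3)[OF assms(2) XY] by simp
qed

lemma mat_bounded_mono:
  assumes "mat_bounded F N C" "C \<le> C'"
  shows "mat_bounded F N C'"
proof (rule mat_boundedI)
  show "0 \<le> C'" using mat_boundedD(1)[OF assms(1)] assms(2) by linarith
  fix X Y f g assume XY: "finite X" "X \<subseteq> F" "finite Y" "Y \<subseteq> F"
  show "cmod (mform N X Y f g) \<le>
        C' * fnorm f X * fnorm g Y"
    by (rule order_trans[OF mat_boundedD(3)[OF assms(1) XY]]) (intro mult_right_mono assms(2) L2_set_nonneg)
qed (use mat_boundedD(2)[OF assms(1)] in blast)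

lemma mat_boundedI_norm:
  assumes "0 \<le> C" "\<And>\<omega> \<gamma>. \<omega> \<in> F \<Longrightarrow> \<gamma> \<in> F \<Longrightarrow> bounded_clinear (N \<omega> \<gamma>)"
    and bd: "\<And>X Y f. finite X \<Longrightarrow> X \<subseteq> F \<Longrightarrow> finite Y \<Longrightarrow> Y \<subseteq> F \<Longrightarrow>
      L2_set (\<lambda>\<omega>. norm (\<Sum>\<gamma>\<in>X. N \<omega> \<gamma> (f \<gamma>))) Y \<le> C * fnorm f X"
  shows "mat_bounded F N C"
proof (rule mat_boundedI[OF assms(1,2)])
  fix X Y f g assume XY: "finite X" "X \<subseteq> F" "finite Y" "Y \<subseteq> F"
  let ?h = "\<lambda>\<omega>. \<Sum>\<gamma>\<in>X. N \<omega> \<gamma> (f \<gamma>)"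
  have "cmod (mform N X Y f g) = cmod (\<Sum>\<omega>\<in>Y. cinner (?h \<omega>) (g \<omega>))"
    by (simp add: cinner_sum_left)
  also have "\<dots> \<le> (\<Sum>\<omega>\<in>Y. norm (?h \<omega>) * norm (g \<omega>))"
    by (rule sum_norm_le) (rule cinner_Cauchy_Schwarz)
  also have "\<dots> \<le> fnorm ?h Y * fnorm g Y"
    using L2_set_mult_ineq[of "\<lambda>\<omega>. norm (?h \<omega>)" "\<lambda>\<omega>. norm (g \<omega>)" Y] by simp
  also have "\<dots> \<le> C * fnorm f X * fnorm g Y"
    by (intro mult_right_mono bd[OF XY] L2_set_nonneg)
  finally show "cmod (mform N X Y f g) \<le>
    C * fnorm f X * fnorm g Y" .
qed

text \<open>The form is tested against the image \<open>?h\<close> itself and one factor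
  \<open>?L\<close> is cancelled. Together with \<open>mat_boundedI_norm\<close>, which is
  Cauchy-Schwarz, form bounds and norm bounds agree with the same constant.\<close>

lemma mat_bounded_norm:
  assumes N: "mat_bounded F N C" and XY: "finite X" "X \<subseteq> F" "finite Y" "Y \<subseteq> F"
  shows "L2_set (\<lambda>\<omega>. norm (\<Sum>\<gamma>\<in>X. N \<omega> \<gamma> (f \<gamma>))) Y \<le> C * fnorm f X"
proof -
  let ?h = "\<lambda>\<omega>. \<Sum>\<gamma>\<in>X. N \<omega> \<gamma> (f \<gamma>)"
  let ?L = "fnorm ?h Y"
  have "?L\<^sup>2 = (\<Sum>\<omega>\<in>Y. (norm (?h \<omega>))\<^sup>2)"
    unfolding L2_set_def by (simp add: sum_nonneg)
  also have "\<dots> = cmod (of_real (\<Sum>\<omega>\<in>Y. (norm (?h \<omega>))\<^sup>2))"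
    by (simp add: sum_nonneg del: of_real_sum)
  also have "\<dots> = cmod (\<Sum>\<omega>\<in>Y. \<Sum>\<gamma>\<in>X. cinner (N \<omega> \<gamma> (f \<gamma>)) (?h \<omega>))"
    by (simp only: cinner_sum_left[symmetric] cinner_self of_real_sum)
  also have "\<dots> \<le> C * fnorm f X * ?L"
    by (rule mat_boundedD(3)[OF N XY])
  finally have "?L * ?L \<le> C * fnorm f X * ?L" by (simp add: power2_eq_square)
  then show ?thesis
    using mat_boundedD(1)[OF N] L2_set_nonneg[of "\<lambda>\<omega>. norm (?h \<omega>)" Y]
    by (cases "?L = 0") (auto simp: mult_le_cancel_right)
qed

section \<open>The operator of a bounded matrix\<close>

definition mat_op :: "'i set \<Rightarrow> ('i \<Rightarrow> 'i \<Rightarrow> 'a::chilbert_space \<Rightarrow> 'a) \<Rightarrow> ('i \<Rightarrow> 'a) \<Rightarrow> 'i \<Rightarrow> 'a"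
  where "mat_op F N f = (\<lambda>\<omega>. if \<omega> \<in> F then \<Sum>\<^sub>\<infinity>\<gamma>\<in>F. N \<omega> \<gamma> (f \<gamma>) else 0)"

text \<open>The terms of a row need not be absolutely summable when \<open>'a\<close> is
  infinite-dimensional, hence the Cauchy criterion. Beyond a finite \<open>Z\<close> the partial
  sums change by the row applied to \<open>f\<close> restricted to \<open>X - Z\<close>, which the
  one-row case of \<open>mat_bounded_norm\<close> bounds by the tail of \<open>f\<close>.\<close>

lemma mat_op_summable:
  assumes N: "mat_bounded F N C" and f: "f \<in> l2 F" and w: "\<omega> \<in> F"
  shows "(\<lambda>\<gamma>. N \<omega> \<gamma> (f \<gamma>)) summable_on F"
proof -
  let ?S = "\<lambda>X. \<Sum>\<gamma>\<in>X. N \<omega> \<gamma> (f \<gamma>)"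
  have "cauchy_filter (filtermap ?S (finite_subsets_at_top F))"
    unfolding cauchy_filter_metric_filtermap
  proof (intro allI impI)
    fix e :: real assume e: "e > 0"
    have C: "0 \<le> C" using mat_boundedD(1)[OF N] .
    \<comment> \<open>\<open>C + 1\<close> keeps the denominator positive when \<open>C = 0\<close>
      and makes the final comparison with \<open>e / 2\<close> strict.\<close>
    obtain Z where Z: "finite Z" "Z \<subseteq> F" and Zn: "l2_norm F (\<lambda>\<omega>. if \<omega> \<in> Z then 0 else f \<omega>) < e / (2 * (C + 1))"
      using l2_norm_cofinite_less[OF f, of "e / (2 * (C + 1))"] e C by auto
    have *: "norm (?S X - ?S Z) < e / 2" if X: "finite X" "Z \<subseteq> X" "X \<subseteq> F" for X
    proof -
      have "?S X - ?S Z = ?S (X - Z)" using X by (simp add: sum_diff)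
      then have "norm (?S X - ?S Z) = L2_set (\<lambda>\<omega>. norm (\<Sum>\<gamma>\<in>X - Z. N \<omega> \<gamma> (f \<gamma>))) {\<omega>}"
        by (simp add: L2_set_def)
      also have "\<dots> \<le> C * fnorm f (X - Z)"
        by (rule mat_bounded_norm[OF N]) (use X w in auto)
      also have "fnorm f (X - Z) = L2_set (\<lambda>\<gamma>. norm (if \<gamma> \<in> Z then 0 else f \<gamma>)) (X - Z)"
        by (intro L2_set_cong) auto
      also have "C * \<dots> \<le> C * l2_norm F (\<lambda>\<omega>. if \<omega> \<in> Z then 0 else f \<omega>)"
        by (intro mult_left_mono C L2_set_le_l2_norm l2_cut_compl f) (use X in auto)
      also have "\<dots> \<le> C * (e / (2 * (C + 1)))" using Zn C by (intro mult_left_mono) auto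
      also have "\<dots> < e / 2" using e C by (simp add: field_simps)
      finally show ?thesis .
    qed
    show "\<exists>P. eventually P (finite_subsets_at_top F) \<and> (\<forall>x y. P x \<and> P y \<longrightarrow> dist (?S x) (?S y) < e)"
    proof (intro exI conjI allI impI)
      show "\<forall>\<^sub>F X in finite_subsets_at_top F. finite X \<and> Z \<subseteq> X \<and> X \<subseteq> F"
        unfolding eventually_finite_subsets_at_top using Z by blast
      fix X Y assume "(finite X \<and> Z \<subseteq> X \<and> X \<subseteq> F) \<and> (finite Y \<and> Z \<subseteq> Y \<and> Y \<subseteq> F)"
      then have "norm (?S X - ?S Z) < e / 2" "norm (?S Y - ?S Z) < e / 2" using * by blast+
      then show "dist (?S X) (?S Y) < e"
        unfolding dist_norm
        using norm_triangle_ineq4[of "?S X - ?S Z" "?S Y - ?S Z"] by simp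
    qed
  qed
  then obtain c where "filtermap ?S (finite_subsets_at_top F) \<le> nhds c"
    using cauchy_filter_complete_converges[OF _ complete_UNIV_cuspace]
    by (metis filtermap_bot_iff finite_subsets_at_top_neq_bot principal_UNIV top_greatest)
  then show ?thesis unfolding summable_on_def has_sum_def filterlim_def by blast
qed

lemma mat_op_has_sum:
  assumes "mat_bounded F N C" "f \<in> l2 F" "\<omega> \<in> F"
  shows "((\<lambda>\<gamma>. N \<omega> \<gamma> (f \<gamma>)) has_sum mat_op F N f \<omega>) F"
  using has_sum_infsum[OF mat_op_summable[OF assms]] assms(3) by (simp add: mat_op_def)

lemma mat_op_single:
  assumes N: "\<And>\<gamma>'. \<omega> \<in> F \<Longrightarrow> \<gamma>' \<in> F \<Longrightarrow> bounded_clinear (N \<omega> \<gamma>')" and g: "\<gamma> \<in> F"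
  shows "mat_op F N (l2_single \<gamma> x) \<omega> = (if \<omega> \<in> F then N \<omega> \<gamma> x else 0)"
proof (cases "\<omega> \<in> F")
  case True
  have "((\<lambda>\<gamma>'. N \<omega> \<gamma>' (l2_single \<gamma> x \<gamma>')) has_sum N \<omega> \<gamma> x) F"
    by (rule has_sum_finite_neutralI[of "{\<gamma>}"])
       (use g bounded_clinearD(2)[OF N[OF True]] in \<open>auto simp: l2_single_def\<close>)
  then show ?thesis using True infsumI by (auto simp: mat_op_def)
qed (simp add: mat_op_def)

text \<open>The order of limits matters: a finite set \<open>Y\<close> of rows is fixed, the finite
  sets of columns grow to all of \<open>F\<close>, and only then are all rows taken
  together.\<close>

lemma mat_op_norm:
  assumes N: "mat_bounded F N C" and f: "f \<in> l2 F"
  shows "mat_op F N f \<in> l2 F" "l2_norm F (mat_op F N f) \<le> C * l2_norm F f"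
proof -
  have "L2_set (\<lambda>\<omega>. norm (mat_op F N f \<omega>)) Y \<le> C * l2_norm F f" if Y: "finite Y" "Y \<subseteq> F" for Y
  proof (rule tendsto_upperbound)
    have "((\<lambda>X. \<Sum>\<gamma>\<in>X. N \<omega> \<gamma> (f \<gamma>)) \<longlongrightarrow> mat_op F N f \<omega>) (finite_subsets_at_top F)" if "\<omega> \<in> Y" for \<omega>
      using mat_op_has_sum[OF N f, of \<omega>] Y that unfolding has_sum_def by auto
    then show "((\<lambda>X. L2_set (\<lambda>\<omega>. norm (\<Sum>\<gamma>\<in>X. N \<omega> \<gamma> (f \<gamma>))) Y) \<longlongrightarrow>
        L2_set (\<lambda>\<omega>. norm (mat_op F N f \<omega>)) Y) (finite_subsets_at_top F)"
      unfolding L2_set_def by (intro tendsto_intros)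
    show "\<forall>\<^sub>F X in finite_subsets_at_top F.
        L2_set (\<lambda>\<omega>. norm (\<Sum>\<gamma>\<in>X. N \<omega> \<gamma> (f \<gamma>))) Y \<le> C * l2_norm F f"
    proof (rule eventually_finite_subsets_at_top_weakI)
      fix X assume X: "finite X" "X \<subseteq> F"
      show "L2_set (\<lambda>\<omega>. norm (\<Sum>\<gamma>\<in>X. N \<omega> \<gamma> (f \<gamma>))) Y \<le> C * l2_norm F f"
        by (rule order_trans[OF mat_bounded_norm[OF N X Y]])
           (intro mult_left_mono L2_set_le_l2_norm f X mat_boundedD(1)[OF N])
    qed
  qed auto
  from l2_bounded_finite[OF _ this]
  show "mat_op F N f \<in> l2 F" "l2_norm F (mat_op F N f) \<le> C * l2_norm F f"
    by (simp_all add: mat_op_def)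
qed

lemma mat_op_bounded_op:
  assumes N: "mat_bounded F N C"
  shows "l2_bounded_op F (mat_op F N)"
  unfolding l2_bounded_op_def
proof (intro conjI ballI allI)
  show "\<exists>M. \<forall>f\<in>l2 F. l2_norm F (mat_op F N f) \<le> M * l2_norm F f"
    using mat_op_norm(2)[OF N] by blast
  fix f :: "'a \<Rightarrow> 'b" assume f: "f \<in> l2 F"
  show "mat_op F N f \<in> l2 F" by (rule mat_op_norm(1)[OF N f])
  note lin = bounded_clinearD[OF mat_boundedD(2)[OF N]]
  { fix g :: "'a \<Rightarrow> 'b" assume g: "g \<in> l2 F"
    show "mat_op F N (\<lambda>\<omega>. f \<omega> + g \<omega>) = (\<lambda>\<omega>. mat_op F N f \<omega> + mat_op F N g \<omega>)"
    proof
      fix \<omega>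
      have "((\<lambda>\<gamma>. N \<omega> \<gamma> (f \<gamma> + g \<gamma>)) has_sum mat_op F N f \<omega> + mat_op F N g \<omega>) F" if w: "\<omega> \<in> F"
        using has_sum_add[OF mat_op_has_sum[OF N f w] mat_op_has_sum[OF N g w]]
        by (rule has_sum_cong[THEN iffD1, rotated]) (simp add: lin(3) w)
      then show "mat_op F N (\<lambda>\<omega>. f \<omega> + g \<omega>) \<omega> = mat_op F N f \<omega> + mat_op F N g \<omega>"
        by (auto simp: mat_op_def dest!: infsumI)
    qed }
  fix c
  show "mat_op F N (\<lambda>\<omega>. c *\<^sub>C f \<omega>) = (\<lambda>\<omega>. c *\<^sub>C mat_op F N f \<omega>)"
  proof
    fix \<omega>
    have "((\<lambda>\<gamma>. N \<omega> \<gamma> (c *\<^sub>C f \<gamma>)) has_sum c *\<^sub>C mat_op F N f \<omega>) F" if w: "\<omega> \<in> F"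
      using has_sum_bounded_linear[OF bounded_linear_scaleC mat_op_has_sum[OF N f w]]
      by (rule has_sum_cong[THEN iffD1, rotated]) (simp add: lin(4) w)
    then show "mat_op F N (\<lambda>\<omega>. c *\<^sub>C f \<omega>) \<omega> = c *\<^sub>C mat_op F N f \<omega>"
      by (auto simp: mat_op_def dest!: infsumI)
  qed
qed

section \<open>Operators and their entries\<close>

text \<open>A relation instead of a function extracting entries: operators matter on
  \<open>l2 F\<close> only and are often given by choice, so \<open>T\<close> is tied to a matrix
  through its values on singles, and the matrix stays free outside \<open>F\<close>.\<close>

definition op_entries ::
    "'i set \<Rightarrow> (('i \<Rightarrow> 'a::chilbert_space) \<Rightarrow> 'i \<Rightarrow> 'a) \<Rightarrow> ('i \<Rightarrow> 'i \<Rightarrow> 'a \<Rightarrow> 'a) \<Rightarrow> bool"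
  where "op_entries F T N \<longleftrightarrow> l2_bounded_op F T \<and>
    (\<forall>\<omega>\<in>F. \<forall>\<gamma>\<in>F. bounded_clinear (N \<omega> \<gamma>) \<and> (\<forall>x. T (l2_single \<gamma> x) \<omega> = N \<omega> \<gamma> x))"

lemma op_entriesD:
  assumes "op_entries F T N"
  shows "l2_bounded_op F T" "\<omega> \<in> F \<Longrightarrow> \<gamma> \<in> F \<Longrightarrow> bounded_clinear (N \<omega> \<gamma>)"
    "\<omega> \<in> F \<Longrightarrow> \<gamma> \<in> F \<Longrightarrow> T (l2_single \<gamma> x) \<omega> = N \<omega> \<gamma> x"
  using assms unfolding op_entries_def by auto

lemma op_entriesI:
  assumes "l2_bounded_op F T" "\<And>\<omega> \<gamma>. \<omega> \<in> F \<Longrightarrow> \<gamma> \<in> F \<Longrightarrow> bounded_clinear (N \<omega> \<gamma>)"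
    "\<And>\<omega> \<gamma> x. \<omega> \<in> F \<Longrightarrow> \<gamma> \<in> F \<Longrightarrow> T (l2_single \<gamma> x) \<omega> = N \<omega> \<gamma> x"
  shows "op_entries F T N"
  using assms unfolding op_entries_def by auto

lemma op_entries_mat_op: "mat_bounded F N C \<Longrightarrow> op_entries F (mat_op F N) N"
  by (rule op_entriesI) (simp_all only: mat_op_bounded_op mat_boundedD(2) mat_op_single if_True)

lemma op_entries_finite_support:
  assumes T: "op_entries F T N" and X: "finite X" "X \<subseteq> F" "\<And>\<omega>. \<omega> \<notin> X \<Longrightarrow> f \<omega> = 0" and w: "\<omega> \<in> F"
  shows "T f \<omega> = (\<Sum>\<gamma>\<in>X. N \<omega> \<gamma> (f \<gamma>))"
proof -
  have "T f = T (\<lambda>\<omega>. \<Sum>\<gamma>\<in>X. l2_single \<gamma> (f \<gamma>) \<omega>)"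
    by (rule arg_cong[OF finite_support_sum_single[OF X(1,3)]])
  also have "\<dots> = (\<lambda>\<omega>. \<Sum>\<gamma>\<in>X. T (l2_single \<gamma> (f \<gamma>)) \<omega>)"
    by (rule l2_bounded_op_sum[OF op_entriesD(1)[OF T]]) (use X(2) in \<open>auto intro: l2_single(1)\<close>)
  finally show ?thesis using op_entriesD(3)[OF T w] X(2) by (auto intro!: sum.cong)
qed

lemma op_entries_mat_bounded:
  assumes T: "op_entries F T N" and C: "0 \<le> C" "\<And>f. f \<in> l2 F \<Longrightarrow> l2_norm F (T f) \<le> C * l2_norm F f"
  shows "mat_bounded F N C"
proof (rule mat_boundedI_norm[OF C(1) op_entriesD(2)[OF T]])
  fix X Y and f :: "'a \<Rightarrow> 'b" assume XY: "finite X" "X \<subseteq> F" "finite Y" "Y \<subseteq> F"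
  let ?f = "\<lambda>\<gamma>. if \<gamma> \<in> X then f \<gamma> else 0"
  have f: "?f \<in> l2 F" "l2_norm F ?f = fnorm ?f X"
    by (rule l2_finite_support[OF XY(1,2)]; simp)+
  have "L2_set (\<lambda>\<omega>. norm (\<Sum>\<gamma>\<in>X. N \<omega> \<gamma> (f \<gamma>))) Y = L2_set (\<lambda>\<omega>. norm (T ?f \<omega>)) Y"
    by (intro L2_set_cong refl arg_cong[of _ _ norm])
       (use XY op_entries_finite_support[OF T XY(1,2), of ?f] in auto)
  also have "\<dots> \<le> l2_norm F (T ?f)"
    by (intro L2_set_le_l2_norm l2_bounded_opD(1)[OF op_entriesD(1)[OF T]] f XY)
  also have "\<dots> \<le> C * l2_norm F ?f" by (rule C(2)[OF f(1)])
  also have "l2_norm F ?f = fnorm f X" unfolding f(2) by (intro L2_set_cong) auto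
  finally show "L2_set (\<lambda>\<omega>. norm (\<Sum>\<gamma>\<in>X. N \<omega> \<gamma> (f \<gamma>))) Y \<le> C * fnorm f X" .
qed

lemma op_entries_mat_bounded_opnorm:
  assumes T: "op_entries F T N"
  shows "mat_bounded F N (l2_opnorm F T)"
  by (rule op_entries_mat_bounded[OF T l2_opnorm_nonneg l2_norm_le_opnorm]) (rule op_entriesD(1)[OF T])+

lemma op_entries_eq:
  assumes T: "op_entries F T N" and T': "op_entries F T' N'"
    and eq: "\<And>\<omega> \<gamma>. \<omega> \<in> F \<Longrightarrow> \<gamma> \<in> F \<Longrightarrow> N \<omega> \<gamma> = N' \<omega> \<gamma>" and f: "f \<in> l2 F"
  shows "T f = T' f"
proof (rule l2_bounded_op_eqI[OF op_entriesD(1)[OF T] op_entriesD(1)[OF T'] _ f])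
  fix \<gamma> and x :: 'b assume g: "\<gamma> \<in> F"
  show "T (l2_single \<gamma> x) = T' (l2_single \<gamma> x)"
  proof
    fix \<omega>
    show "T (l2_single \<gamma> x) \<omega> = T' (l2_single \<gamma> x) \<omega>"
    proof (cases "\<omega> \<in> F")
      case False
      then show ?thesis
        using l2_outside l2_bounded_opD(1)[OF op_entriesD(1)[OF T] l2_single(1)[OF g]]
          l2_bounded_opD(1)[OF op_entriesD(1)[OF T'] l2_single(1)[OF g]] by metis
    qed (simp add: op_entriesD(3)[OF T _ g] op_entriesD(3)[OF T' _ g] eq g)
  qed
qed

text \<open>A bounded operator is determined on \<open>l2 F\<close> by its entries, hence agrees
  there with \<open>mat_op F N\<close> and inherits its bound. With
  \<open>op_entries_mat_bounded_opnorm\<close>, the operator norm is the least constant for the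
  matrix.\<close>

lemma op_entries_norm:
  assumes T: "op_entries F T N" and N: "mat_bounded F N C"
  shows "f \<in> l2 F \<Longrightarrow> l2_norm F (T f) \<le> C * l2_norm F f" "l2_opnorm F T \<le> C"
proof -
  show *: "l2_norm F (T f) \<le> C * l2_norm F f" if "f \<in> l2 F" for f
    using mat_op_norm(2)[OF N that] op_entries_eq[OF T op_entries_mat_op[OF N] refl that] by simp
  show "l2_opnorm F T \<le> C" by (rule l2_opnorm_least[OF mat_boundedD(1)[OF N] *])
qed

lemma op_entries_cong:
  assumes "\<And>\<omega> \<gamma>. \<omega> \<in> F \<Longrightarrow> \<gamma> \<in> F \<Longrightarrow> N \<omega> \<gamma> = N' \<omega> \<gamma>" "op_entries F T N"
  shows "op_entries F T N'"
  using assms unfolding op_entries_def by auto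

lemma op_entries_scaleR:
  assumes T: "op_entries F T N"
  shows "op_entries F (\<lambda>f \<omega>. r *\<^sub>R T f \<omega>) (\<lambda>\<omega> \<gamma> x. r *\<^sub>R N \<omega> \<gamma> x)"
  using op_entriesD[OF T] by (intro op_entriesI l2_bounded_op_scaleR bounded_clinear_scaleR) auto

section \<open>Schur multipliers\<close>

text \<open>The form of the entrywise product is the sum over \<open>l\<close> of the form of
  \<open>N\<close> at the vectors \<open>v l \<gamma> *\<^sub>R f \<gamma>\<close> and
  \<open>u l \<omega> *\<^sub>R g \<omega>\<close>; Cauchy-Schwarz in \<open>l\<close> then returns
  the same \<open>C\<close>. The factorization may depend on \<open>X\<close> and \<open>Y\<close>,
  so that finitely many \<open>l\<close> suffice for each block.\<close>

lemma Schur_multiplier_contractive: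
  fixes K :: "'i \<Rightarrow> 'i \<Rightarrow> real"
  assumes N: "mat_bounded F N C"
    and K: "\<And>X Y. finite X \<Longrightarrow> X \<subseteq> F \<Longrightarrow> finite Y \<Longrightarrow> Y \<subseteq> F \<Longrightarrow>
      \<exists>(I::'l set) u v. finite I \<and> (\<forall>\<omega>\<in>Y. (\<Sum>l\<in>I. (u l \<omega>)\<^sup>2) \<le> 1) \<and>
        (\<forall>\<gamma>\<in>X. (\<Sum>l\<in>I. (v l \<gamma>)\<^sup>2) \<le> 1) \<and> (\<forall>\<omega>\<in>Y. \<forall>\<gamma>\<in>X. K \<omega> \<gamma> = (\<Sum>l\<in>I. u l \<omega> * v l \<gamma>))"
  shows "mat_bounded F (\<lambda>\<omega> \<gamma> x. K \<omega> \<gamma> *\<^sub>R N \<omega> \<gamma> x) C"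
proof (rule mat_boundedI[OF mat_boundedD(1)[OF N] bounded_clinear_scaleR[OF mat_boundedD(2)[OF N]]])
  fix X Y and f g :: "'i \<Rightarrow> 'a" assume XY: "finite X" "X \<subseteq> F" "finite Y" "Y \<subseteq> F"
  obtain I :: "'l set" and u v where I: "finite I"
    and u: "\<And>\<omega>. \<omega> \<in> Y \<Longrightarrow> (\<Sum>l\<in>I. (u l \<omega>)\<^sup>2) \<le> 1" and v: "\<And>\<gamma>. \<gamma> \<in> X \<Longrightarrow> (\<Sum>l\<in>I. (v l \<gamma>)\<^sup>2) \<le> 1"
    and K: "\<And>\<omega> \<gamma>. \<omega> \<in> Y \<Longrightarrow> \<gamma> \<in> X \<Longrightarrow> K \<omega> \<gamma> = (\<Sum>l\<in>I. u l \<omega> * v l \<gamma>)"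
    using K[OF XY] by blast
  have C: "0 \<le> C" using mat_boundedD(1)[OF N] .
  let ?f = "\<lambda>l \<gamma>. v l \<gamma> *\<^sub>R f \<gamma>" and ?g = "\<lambda>l \<omega>. u l \<omega> *\<^sub>R g \<omega>"
  let ?n = "\<lambda>f X. L2_set (\<lambda>\<gamma>. norm (f \<gamma> :: 'a)) X"
  \<comment> \<open>Interchanging the sums over \<open>l\<close> and \<open>\<gamma>\<close> shows
    that the rescaled vectors together have at most the square norm of \<open>h\<close>.\<close>
  have avg: "L2_set (\<lambda>l. ?n (\<lambda>\<gamma>. w l \<gamma> *\<^sub>R h \<gamma>) Z) I \<le> ?n h Z"
    if w: "\<And>\<gamma>. \<gamma> \<in> Z \<Longrightarrow> (\<Sum>l\<in>I. (w l \<gamma>)\<^sup>2) \<le> 1" for Z h and w :: "'l \<Rightarrow> 'i \<Rightarrow> real"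
  proof -
    have "(\<Sum>l\<in>I. (?n (\<lambda>\<gamma>. w l \<gamma> *\<^sub>R h \<gamma>) Z)\<^sup>2) = (\<Sum>l\<in>I. \<Sum>\<gamma>\<in>Z. (w l \<gamma>)\<^sup>2 * (norm (h \<gamma>))\<^sup>2)"
      unfolding L2_set_def by (simp add: sum_nonneg power_mult_distrib)
    also have "\<dots> = (\<Sum>\<gamma>\<in>Z. (\<Sum>l\<in>I. (w l \<gamma>)\<^sup>2) * (norm (h \<gamma>))\<^sup>2)"
      by (subst sum.swap) (simp add: sum_distrib_right)
    also have "\<dots> \<le> (\<Sum>\<gamma>\<in>Z. 1 * (norm (h \<gamma>))\<^sup>2)"
      by (intro sum_mono mult_right_mono w) auto
    finally show ?thesis
      unfolding L2_set_def[of _ I] L2_set_def[of "\<lambda>\<gamma>. norm (h \<gamma>)"] by (intro real_sqrt_le_mono) simp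
  qed
  have "(\<Sum>\<omega>\<in>Y. \<Sum>\<gamma>\<in>X. cinner (K \<omega> \<gamma> *\<^sub>R N \<omega> \<gamma> (f \<gamma>)) (g \<omega>)) =
      (\<Sum>\<omega>\<in>Y. \<Sum>\<gamma>\<in>X. \<Sum>l\<in>I. cinner (N \<omega> \<gamma> (?f l \<gamma>)) (?g l \<omega>))"
  proof (intro sum.cong refl)
    fix \<omega> \<gamma> assume wg: "\<omega> \<in> Y" "\<gamma> \<in> X"
    then have bc: "bounded_clinear (N \<omega> \<gamma>)" using mat_boundedD(2)[OF N] XY by blast
    show "cinner (K \<omega> \<gamma> *\<^sub>R N \<omega> \<gamma> (f \<gamma>)) (g \<omega>) = (\<Sum>l\<in>I. cinner (N \<omega> \<gamma> (?f l \<gamma>)) (?g l \<omega>))"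
      by (simp add: K[OF wg] bounded_clinearD(5)[OF bc] cinner_scaleR_left cinner_scaleR_right
          sum_distrib_right mult.assoc)
  qed
  also have "\<dots> = (\<Sum>l\<in>I. \<Sum>\<omega>\<in>Y. \<Sum>\<gamma>\<in>X. cinner (N \<omega> \<gamma> (?f l \<gamma>)) (?g l \<omega>))"
    by (simp add: sum.swap[of _ _ I])
  also have "cmod \<dots> \<le> (\<Sum>l\<in>I. C * (?n (?f l) X * ?n (?g l) Y))"
  proof (rule sum_norm_le)
    fix l
    show "cmod (\<Sum>\<omega>\<in>Y. \<Sum>\<gamma>\<in>X. cinner (N \<omega> \<gamma> (?f l \<gamma>)) (?g l \<omega>)) \<le> C * (?n (?f l) X * ?n (?g l) Y)"
      using mat_boundedD(3)[OF N XY, of "?f l" "?g l"] by (simp only: mult.assoc)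
  qed
  also have "\<dots> \<le> C * (L2_set (\<lambda>l. ?n (?f l) X) I * L2_set (\<lambda>l. ?n (?g l) Y) I)"
    unfolding sum_distrib_left[symmetric]
    using L2_set_mult_ineq[of "\<lambda>l. ?n (?f l) X" "\<lambda>l. ?n (?g l) Y" I] C
    by (intro mult_left_mono) auto
  also have "\<dots> \<le> C * (?n f X * ?n g Y)"
    by (intro mult_left_mono mult_mono avg u v C) auto
  finally show "cmod (\<Sum>\<omega>\<in>Y. \<Sum>\<gamma>\<in>X. cinner (K \<omega> \<gamma> *\<^sub>R N \<omega> \<gamma> (f \<gamma>)) (g \<omega>)) \<le> C * ?n f X * ?n g Y"
    by (simp add: mult.assoc)
qed

text \<open>The indicator is the inner product of the standard unit vectors with indices
  \<open>int (lev \<omega>)\<close> and \<open>int (lev \<gamma>) + s\<close>. The index is an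
  integer because the second one may be negative.\<close>

lemma Schur_multiplier_level:
  fixes lev :: "'i \<Rightarrow> nat" and s :: int
  assumes N: "mat_bounded F N C"
  shows "mat_bounded F (\<lambda>\<omega> \<gamma> x. (if int (lev \<omega>) - int (lev \<gamma>) = s then 1 else 0) *\<^sub>R N \<omega> \<gamma> x) C"
proof (rule Schur_multiplier_contractive[OF N, where 'l = int])
  fix X Y :: "'i set" assume XY: "finite X" "finite Y"
  let ?u = "\<lambda>l \<omega>. if int (lev \<omega>) = l then 1 else 0 :: real"
  let ?v = "\<lambda>l \<gamma>. if int (lev \<gamma>) + s = l then 1 else 0 :: real"
  let ?I = "(\<lambda>\<omega>. int (lev \<omega>)) ` Y \<union> (\<lambda>\<gamma>. int (lev \<gamma>) + s) ` X"
  show "\<exists>I u v. finite (I :: int set) \<and> (\<forall>\<omega>\<in>Y. (\<Sum>l\<in>I. (u l \<omega>)\<^sup>2) \<le> 1) \<and>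
        (\<forall>\<gamma>\<in>X. (\<Sum>l\<in>I. (v l \<gamma>)\<^sup>2) \<le> (1::real)) \<and>
        (\<forall>\<omega>\<in>Y. \<forall>\<gamma>\<in>X. (if int (lev \<omega>) - int (lev \<gamma>) = s then 1 else 0) = (\<Sum>l\<in>I. u l \<omega> * v l \<gamma>))"
  proof (rule exI[of _ ?I], rule exI[of _ ?u], rule exI[of _ ?v], intro conjI ballI)
    have I: "finite ?I" using XY by simp
    then show "finite ?I" .
    have sq: "(if P then 1 else 0 :: real)\<^sup>2 = (if P then 1 else 0)" for P by simp
    show "(\<Sum>l\<in>?I. (?u l \<omega>)\<^sup>2) \<le> 1" for \<omega> unfolding sq by (subst sum.delta'[OF I]) simp
    show "(\<Sum>l\<in>?I. (?v l \<gamma>)\<^sup>2) \<le> 1" for \<gamma> unfolding sq by (subst sum.delta'[OF I]) simp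
    fix \<omega> \<gamma> assume "\<omega> \<in> Y" "\<gamma> \<in> X"
    have "(\<Sum>l\<in>?I. ?u l \<omega> * ?v l \<gamma>) = (\<Sum>l\<in>?I. if l = int (lev \<omega>) then ?v l \<gamma> else 0)"
      by (intro sum.cong) auto
    also have "\<dots> = ?v (int (lev \<omega>)) \<gamma>" using \<open>\<omega> \<in> Y\<close> by (subst sum.delta[OF I]) auto
    finally show "(if int (lev \<omega>) - int (lev \<gamma>) = s then 1 else 0) = (\<Sum>l\<in>?I. ?u l \<omega> * ?v l \<gamma>)" by auto
  qed
qed

text \<open>The kernel \<open>r ^ \<bar>a - b\<bar>\<close> on the natural numbers is the Gram matrix of the unit vectors
  \<open>(r\<^sup>a, c r\<^bsup>a-1\<^esup>, \<dots>, c r\<^sup>0, 0, \<dots>)\<close> with \<open>c\<^sup>2 = 1 - r\<^sup>2\<close>.\<close>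

lemma power_abs_diff_Gram:
  fixes r :: real
  assumes r: "0 \<le> r" "r \<le> 1" and ab: "a \<le> b" "b \<le> L"
  defines "c \<equiv> \<lambda>(l::nat) a. if l = 0 then r ^ a else if l \<le> a then sqrt (1 - r\<^sup>2) * r ^ (a - l) else 0"
  shows "(\<Sum>l\<in>{..L}. c l a * c l b) = r ^ (b - a)"
proof -
  have r2: "r\<^sup>2 \<le> 1" using r by (simp add: power_le_one)
  have "(\<Sum>l\<in>{..L}. c l a * c l b) = c 0 a * c 0 b + (\<Sum>l\<in>{1..L}. c l a * c l b)"
    by (simp add: sum.atMost_shift sum.atLeast1_atMost_eq lessThan_Suc_atMost)
  also have "(\<Sum>l\<in>{1..L}. c l a * c l b) = (\<Sum>l\<in>{1..a}. (1 - r\<^sup>2) * r ^ (a - l) * r ^ (b - l))"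
    by (rule sum.mono_neutral_cong_right) (use ab r2 in \<open>auto simp: c_def\<close>)
  also have "\<dots> = (\<Sum>l\<in>{1..a}. (1 - r\<^sup>2) * r ^ (b - a) * (r\<^sup>2) ^ (a - l))"
  proof (intro sum.cong refl)
    fix l assume "l \<in> {1..a}"
    then have "b - l = (b - a) + (a - l)" using ab by auto
    then show "(1 - r\<^sup>2) * r ^ (a - l) * r ^ (b - l) = (1 - r\<^sup>2) * r ^ (b - a) * (r\<^sup>2) ^ (a - l)"
      by (simp add: power_add power2_eq_square power_mult_distrib)
  qed
  also have "\<dots> = r ^ (b - a) * ((1 - r\<^sup>2) * (\<Sum>l\<in>{1..a}. (r\<^sup>2) ^ (a - l)))"
    by (simp add: sum_distrib_left mult_ac)
  also have "(\<Sum>l\<in>{1..a}. (r\<^sup>2) ^ (a - l)) = (\<Sum>l<a. (r\<^sup>2) ^ l)"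
    by (rule sum.reindex_bij_witness[of _ "\<lambda>l. a - l" "\<lambda>l. a - l"]) auto
  also have "(1 - r\<^sup>2) * (\<Sum>l<a. (r\<^sup>2) ^ l) = 1 - (r\<^sup>2) ^ a"
    by (rule one_diff_power_eq[symmetric])
  \<comment> \<open>Coordinate 0 contributes \<open>r ^ (a + b)\<close>, exactly what the finite
    geometric sum leaves over.\<close>
  also have "c 0 a * c 0 b + r ^ (b - a) * (1 - (r\<^sup>2) ^ a) = r ^ (b - a)"
  proof -
    have "r ^ b = r ^ (b - a) * r ^ a" using ab by (simp flip: power_add)
    then show ?thesis by (simp add: c_def power2_eq_square power_mult_distrib algebra_simps)
  qed
  finally show ?thesis .
qed

text \<open>The vectors of \<open>power_abs_diff_Gram\<close> serve on both sides, and the case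
  \<open>a = b\<close> gives them norm one. Truncation at \<open>L\<close> is harmless because all
  levels in \<open>X \<union> Y\<close> are at most \<open>L\<close>.\<close>

lemma Schur_multiplier_radial:
  fixes lev :: "'i \<Rightarrow> nat"
  assumes N: "mat_bounded F N C" and r: "0 \<le> r" "r \<le> 1"
  shows "mat_bounded F (\<lambda>\<omega> \<gamma> x. r ^ nat \<bar>int (lev \<omega>) - int (lev \<gamma>)\<bar> *\<^sub>R N \<omega> \<gamma> x) C"
proof (rule Schur_multiplier_contractive[OF N, where 'l = nat])
  fix X Y :: "'i set" assume XY: "finite X" "finite Y"
  define c where "c = (\<lambda>(l::nat) a. if l = 0 then r ^ a else if l \<le> a then sqrt (1 - r\<^sup>2) * r ^ (a - l) else 0)"
  obtain L where L: "\<And>\<omega>. \<omega> \<in> X \<union> Y \<Longrightarrow> lev \<omega> \<le> L"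
    using XY finite_nat_set_iff_bounded_le[of "lev ` (X \<union> Y)"] by auto
  have G: "(\<Sum>l\<in>{..L}. c l a * c l b) = r ^ nat \<bar>int a - int b\<bar>" if "a \<le> L" "b \<le> L" for a b
  proof (cases "a \<le> b")
    case True
    then have "nat \<bar>int a - int b\<bar> = b - a" by auto
    then show ?thesis using power_abs_diff_Gram[OF r True that(2)] by (simp only: c_def)
  next
    case False
    then have "nat \<bar>int a - int b\<bar> = a - b" by auto
    then show ?thesis
      using power_abs_diff_Gram[OF r _ that(1), of b] False by (simp only: c_def mult.commute linear)
  qed
  show "\<exists>I u v. finite (I :: nat set) \<and> (\<forall>\<omega>\<in>Y. (\<Sum>l\<in>I. (u l \<omega>)\<^sup>2) \<le> 1) \<and>
        (\<forall>\<gamma>\<in>X. (\<Sum>l\<in>I. (v l \<gamma>)\<^sup>2) \<le> (1::real)) \<and>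
        (\<forall>\<omega>\<in>Y. \<forall>\<gamma>\<in>X. r ^ nat \<bar>int (lev \<omega>) - int (lev \<gamma>)\<bar> = (\<Sum>l\<in>I. u l \<omega> * v l \<gamma>))"
    by (rule exI[of _ "{..L}"], rule exI[of _ "\<lambda>l \<omega>. c l (lev \<omega>)"], rule exI[of _ "\<lambda>l \<omega>. c l (lev \<omega>)"])
       (simp add: G L power2_eq_square)
qed

section \<open>Bounded matrices from diagonals, limits and partial injections\<close>

text \<open>A finite block meets only finitely many classes \<open>d \<omega> \<gamma> = j\<close>,
  so the triangle inequality over the finite set \<open>Z\<close> applies and \<open>S\<close> has
  to dominate finite sums of \<open>c\<close> only.\<close>

lemma mat_bounded_sum_components:
  fixes d :: "'i \<Rightarrow> 'i \<Rightarrow> 'j"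
  assumes bc: "\<And>\<omega> \<gamma>. \<omega> \<in> F \<Longrightarrow> \<gamma> \<in> F \<Longrightarrow> bounded_clinear (N \<omega> \<gamma>)"
    and comp: "\<And>j. j \<in> J \<Longrightarrow> mat_bounded F (\<lambda>\<omega> \<gamma> x. if d \<omega> \<gamma> = j then N \<omega> \<gamma> x else 0) (c j)"
    and out: "\<And>\<omega> \<gamma> x. \<omega> \<in> F \<Longrightarrow> \<gamma> \<in> F \<Longrightarrow> d \<omega> \<gamma> \<notin> J \<Longrightarrow> N \<omega> \<gamma> x = 0"
    and c: "\<And>Z. finite Z \<Longrightarrow> Z \<subseteq> J \<Longrightarrow> sum c Z \<le> S"
  shows "mat_bounded F N S"
proof (rule mat_boundedI[OF _ bc])
  show "0 \<le> S" using c[of "{}"] by simp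
  fix X Y and f g :: "'i \<Rightarrow> 'a" assume XY: "finite X" "X \<subseteq> F" "finite Y" "Y \<subseteq> F"
  let ?n = "fnorm f X * fnorm g Y"
  define Z where "Z = (\<lambda>(\<omega>, \<gamma>). d \<omega> \<gamma>) ` (Y \<times> X) \<inter> J"
  have Z: "finite Z" "Z \<subseteq> J" unfolding Z_def using XY by auto
  have "(mform N X Y f g) =
     (\<Sum>\<omega>\<in>Y. \<Sum>\<gamma>\<in>X. \<Sum>j\<in>Z. cinner (if d \<omega> \<gamma> = j then N \<omega> \<gamma> (f \<gamma>) else 0) (g \<omega>))"
  proof (intro sum.cong refl)
    fix \<omega> \<gamma> assume wg: "\<omega> \<in> Y" "\<gamma> \<in> X"
    have "(\<Sum>j\<in>Z. cinner (if d \<omega> \<gamma> = j then N \<omega> \<gamma> (f \<gamma>) else 0) (g \<omega>)) =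
        (\<Sum>j\<in>Z. if j = d \<omega> \<gamma> then cinner (N \<omega> \<gamma> (f \<gamma>)) (g \<omega>) else 0)"
      by (intro sum.cong) auto
    also have "\<dots> = cinner (N \<omega> \<gamma> (f \<gamma>)) (g \<omega>)"
    proof (cases "d \<omega> \<gamma> \<in> J")
      case True
      then have "d \<omega> \<gamma> \<in> Z" unfolding Z_def using wg by auto
      then show ?thesis using Z by simp
    next
      case False
      then have "N \<omega> \<gamma> (f \<gamma>) = 0" by (intro out) (use wg XY in auto)
      then show ?thesis by (intro trans[OF sum.neutral]) auto
    qed
    finally show "cinner (N \<omega> \<gamma> (f \<gamma>)) (g \<omega>) =
      (\<Sum>j\<in>Z. cinner (if d \<omega> \<gamma> = j then N \<omega> \<gamma> (f \<gamma>) else 0) (g \<omega>))" ..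
  qed
  also have "\<dots> = (\<Sum>j\<in>Z. \<Sum>\<omega>\<in>Y. \<Sum>\<gamma>\<in>X. cinner (if d \<omega> \<gamma> = j then N \<omega> \<gamma> (f \<gamma>) else 0) (g \<omega>))"
    by (simp add: sum.swap[of _ _ Z])
  also have "cmod \<dots> \<le> (\<Sum>j\<in>Z. c j * ?n)"
    using mat_boundedD(3)[OF comp XY] Z by (intro sum_norm_le) (auto simp: mult.assoc)
  also have "\<dots> = sum c Z * ?n" by (rule sum_distrib_right[symmetric])
  also have "\<dots> \<le> S * ?n" by (intro mult_right_mono c Z) auto
  finally show "cmod (mform N X Y f g) \<le>
    S * fnorm f X * fnorm g Y" by (simp add: mult.assoc)
qed

text \<open>On a fixed finite block the form is a polynomial in \<open>r\<close>, hence continuous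
  at 1, and \<open>C\<close> is independent of the block.\<close>

lemma mat_bounded_radial_limit:
  fixes e :: "'i \<Rightarrow> 'i \<Rightarrow> nat"
  assumes bc: "\<And>\<omega> \<gamma>. \<omega> \<in> F \<Longrightarrow> \<gamma> \<in> F \<Longrightarrow> bounded_clinear (N \<omega> \<gamma>)"
    and N: "\<And>r::real. 0 \<le> r \<Longrightarrow> r < 1 \<Longrightarrow> mat_bounded F (\<lambda>\<omega> \<gamma> x. r ^ e \<omega> \<gamma> *\<^sub>R N \<omega> \<gamma> x) C"
  shows "mat_bounded F N C"
proof (rule mat_boundedI[OF mat_boundedD(1)[OF N[of 0]] bc])
  fix X Y and f g :: "'i \<Rightarrow> 'a" assume XY: "finite X" "X \<subseteq> F" "finite Y" "Y \<subseteq> F"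
  show "cmod (mform N X Y f g) \<le>
    C * fnorm f X * fnorm g Y" (is "_ \<le> ?B")
  proof (rule tendsto_upperbound)
    have "((\<lambda>r::real. r) \<longlongrightarrow> 1) (at_left 1)" by (rule tendsto_ident_at)
    then have "((\<lambda>r. cmod (\<Sum>\<omega>\<in>Y. \<Sum>\<gamma>\<in>X. of_real (r ^ e \<omega> \<gamma>) * cinner (N \<omega> \<gamma> (f \<gamma>)) (g \<omega>))) \<longlongrightarrow>
       cmod (\<Sum>\<omega>\<in>Y. \<Sum>\<gamma>\<in>X. of_real (1 ^ e \<omega> \<gamma>) * cinner (N \<omega> \<gamma> (f \<gamma>)) (g \<omega>))) (at_left 1)"
      by (intro tendsto_intros)
    then show "((\<lambda>r. cmod (\<Sum>\<omega>\<in>Y. \<Sum>\<gamma>\<in>X. cinner (r ^ e \<omega> \<gamma> *\<^sub>R N \<omega> \<gamma> (f \<gamma>)) (g \<omega>))) \<longlongrightarrow>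
      cmod (mform N X Y f g)) (at_left 1)"
      by (simp add: cinner_scaleR_left)
    have "\<forall>\<^sub>F r in at_left (1::real). 0 < r \<and> r < 1"
      using eventually_at_left_real[of 0 1] by (auto elim: eventually_mono)
    then show "\<forall>\<^sub>F r in at_left 1. cmod (\<Sum>\<omega>\<in>Y. \<Sum>\<gamma>\<in>X. cinner (r ^ e \<omega> \<gamma> *\<^sub>R N \<omega> \<gamma> (f \<gamma>)) (g \<omega>)) \<le> ?B"
      by eventually_elim (rule mat_boundedD(3)[OF N XY]; simp)
  qed simp
qed simp_all

text \<open>The positions in a block that satisfy \<open>P\<close> project injectively to rows and
  to columns, so Cauchy-Schwarz over these positions yields at most the two full norms.\<close>

lemma mat_bounded_partial_injection:
  assumes C: "0 \<le> C" and bc: "\<And>\<omega> \<gamma>. \<omega> \<in> F \<Longrightarrow> \<gamma> \<in> F \<Longrightarrow> bounded_clinear (N \<omega> \<gamma>)"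
    and le: "\<And>\<omega> \<gamma> x. \<omega> \<in> F \<Longrightarrow> \<gamma> \<in> F \<Longrightarrow> norm (N \<omega> \<gamma> x) \<le> C * norm x"
    and P: "\<And>\<omega> \<gamma> x. \<omega> \<in> F \<Longrightarrow> \<gamma> \<in> F \<Longrightarrow> \<not> P \<omega> \<gamma> \<Longrightarrow> N \<omega> \<gamma> x = 0"
    and row: "\<And>\<omega> \<gamma> \<gamma>'. \<omega> \<in> F \<Longrightarrow> \<gamma> \<in> F \<Longrightarrow> \<gamma>' \<in> F \<Longrightarrow> P \<omega> \<gamma> \<Longrightarrow> P \<omega> \<gamma>' \<Longrightarrow> \<gamma> = \<gamma>'"
    and col: "\<And>\<omega> \<omega>' \<gamma>. \<omega> \<in> F \<Longrightarrow> \<omega>' \<in> F \<Longrightarrow> \<gamma> \<in> F \<Longrightarrow> P \<omega> \<gamma> \<Longrightarrow> P \<omega>' \<gamma> \<Longrightarrow> \<omega> = \<omega>'"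
  shows "mat_bounded F N C"
proof (rule mat_boundedI[OF C bc])
  fix X Y and f g :: "'a \<Rightarrow> 'b" assume XY: "finite X" "X \<subseteq> F" "finite Y" "Y \<subseteq> F"
  define E where "E = {(\<omega>, \<gamma>). \<omega> \<in> Y \<and> \<gamma> \<in> X \<and> P \<omega> \<gamma>}"
  have E: "E \<subseteq> Y \<times> X" by (auto simp: E_def)
  have injf: "inj_on fst E" and injs: "inj_on snd E"
    using row col XY by (auto simp: inj_on_def E_def subset_iff)
  have "(mform N X Y f g) = (\<Sum>(\<omega>, \<gamma>)\<in>Y \<times> X. cinner (N \<omega> \<gamma> (f \<gamma>)) (g \<omega>))"
    by (rule sum.cartesian_product)
  also have "\<dots> = (\<Sum>(\<omega>, \<gamma>)\<in>E. cinner (N \<omega> \<gamma> (f \<gamma>)) (g \<omega>))"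
  proof (rule sum.mono_neutral_right)
    show "\<forall>p\<in>Y \<times> X - E. (case p of (\<omega>, \<gamma>) \<Rightarrow> cinner (N \<omega> \<gamma> (f \<gamma>)) (g \<omega>)) = 0"
    proof clarify
      fix \<omega> \<gamma> assume "\<omega> \<in> Y" "\<gamma> \<in> X" "(\<omega>, \<gamma>) \<notin> E"
      then have "N \<omega> \<gamma> (f \<gamma>) = 0" by (intro P) (use XY in \<open>auto simp: E_def\<close>)
      then show "cinner (N \<omega> \<gamma> (f \<gamma>)) (g \<omega>) = 0" by simp
    qed
  qed (use XY E in auto)
  also have "cmod \<dots> \<le> (\<Sum>(\<omega>, \<gamma>)\<in>E. C * (norm (f \<gamma>) * norm (g \<omega>)))"
  proof (rule sum_norm_le, clarify)
    fix \<omega> \<gamma> assume "(\<omega>, \<gamma>) \<in> E"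
    then have "\<omega> \<in> F" "\<gamma> \<in> F" using XY E by auto
    then show "cmod (cinner (N \<omega> \<gamma> (f \<gamma>)) (g \<omega>)) \<le> C * (norm (f \<gamma>) * norm (g \<omega>))"
      using cinner_Cauchy_Schwarz[of "N \<omega> \<gamma> (f \<gamma>)" "g \<omega>"]
        mult_right_mono[OF le[of \<omega> \<gamma> "f \<gamma>"] norm_ge_zero[of "g \<omega>"]] by (simp add: mult.assoc)
  qed
  also have "\<dots> = C * (\<Sum>p\<in>E. \<bar>norm (f (snd p))\<bar> * \<bar>norm (g (fst p))\<bar>)"
    by (simp add: sum_distrib_left case_prod_beta)
  also have "\<dots> \<le> C * (L2_set (\<lambda>p. norm (f (snd p))) E * L2_set (\<lambda>p. norm (g (fst p))) E)"
    by (rule mult_left_mono[OF L2_set_mult_ineq C])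
  also have "\<dots> \<le> C * (fnorm f X * fnorm g Y)"
  proof (intro mult_left_mono[OF _ C] mult_mono)
    have "(\<Sum>p\<in>E. (norm (f (snd p)))\<^sup>2) = (\<Sum>\<gamma>\<in>snd ` E. (norm (f \<gamma>))\<^sup>2)"
      by (simp add: sum.reindex[OF injs])
    also have "\<dots> \<le> (\<Sum>\<gamma>\<in>X. (norm (f \<gamma>))\<^sup>2)" using E XY by (intro sum_mono2) auto
    finally show "L2_set (\<lambda>p. norm (f (snd p))) E \<le> fnorm f X"
      unfolding L2_set_def by (rule real_sqrt_le_mono)
    have "(\<Sum>p\<in>E. (norm (g (fst p)))\<^sup>2) = (\<Sum>\<gamma>\<in>fst ` E. (norm (g \<gamma>))\<^sup>2)"
      by (simp add: sum.reindex[OF injf])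
    also have "\<dots> \<le> (\<Sum>\<gamma>\<in>Y. (norm (g \<gamma>))\<^sup>2)" using E XY by (intro sum_mono2) auto
    finally show "L2_set (\<lambda>p. norm (g (fst p))) E \<le> fnorm g Y"
      unfolding L2_set_def by (rule real_sqrt_le_mono)
  qed auto
  finally show "cmod (mform N X Y f g) \<le>
    C * fnorm f X * fnorm g Y" by (simp add: mult.assoc)
qed

section \<open>Words and weighted shifts\<close>

lemma rdiff_append [simp]: "rdiff (\<sigma> @ \<gamma>) \<gamma> = \<sigma>"
  unfolding rdiff_def by (rule the_equality) auto

lemma rmin_append [simp]: "rmin (\<sigma> @ \<gamma>) \<gamma> = \<gamma>" "rmin \<gamma> (\<sigma> @ \<gamma>) = \<gamma>"
  by (auto simp: rmin_def suffix_def)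

lemma rmax_append [simp]: "rmax (\<sigma> @ \<gamma>) \<gamma> = \<sigma> @ \<gamma>" "rmax \<gamma> (\<sigma> @ \<gamma>) = \<sigma> @ \<gamma>"
  by (auto simp: rmax_def suffix_def)

lemma rdiff_self [simp]: "rdiff \<gamma> \<gamma> = []"
  using rdiff_append[of "[]"] by simp

lemma rmin_self [simp]: "rmin \<gamma> \<gamma> = \<gamma>"
  by (simp add: rmin_def)

lemma bcoeff_pos: "0 < m \<Longrightarrow> 0 < bcoeff m \<alpha>"
  by (simp add: bcoeff_def)

text \<open>Cross-multiplied: \<open>bcoeff m \<alpha>\<close> divided by
  \<open>bcoeff m (j # \<alpha>)\<close> is the square of the weight in \<open>Dop\<close>. This is
  the absorption identity for binomial coefficients, and along a word such quotients
  telescope.\<close>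

lemma bcoeff_Cons:
  assumes "0 < m"
  shows "bcoeff m (j # \<alpha>) * (length \<alpha> + 1) = bcoeff m \<alpha> * (length \<alpha> + m)"
proof -
  have "(length \<alpha> + 1) * ((length \<alpha> + m) choose (m - 1)) = (length \<alpha> + m) * ((length \<alpha> + m - 1) choose (m - 1))"
    using binomial_absorb_comp[of "length \<alpha> + m" "m - 1"] assms by (simp add: Suc_diff_le)
  then have "real ((length \<alpha> + 1) * ((length \<alpha> + m) choose (m - 1))) =
      real ((length \<alpha> + m) * ((length \<alpha> + m - 1) choose (m - 1)))" by simp
  then show ?thesis by (simp only: bcoeff_def of_nat_mult length_Cons) (simp add: mult.commute)
qed

text \<open>Each further letter multiplies the coefficient by \<open>(l + m) / (l + 1)\<close>,
  where \<open>l\<close> is the current length; this is at least one for positive \<open>m\<close>.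
  Hence \<open>tau\<close> is at most one on comparable pairs.\<close>

lemma bcoeff_le_append:
  assumes "0 < m"
  shows "bcoeff m \<gamma> \<le> bcoeff m (\<sigma> @ \<gamma>)"
proof (induction \<sigma>)
  case (Cons j \<sigma>)
  let ?l = "length (\<sigma> @ \<gamma>)"
  have "bcoeff m (\<sigma> @ \<gamma>) * (?l + 1) \<le> bcoeff m (\<sigma> @ \<gamma>) * (?l + m)"
    using assms bcoeff_pos[OF assms, of "\<sigma> @ \<gamma>"] by (intro mult_left_mono) auto
  then have "bcoeff m (\<sigma> @ \<gamma>) * (?l + 1) \<le> bcoeff m (j # \<sigma> @ \<gamma>) * (?l + 1)"
    unfolding bcoeff_Cons[OF assms] .
  then have "bcoeff m (\<sigma> @ \<gamma>) \<le> bcoeff m (j # \<sigma> @ \<gamma>)"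
    by (subst (asm) mult_le_cancel_right_pos) auto
  then show ?case using Cons by simp
qed simp

section \<open>Multiwords and the action of the weighted shifts\<close>

text \<open>Restricted to \<open>{1..k}\<close> so that the product is extensional, as membership in
  \<open>Fn\<close> demands.\<close>

definition rmul :: "nat \<Rightarrow> multiword \<Rightarrow> multiword \<Rightarrow> multiword"
  where "rmul k \<alpha> \<gamma> = (\<lambda>i\<in>{1..k}. \<alpha> i @ \<gamma> i)"

lemma rmul_apply [simp]: "i \<in> {1..k} \<Longrightarrow> rmul k \<alpha> \<gamma> i = \<alpha> i @ \<gamma> i"
  by (simp add: rmul_def)

lemma Fn_eqI:
  assumes "\<omega> \<in> Fn k n" "\<gamma> \<in> Fn k n" "\<And>i. i \<in> {1..k} \<Longrightarrow> \<omega> i = \<gamma> i"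
  shows "\<omega> = \<gamma>"
  using assms unfolding Fn_def by (rule PiE_ext)

lemma rmul_in_Fn: "\<alpha> \<in> Fn k n \<Longrightarrow> \<gamma> \<in> Fn k n \<Longrightarrow> rmul k \<alpha> \<gamma> \<in> Fn k n"
  unfolding Fn_def rmul_def by (auto simp: PiE_iff)

lemma rmul_left_cancel:
  assumes "\<gamma> \<in> Fn k n" "\<gamma>' \<in> Fn k n" "rmul k \<alpha> \<gamma> = rmul k \<alpha> \<gamma>'"
  shows "\<gamma> = \<gamma>'"
proof (rule Fn_eqI[OF assms(1,2)])
  fix i assume "i \<in> {1..k}"
  then show "\<gamma> i = \<gamma>' i" using fun_cong[OF assms(3), of i] by simp
qed

lemma Fn_update: "w \<in> Fn k n \<Longrightarrow> i \<in> {1..k} \<Longrightarrow> u \<in> lists {1..n i} \<Longrightarrow> w(i := u) \<in> Fn k n"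
  unfolding Fn_def by (auto simp: PiE_iff extensional_def)

lemma Fn_lists: "w \<in> Fn k n \<Longrightarrow> i \<in> {1..k} \<Longrightarrow> w i \<in> lists {1..n i}"
  unfolding Fn_def by (auto simp: PiE_iff)

lemma tau_rmul:
  "tau k m (rmul k \<alpha> \<gamma>, \<gamma>) = (\<Prod>i\<in>{1..k}. sqrt (bcoeff (m i) (\<gamma> i) / bcoeff (m i) (\<alpha> i @ \<gamma> i)))"
  unfolding tau_def by (auto intro!: prod.cong)

text \<open>The weights of the letters of \<open>\<alpha>\<close> telescope to a single quotient of
  coefficients. That \<open>f\<close> vanishes off \<open>Fn k n\<close> is used for the empty word,
  where nothing is cut off.\<close>

lemma bW_word_apply:
  assumes m: "0 < m i" and i: "i \<in> {1..k}" and f: "\<And>w. w \<notin> Fn k n \<Longrightarrow> f w = 0"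
  shows "bW_word k m n i \<alpha> f w = (if w \<in> Fn k n \<and> prefix \<alpha> (w i)
    then complex_of_real (sqrt (bcoeff (m i) (drop (length \<alpha>) (w i)) / bcoeff (m i) (w i))) *
      f (w(i := drop (length \<alpha>) (w i))) else 0)"
proof (induction \<alpha> arbitrary: w)
  case Nil
  show ?case using f bcoeff_pos[of "m i" "w i"] m by (auto simp: bW_word_def)
next
  case (Cons j \<alpha>)
  let ?R = "bW_word k m n i \<alpha> f"
  have step: "bW_word k m n i (j # \<alpha>) f w = bW k m n i j ?R w" by (simp add: bW_word_def)
  show ?case
  proof (cases "w \<in> Fn k n \<and> prefix (j # \<alpha>) (w i)")
    case False
    then show ?thesis
      unfolding step by (auto simp: bW_def ampliation_def Wop_def Sop_def Dop_def Cons.IH split: list.splits)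
  next
    case True
    then obtain u where u: "w i = j # \<alpha> @ u" by (auto simp: prefix_def)
    have w: "w \<in> Fn k n" using True by simp
    have w': "w(i := \<alpha> @ u) \<in> Fn k n"
      using Fn_update[OF w i, of "\<alpha> @ u"] Fn_lists[OF w i] u by auto
    let ?l = "length (\<alpha> @ u)" and ?b = "bcoeff (m i)"
    have b: "?b (\<alpha> @ u) > 0" "?b (j # \<alpha> @ u) > 0" using m bcoeff_pos by auto
    have "(?l + 1) / (?l + m i) = ?b (\<alpha> @ u) / ?b (j # \<alpha> @ u)"
      using bcoeff_Cons[OF m, of j "\<alpha> @ u"] b m by (simp add: frac_eq_eq mult.commute)
    \<comment> \<open>One step of the telescoping: the coefficient of \<open>\<alpha> @ u\<close>
      cancels.\<close>
    then have *: "sqrt ((?l + 1) / (?l + m i)) * sqrt (?b u / ?b (\<alpha> @ u)) = sqrt (?b u / ?b (j # \<alpha> @ u))"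
      using b by (simp add: real_sqrt_mult[symmetric])
    have "bW k m n i j ?R w = of_real (sqrt ((?l + 1) / (?l + m i))) * ?R (w(i := \<alpha> @ u))"
      using w u by (simp add: bW_def ampliation_def Wop_def Sop_def Dop_def)
    also have "?R (w(i := \<alpha> @ u)) = of_real (sqrt (?b u / ?b (\<alpha> @ u))) * f (w(i := u))"
      unfolding Cons.IH using w' by simp
    finally show ?thesis
      unfolding step using True u by (simp add: *[symmetric] mult.assoc)
  qed
qed

text \<open>A general list replaces \<open>[1..<Suc k]\<close> for the sake of the induction.
  Distinctness makes the factors independent: changing coordinate \<open>i\<close> leaves the
  prefixes and weights at the other coordinates alone.\<close>

lemma bW_list_apply:
  assumes m: "\<And>i. i \<in> {1..k} \<Longrightarrow> 0 < m i" and f: "\<And>w. w \<notin> Fn k n \<Longrightarrow> f w = 0"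
    and I: "distinct I" "set I \<subseteq> {1..k}"
  shows "foldr (\<lambda>i R. bW_word k m n i (\<alpha> i) \<circ> R) I id f w =
    (if w \<in> Fn k n \<and> (\<forall>i\<in>set I. prefix (\<alpha> i) (w i))
     then (\<Prod>i\<in>set I. complex_of_real (sqrt (bcoeff (m i) (drop (length (\<alpha> i)) (w i)) / bcoeff (m i) (w i)))) *
       f (\<lambda>i. if i \<in> set I then drop (length (\<alpha> i)) (w i) else w i) else 0)"
  using I
proof (induction I arbitrary: w)
  case Nil
  then show ?case using f by auto
next
  case (Cons i I)
  let ?R = "foldr (\<lambda>i R. bW_word k m n i (\<alpha> i) \<circ> R) I id f"
  let ?d = "drop (length (\<alpha> i)) (w i)"
  have i: "i \<in> {1..k}" "i \<notin> set I" using Cons.prems by auto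
  have IH: "?R w = (if w \<in> Fn k n \<and> (\<forall>i\<in>set I. prefix (\<alpha> i) (w i))
     then (\<Prod>i\<in>set I. complex_of_real (sqrt (bcoeff (m i) (drop (length (\<alpha> i)) (w i)) / bcoeff (m i) (w i)))) *
       f (\<lambda>i. if i \<in> set I then drop (length (\<alpha> i)) (w i) else w i) else 0)" for w
    by (intro Cons.IH) (use Cons.prems in auto)
  have R0: "?R w = 0" if "w \<notin> Fn k n" for w using that by (simp add: IH)
  have step: "foldr (\<lambda>i R. bW_word k m n i (\<alpha> i) \<circ> R) (i # I) id f w = bW_word k m n i (\<alpha> i) ?R w"
    by simp
  have fin: "w(i := ?d) \<in> Fn k n" if "w \<in> Fn k n"
    by (rule Fn_update[OF that i(1)]) (use Fn_lists[OF that i(1)] in \<open>auto dest: in_set_dropD\<close>)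
  have pre: "(\<forall>i'\<in>set I. prefix (\<alpha> i') ((w(i := ?d)) i')) = (\<forall>i'\<in>set I. prefix (\<alpha> i') (w i'))"
    using i(2) by auto
  have prods: "(\<Prod>i'\<in>set I. complex_of_real (sqrt (bcoeff (m i') (drop (length (\<alpha> i')) ((w(i := ?d)) i')) / bcoeff (m i') ((w(i := ?d)) i')))) =
     (\<Prod>i\<in>set I. complex_of_real (sqrt (bcoeff (m i) (drop (length (\<alpha> i)) (w i)) / bcoeff (m i) (w i))))"
    by (intro prod.cong) (use i(2) in auto)
  have arg: "(\<lambda>i'. if i' \<in> set I then drop (length (\<alpha> i')) ((w(i := ?d)) i') else (w(i := ?d)) i') =
     (\<lambda>i'. if i' \<in> set (i # I) then drop (length (\<alpha> i')) (w i') else w i')"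
    using i(2) by (auto simp: fun_eq_iff)
  have word: "bW_word k m n i (\<alpha> i) ?R w = (if w \<in> Fn k n \<and> prefix (\<alpha> i) (w i)
    then complex_of_real (sqrt (bcoeff (m i) ?d / bcoeff (m i) (w i))) * ?R (w(i := ?d)) else 0)"
    by (rule bW_word_apply[where m = m, OF m[OF i(1)] i(1) R0])
  show ?case
    unfolding step word IH[of "w(i := ?d)"] pre prods arg
    using fin i(2) by (auto simp: mult.assoc)
qed

lemma bW_multi_apply:
  assumes m: "\<And>i. i \<in> {1..k} \<Longrightarrow> 0 < m i" and f: "\<And>w. w \<notin> Fn k n \<Longrightarrow> f w = 0"
  shows "bW_multi k m n \<alpha> f w =
    (if w \<in> Fn k n \<and> (\<forall>i\<in>{1..k}. prefix (\<alpha> i) (w i))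
     then (\<Prod>i\<in>{1..k}. complex_of_real (sqrt (bcoeff (m i) (drop (length (\<alpha> i)) (w i)) / bcoeff (m i) (w i)))) *
       f (\<lambda>i. if i \<in> {1..k} then drop (length (\<alpha> i)) (w i) else w i) else 0)"
proof -
  have s: "set [1..<Suc k] = {1..k}" by auto
  show ?thesis
    using bW_list_apply[of k m n f "[1..<Suc k]" \<alpha> w, OF m f distinct_upt eq_refl[OF s]]
    unfolding bW_multi_def s .
qed

text \<open>Together with \<open>bW_multi_outside\<close> this exhibits \<open>bW_multi\<close> as a
  weighted shift of basis vectors, from \<open>\<gamma>\<close> to
  \<open>rmul k \<alpha> \<gamma>\<close>, with the weights of the Toeplitz condition.\<close>

lemma bW_multi_rmul:
  assumes m: "\<And>i. i \<in> {1..k} \<Longrightarrow> 0 < m i" and f: "\<And>w. w \<notin> Fn k n \<Longrightarrow> f w = 0"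
    and "\<alpha> \<in> Fn k n" and g: "\<gamma> \<in> Fn k n"
  shows "bW_multi k m n \<alpha> f (rmul k \<alpha> \<gamma>) = complex_of_real (tau k m (rmul k \<alpha> \<gamma>, \<gamma>)) * f \<gamma>"
proof -
  \<comment> \<open>Outside \<open>{1..k}\<close> both sides are \<open>undefined\<close>, because
    \<open>\<gamma>\<close> is extensional.\<close>
  have "(\<lambda>i. if i \<in> {1..k} then drop (length (\<alpha> i)) (rmul k \<alpha> \<gamma> i) else rmul k \<alpha> \<gamma> i) = \<gamma>"
  proof
    fix i show "(if i \<in> {1..k} then drop (length (\<alpha> i)) (rmul k \<alpha> \<gamma> i) else rmul k \<alpha> \<gamma> i) = \<gamma> i"
      using g by (auto simp: Fn_def rmul_def PiE_iff extensional_def)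
  qed
  then show ?thesis
    using bW_multi_apply[of k m n f \<alpha> "rmul k \<alpha> \<gamma>", OF m f] rmul_in_Fn[OF assms(3) g]
    by (simp add: tau_rmul)
qed

lemma bW_multi_outside:
  assumes m: "\<And>i. i \<in> {1..k} \<Longrightarrow> 0 < m i" and f: "\<And>w. w \<notin> Fn k n \<Longrightarrow> f w = 0"
    and w: "w \<notin> rmul k \<alpha> ` Fn k n"
  shows "bW_multi k m n \<alpha> f w = 0"
proof -
  have "\<not> (w \<in> Fn k n \<and> (\<forall>i\<in>{1..k}. prefix (\<alpha> i) (w i)))"
  proof
    assume a: "w \<in> Fn k n \<and> (\<forall>i\<in>{1..k}. prefix (\<alpha> i) (w i))"
    let ?g = "\<lambda>i\<in>{1..k}. drop (length (\<alpha> i)) (w i)"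
    have "?g \<in> Fn k n" using a by (auto simp: Fn_def PiE_iff dest: in_set_dropD)
    moreover have "w = rmul k \<alpha> ?g"
    proof (rule Fn_eqI)
      show w: "w \<in> Fn k n" using a by blast
      show eq: "w i = rmul k \<alpha> ?g i" if "i \<in> {1..k}" for i
      proof -
        have "prefix (\<alpha> i) (w i)" using a that by blast
        then obtain zs where "w i = \<alpha> i @ zs" by (rule prefixE)
        then show ?thesis using that by simp
      qed
      show "rmul k \<alpha> ?g \<in> Fn k n"
        unfolding Fn_def
      proof (rule PiE_I)
        show "rmul k \<alpha> ?g i \<in> lists {1..n i}" if "i \<in> {1..k}" for i
          using Fn_lists[OF w that] unfolding eq[OF that] .
      qed (auto simp: rmul_def restrict_def)
    qed
    ultimately show False using w by blast
  qed
  then show ?thesis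
    using bW_multi_apply[of k m n f \<alpha> w, OF m f] by auto
qed

section \<open>Comparable pairs and their reduced forms\<close>

text \<open>For incomparable words \<open>rmin\<close> and \<open>rmax\<close> fall back to
  \<open>\<omega>\<close> and \<open>\<gamma>\<close> in this order, so the upper bound is asserted
  on comparable pairs; there the minimum is a suffix of the maximum and
  \<open>bcoeff_le_append\<close> applies.\<close>

lemma tau_bounds:
  assumes m: "\<And>i. i \<in> {1..k} \<Longrightarrow> 0 < m i"
  shows "0 \<le> tau k m (\<omega>, \<gamma>)"
    and "(\<omega>, \<gamma>) \<in> comparable_pairs k n \<Longrightarrow> tau k m (\<omega>, \<gamma>) \<le> 1"
proof -
  have pos: "0 \<le> bcoeff (m i) u" if "i \<in> {1..k}" for i u
    using bcoeff_pos[OF m[OF that]] by (simp add: less_imp_le)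
  show "0 \<le> tau k m (\<omega>, \<gamma>)"
    unfolding tau_def by (auto intro!: prod_nonneg divide_nonneg_nonneg pos)
  assume C: "(\<omega>, \<gamma>) \<in> comparable_pairs k n"
  have le: "bcoeff (m i) (rmin (\<omega> i) (\<gamma> i)) / bcoeff (m i) (rmax (\<omega> i) (\<gamma> i)) \<le> 1" if i: "i \<in> {1..k}" for i
  proof -
    have "suffix (\<gamma> i) (\<omega> i) \<or> suffix (\<omega> i) (\<gamma> i)"
      using C i unfolding comparable_pairs_def by blast
    then have "suffix (rmin (\<omega> i) (\<gamma> i)) (rmax (\<omega> i) (\<gamma> i))" by (auto simp: rmin_def rmax_def)
    then obtain \<sigma> where "rmax (\<omega> i) (\<gamma> i) = \<sigma> @ rmin (\<omega> i) (\<gamma> i)" by (auto simp: suffix_def)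
    then show ?thesis
      using bcoeff_le_append[OF m[OF i]] bcoeff_pos[OF m[OF i]] by (simp add: divide_le_eq_1)
  qed
  show "tau k m (\<omega>, \<gamma>) \<le> 1"
    unfolding tau_def prod.case
    by (rule prod_le_1) (use le in \<open>auto intro!: divide_nonneg_nonneg pos\<close>)
qed

lemma J_pairsD:
  assumes "(\<alpha>, \<beta>) \<in> J_pairs k n"
  shows "\<alpha> \<in> Fn k n" "\<beta> \<in> Fn k n" "i \<in> {1..k} \<Longrightarrow> \<alpha> i = [] \<or> \<beta> i = []"
proof -
  obtain s where s: "\<alpha> \<in> Fn k n" "\<beta> \<in> Fn k n"
    "\<And>i. i \<in> {1..k} \<Longrightarrow> int (length (\<alpha> i)) = max (s i) 0 \<and> int (length (\<beta> i)) = max (- s i) 0"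
    using assms unfolding J_pairs_def degree_pairs_def by auto
  show "\<alpha> \<in> Fn k n" "\<beta> \<in> Fn k n" by fact+
  show "\<alpha> i = [] \<or> \<beta> i = []" if "i \<in> {1..k}"
  proof (cases "s i \<le> 0")
    case True
    then show ?thesis using s(3)[OF that] by (simp add: max_def)
  next
    case False
    then show ?thesis using s(3)[OF that] by (simp add: max_def)
  qed
qed

text \<open>In each coordinate one of the two words is empty, so nothing can be cancelled beyond the
  common right factor \<open>\<gamma>\<close>.\<close>

lemma rmul_J_pairs:
  assumes J: "(\<alpha>, \<beta>) \<in> J_pairs k n" and g: "\<gamma> \<in> Fn k n"
  shows "(rmul k \<alpha> \<gamma>, rmul k \<beta> \<gamma>) \<in> comparable_pairs k n"
    and "simplify_pair k (rmul k \<alpha> \<gamma>, rmul k \<beta> \<gamma>) = (\<alpha>, \<beta>)"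
proof -
  note ab = J_pairsD[OF J]
  have suf: "suffix (\<beta> i @ \<gamma> i) (\<alpha> i @ \<gamma> i) \<longleftrightarrow> \<beta> i = []"
    "suffix (\<alpha> i @ \<gamma> i) (\<beta> i @ \<gamma> i) \<longleftrightarrow> \<alpha> i = []" if "i \<in> {1..k}" for i
    using ab(3)[OF that] by auto
  show "(rmul k \<alpha> \<gamma>, rmul k \<beta> \<gamma>) \<in> comparable_pairs k n"
  proof -
    have "suffix (rmul k \<beta> \<gamma> i) (rmul k \<alpha> \<gamma> i) \<or> suffix (rmul k \<alpha> \<gamma> i) (rmul k \<beta> \<gamma> i)"
      if i: "i \<in> {1..k}" for i
      using ab(3)[OF i] i by auto
    then show ?thesis
      using rmul_in_Fn[OF ab(1) g] rmul_in_Fn[OF ab(2) g] unfolding comparable_pairs_def by blast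
  qed
  let ?a = "\<lambda>i\<in>{1..k}. if suffix (rmul k \<beta> \<gamma> i) (rmul k \<alpha> \<gamma> i) then rdiff (rmul k \<alpha> \<gamma> i) (rmul k \<beta> \<gamma> i) else []"
    and ?b = "\<lambda>i\<in>{1..k}. if suffix (rmul k \<alpha> \<gamma> i) (rmul k \<beta> \<gamma> i) then rdiff (rmul k \<beta> \<gamma> i) (rmul k \<alpha> \<gamma> i) else []"
  have "?a = \<alpha>"
  proof
    fix i
    show "?a i = \<alpha> i"
      using ab(1) ab(3)[of i] suf[of i]
      by (cases "i \<in> {1..k}") (auto simp: Fn_def PiE_iff extensional_def)
  qed
  moreover have "?b = \<beta>"
  proof
    fix i
    show "?b i = \<beta> i"
      using ab(2) ab(3)[of i] suf[of i]
      by (cases "i \<in> {1..k}") (auto simp: Fn_def PiE_iff extensional_def)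
  qed
  ultimately show "simplify_pair k (rmul k \<alpha> \<gamma>, rmul k \<beta> \<gamma>) = (\<alpha>, \<beta>)"
    unfolding simplify_pair_def by simp
qed

text \<open>The common right factor is the coordinatewise minimum. Stripping it off leaves at most
  one nonempty word per coordinate, and the signed difference of lengths becomes the degree.\<close>

lemma comparable_pairs_cases:
  assumes C: "(\<omega>, \<gamma>) \<in> comparable_pairs k n"
  obtains \<alpha> \<beta> \<gamma>0 where "\<omega> = rmul k \<alpha> \<gamma>0" "\<gamma> = rmul k \<beta> \<gamma>0" "\<gamma>0 \<in> Fn k n"
    "(\<alpha>, \<beta>) \<in> degree_pairs k n (\<lambda>i. int (length (\<omega> i)) - int (length (\<gamma> i)))"
    "simplify_pair k (\<omega>, \<gamma>) = (\<alpha>, \<beta>)"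
proof -
  let ?s = "\<lambda>i. int (length (\<omega> i)) - int (length (\<gamma> i))"
  have F: "\<omega> \<in> Fn k n" "\<gamma> \<in> Fn k n"
    and suf: "\<And>i. i \<in> {1..k} \<Longrightarrow> suffix (\<gamma> i) (\<omega> i) \<or> suffix (\<omega> i) (\<gamma> i)"
    using C by (auto simp: comparable_pairs_def)
  define \<gamma>0 where "\<gamma>0 = (\<lambda>i\<in>{1..k}. rmin (\<omega> i) (\<gamma> i))"
  define \<alpha> where "\<alpha> = (\<lambda>i\<in>{1..k}. if suffix (\<gamma> i) (\<omega> i) then rdiff (\<omega> i) (\<gamma> i) else [])"
  define \<beta> where "\<beta> = (\<lambda>i\<in>{1..k}. if suffix (\<omega> i) (\<gamma> i) then rdiff (\<gamma> i) (\<omega> i) else [])"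
  have dec: "\<omega> i = \<alpha> i @ \<gamma>0 i \<and> \<gamma> i = \<beta> i @ \<gamma>0 i \<and> (\<alpha> i = [] \<or> \<beta> i = [])" if i: "i \<in> {1..k}" for i
    using suf[OF i]
  proof
    assume "suffix (\<gamma> i) (\<omega> i)"
    then obtain \<sigma> where "\<omega> i = \<sigma> @ \<gamma> i" by (auto simp: suffix_def)
    moreover have "suffix u (\<sigma> @ u)" for u :: "nat list" by (simp add: suffix_def)
    \<comment> \<open>Both suffix conditions hold at once only for equal words; then
      \<open>\<sigma>\<close> is empty and both quotients are \<open>[]\<close>.\<close>
    ultimately show ?thesis using i by (cases "\<sigma> = []") (auto simp: \<alpha>_def \<beta>_def \<gamma>0_def)
  next
    assume "suffix (\<omega> i) (\<gamma> i)"
    then obtain \<sigma> where "\<gamma> i = \<sigma> @ \<omega> i" by (auto simp: suffix_def)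
    moreover have "suffix u (\<sigma> @ u)" for u :: "nat list" by (simp add: suffix_def)
    ultimately show ?thesis using i by (cases "\<sigma> = []") (auto simp: \<alpha>_def \<beta>_def \<gamma>0_def)
  qed
  have lists: "\<alpha> i \<in> lists {1..n i} \<and> \<beta> i \<in> lists {1..n i} \<and> \<gamma>0 i \<in> lists {1..n i}" if i: "i \<in> {1..k}" for i
    using dec[OF i] Fn_lists[OF F(1) i] Fn_lists[OF F(2) i] by (metis append_in_lists_conv)
  have in_Fn: "\<alpha> \<in> Fn k n" "\<beta> \<in> Fn k n" "\<gamma>0 \<in> Fn k n"
  proof -
    have "\<alpha> \<in> extensional {1..k}" "\<beta> \<in> extensional {1..k}" "\<gamma>0 \<in> extensional {1..k}"
      unfolding \<alpha>_def \<beta>_def \<gamma>0_def by (rule restrict_extensional)+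
    then show "\<alpha> \<in> Fn k n" "\<beta> \<in> Fn k n" "\<gamma>0 \<in> Fn k n"
      using lists unfolding Fn_def PiE_iff by blast+
  qed
  have "int (length (\<alpha> i)) = max (?s i) 0 \<and> int (length (\<beta> i)) = max (- ?s i) 0" if i: "i \<in> {1..k}" for i
  proof -
    have "length (\<omega> i) = length (\<alpha> i) + length (\<gamma>0 i)" "length (\<gamma> i) = length (\<beta> i) + length (\<gamma>0 i)"
      using dec[OF i] by (metis length_append)+
    then show ?thesis using dec[OF i] by auto
  qed
  then have deg: "(\<alpha>, \<beta>) \<in> degree_pairs k n ?s"
    using in_Fn unfolding degree_pairs_def by auto
  have "\<omega> = rmul k \<alpha> \<gamma>0" "\<gamma> = rmul k \<beta> \<gamma>0"
    by (rule Fn_eqI[OF _ rmul_in_Fn]; use F in_Fn dec in auto)+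
  moreover have "simplify_pair k (\<omega>, \<gamma>) = (\<alpha>, \<beta>)"
    by (simp add: simplify_pair_def \<alpha>_def \<beta>_def)
  ultimately show thesis using that in_Fn deg by blast
qed

text \<open>In each coordinate one of the two words is empty, so one factor on the right is the root
  of \<open>b / b\<close>, that is 1. The weights of the shift by \<open>\<alpha>\<close> and of the
  adjoint shift by \<open>\<beta>\<close> thus multiply to the Toeplitz weight.\<close>

lemma tau_rmul_rmul:
  assumes m: "\<And>i. i \<in> {1..k} \<Longrightarrow> 0 < m i" and J: "(\<alpha>, \<beta>) \<in> J_pairs k n"
  shows "tau k m (rmul k \<alpha> \<gamma>, rmul k \<beta> \<gamma>) = tau k m (rmul k \<alpha> \<gamma>, \<gamma>) * tau k m (rmul k \<beta> \<gamma>, \<gamma>)"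
  unfolding tau_def prod.case prod.distrib[symmetric]
proof (rule prod.cong[OF refl])
  fix i assume i: "i \<in> {1..k}"
  have b: "bcoeff (m i) (\<gamma> i) \<noteq> 0" using bcoeff_pos[OF m[OF i], of "\<gamma> i"] by simp
  show "sqrt (bcoeff (m i) (rmin (rmul k \<alpha> \<gamma> i) (rmul k \<beta> \<gamma> i)) / bcoeff (m i) (rmax (rmul k \<alpha> \<gamma> i) (rmul k \<beta> \<gamma> i))) =
    sqrt (bcoeff (m i) (rmin (rmul k \<alpha> \<gamma> i) (\<gamma> i)) / bcoeff (m i) (rmax (rmul k \<alpha> \<gamma> i) (\<gamma> i))) *
    sqrt (bcoeff (m i) (rmin (rmul k \<beta> \<gamma> i) (\<gamma> i)) / bcoeff (m i) (rmax (rmul k \<beta> \<gamma> i) (\<gamma> i)))"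
    using J_pairsD(3)[OF J i] b i by auto
qed

text \<open>The fibre of \<open>simplify_pair\<close> over a reduced pair is parametrized by the
  common right factor; these are the positions where the shift by \<open>\<alpha>\<close> composed
  with the adjoint shift by \<open>\<beta>\<close> has its entries.\<close>

lemma simplify_pair_eq_iff:
  assumes J: "(\<alpha>, \<beta>) \<in> J_pairs k n"
  shows "(\<omega>, \<gamma>) \<in> comparable_pairs k n \<and> simplify_pair k (\<omega>, \<gamma>) = (\<alpha>, \<beta>) \<longleftrightarrow>
    (\<exists>\<gamma>0\<in>Fn k n. \<omega> = rmul k \<alpha> \<gamma>0 \<and> \<gamma> = rmul k \<beta> \<gamma>0)"
proof
  assume a: "(\<omega>, \<gamma>) \<in> comparable_pairs k n \<and> simplify_pair k (\<omega>, \<gamma>) = (\<alpha>, \<beta>)"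
  obtain \<alpha>' \<beta>' \<gamma>0 where "\<omega> = rmul k \<alpha>' \<gamma>0" "\<gamma> = rmul k \<beta>' \<gamma>0" "\<gamma>0 \<in> Fn k n"
    "simplify_pair k (\<omega>, \<gamma>) = (\<alpha>', \<beta>')"
    using comparable_pairs_cases[OF conjunct1[OF a]] by metis
  then show "\<exists>\<gamma>0\<in>Fn k n. \<omega> = rmul k \<alpha> \<gamma>0 \<and> \<gamma> = rmul k \<beta> \<gamma>0"
    using a by auto
qed (use rmul_J_pairs[OF J] in blast)

lemma degree_pairs_subset_J: "degree_pairs k n s \<subseteq> J_pairs k n"
  by (auto simp: J_pairs_def)

lemma simplify_pair_in_J:
  assumes "(\<omega>, \<gamma>) \<in> comparable_pairs k n"
  shows "simplify_pair k (\<omega>, \<gamma>) \<in> J_pairs k n"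
  by (rule comparable_pairs_cases[OF assms]) (use degree_pairs_subset_J in auto)

text \<open>An integer is recovered from its positive and negative part. Homogeneous parts of the
  series are therefore multi-diagonals of the matrix.\<close>

lemma simplify_pair_degree_iff:
  assumes "(\<omega>, \<gamma>) \<in> comparable_pairs k n"
  shows "simplify_pair k (\<omega>, \<gamma>) \<in> degree_pairs k n s \<longleftrightarrow>
    (\<forall>i\<in>{1..k}. int (length (\<omega> i)) - int (length (\<gamma> i)) = s i)"
proof (rule comparable_pairs_cases[OF assms])
  fix \<alpha> \<beta> \<gamma>0
  assume d: "(\<alpha>, \<beta>) \<in> degree_pairs k n (\<lambda>i. int (length (\<omega> i)) - int (length (\<gamma> i)))"
    and s: "simplify_pair k (\<omega>, \<gamma>) = (\<alpha>, \<beta>)"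
  show ?thesis
  proof
    assume "simplify_pair k (\<omega>, \<gamma>) \<in> degree_pairs k n s"
    then have *: "max (s i) 0 = max (int (length (\<omega> i)) - int (length (\<gamma> i))) 0 \<and>
      max (- s i) 0 = max (- (int (length (\<omega> i)) - int (length (\<gamma> i)))) 0" if "i \<in> {1..k}" for i
      using d that unfolding s degree_pairs_def by auto
    show "\<forall>i\<in>{1..k}. int (length (\<omega> i)) - int (length (\<gamma> i)) = s i"
      using * by (force simp: max_def split: if_splits)
  next
    assume "\<forall>i\<in>{1..k}. int (length (\<omega> i)) - int (length (\<gamma> i)) = s i"
    then show "simplify_pair k (\<omega>, \<gamma>) \<in> degree_pairs k n s"
      using d unfolding s degree_pairs_def by auto
  qed
qed

lemma simplify_pair_length:
  assumes "(\<omega>, \<gamma>) \<in> comparable_pairs k n" "simplify_pair k (\<omega>, \<gamma>) = (\<alpha>, \<beta>)"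
  shows "(\<Sum>i\<in>{1..k}. length (\<alpha> i) + length (\<beta> i)) = (\<Sum>i\<in>{1..k}. nat \<bar>int (length (\<omega> i)) - int (length (\<gamma> i))\<bar>)"
proof (rule sum.cong[OF refl])
  fix i assume i: "i \<in> {1..k}"
  have "(\<alpha>, \<beta>) \<in> degree_pairs k n (\<lambda>i. int (length (\<omega> i)) - int (length (\<gamma> i)))"
    using simplify_pair_degree_iff[OF assms(1)] assms(2) by simp
  then have "int (length (\<alpha> i)) = max (int (length (\<omega> i)) - int (length (\<gamma> i))) 0"
    "int (length (\<beta> i)) = max (- (int (length (\<omega> i)) - int (length (\<gamma> i)))) 0"
    using i unfolding degree_pairs_def by blast+
  then show "length (\<alpha> i) + length (\<beta> i) = nat \<bar>int (length (\<omega> i)) - int (length (\<gamma> i))\<bar>"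
    by linarith
qed

text \<open>Lengths are prescribed and alphabets are finite. Over an infinite class the
  \<open>sum\<close> in \<open>q_op\<close> would be 0 by convention.\<close>

lemma finite_degree_pairs: "finite (degree_pairs k n s)"
proof (rule finite_subset)
  let ?P = "\<lambda>l. PiE {1..k} (\<lambda>i. {xs. set xs \<subseteq> {1..n i} \<and> length xs = l i})"
  show "degree_pairs k n s \<subseteq> ?P (\<lambda>i. nat (max (s i) 0)) \<times> ?P (\<lambda>i. nat (max (- s i) 0))"
  proof clarify
    fix \<alpha> \<beta> assume "(\<alpha>, \<beta>) \<in> degree_pairs k n s"
    then have F: "\<alpha> \<in> Fn k n" "\<beta> \<in> Fn k n"
      and l: "\<And>i. i \<in> {1..k} \<Longrightarrow> int (length (\<alpha> i)) = max (s i) 0 \<and> int (length (\<beta> i)) = max (- s i) 0"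
      unfolding degree_pairs_def by auto
    have l': "length (\<alpha> i) = nat (max (s i) 0) \<and> length (\<beta> i) = nat (max (- s i) 0)" if "i \<in> {1..k}" for i
      using l[OF that] by linarith
    show "\<alpha> \<in> ?P (\<lambda>i. nat (max (s i) 0)) \<and> \<beta> \<in> ?P (\<lambda>i. nat (max (- s i) 0))"
      using F l' unfolding Fn_def PiE_iff lists_eq_set by blast
  qed
  show "finite (?P (\<lambda>i. nat (max (s i) 0)) \<times> ?P (\<lambda>i. nat (max (- s i) 0)))"
    by (intro finite_cartesian_product finite_PiE finite_lists_length_eq) auto
qed

section \<open>Adjoints of the shifts\<close>

lemma bounded_clinear_scaleR_complex: "bounded_clinear (\<lambda>x::complex. r *\<^sub>R x)"
  by (simp add: bounded_clinear_def bounded_linear_scaleR_right scaleC_complex_def)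

lemma l2_inner_single_left:
  assumes "\<omega> \<in> F"
  shows "l2_inner F (l2_single \<omega> x) g = cinner x (g \<omega>)"
  unfolding l2_inner_def
  by (rule infsumI, rule has_sum_finite_neutralI[of "{\<omega>}"]) (use assms in \<open>auto simp: l2_single_def\<close>)

lemma rmul_comparable:
  assumes "\<beta> \<in> Fn k n" "\<gamma> \<in> Fn k n"
  shows "(rmul k \<beta> \<gamma>, \<gamma>) \<in> comparable_pairs k n"
proof -
  have "suffix (\<gamma> i) (rmul k \<beta> \<gamma> i)" if "i \<in> {1..k}" for i
    using that by (simp add: suffix_def)
  then show ?thesis using assms rmul_in_Fn unfolding comparable_pairs_def by blast
qed

text \<open>\<open>l2_adjoint\<close> is a choice. Existence is shown with the explicit partial
  shift \<open>?S\<close>, which carries the basis vector of \<open>rmul k \<beta> \<gamma>\<close>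
  back to that of \<open>\<gamma>\<close>; uniqueness follows by testing against singles.\<close>

lemma l2_adjoint_bW_multi:
  fixes g :: "multiword \<Rightarrow> complex"
  assumes m: "\<And>i. i \<in> {1..k} \<Longrightarrow> 0 < m i" and b: "\<beta> \<in> Fn k n" and g: "g \<in> l2 (Fn k n)"
  shows "l2_adjoint (Fn k n) (bW_multi k m n \<beta>) g =
    (\<lambda>\<gamma>. if \<gamma> \<in> Fn k n then complex_of_real (tau k m (rmul k \<beta> \<gamma>, \<gamma>)) * g (rmul k \<beta> \<gamma>) else 0)"
proof -
  let ?F = "Fn k n" and ?t = "\<lambda>\<gamma>. tau k m (rmul k \<beta> \<gamma>, \<gamma>)"
  let ?N = "\<lambda>\<gamma> \<omega> x. (if \<omega> = rmul k \<beta> \<gamma> then ?t \<gamma> else 0) *\<^sub>R x :: complex"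
  let ?S = "mat_op ?F ?N"
  have N: "mat_bounded ?F ?N 1"
  proof (rule mat_bounded_partial_injection[where P = "\<lambda>\<gamma> \<omega>. \<omega> = rmul k \<beta> \<gamma>"])
    fix \<omega> \<gamma> :: multiword and x :: complex assume wg: "\<gamma> \<in> ?F" "\<omega> \<in> ?F"
    have "0 \<le> ?t \<gamma>" "?t \<gamma> \<le> 1" using tau_bounds[OF m] rmul_comparable[OF b wg(1)] by auto
    then show "norm (?N \<gamma> \<omega> x) \<le> 1 * norm x" by (auto intro: mult_left_le_one_le)
    show "\<gamma> = \<gamma>'" if "\<gamma>' \<in> ?F" "\<omega> = rmul k \<beta> \<gamma>" "\<omega> = rmul k \<beta> \<gamma>'" for \<gamma>'
      by (rule rmul_left_cancel[OF wg(1) that(1), of \<beta>]) (use that(2,3) in simp)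
  qed (auto simp only: bounded_clinear_scaleR_complex, simp)
  have S_eq: "?S g = (\<lambda>\<gamma>. if \<gamma> \<in> ?F then complex_of_real (?t \<gamma>) * g (rmul k \<beta> \<gamma>) else 0)" for g
  proof
    fix \<gamma>
    show "?S g \<gamma> = (if \<gamma> \<in> ?F then complex_of_real (?t \<gamma>) * g (rmul k \<beta> \<gamma>) else 0)"
    proof (cases "\<gamma> \<in> ?F")
      case True
      have "((\<lambda>\<omega>. ?N \<gamma> \<omega> (g \<omega>)) has_sum complex_of_real (?t \<gamma>) * g (rmul k \<beta> \<gamma>)) ?F"
        by (rule has_sum_finite_neutralI[of "{rmul k \<beta> \<gamma>}"])
           (use rmul_in_Fn[OF b True] in \<open>auto simp: scaleR_conv_of_real\<close>)
      then show ?thesis using True by (simp add: mat_op_def infsumI)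
    qed (simp add: mat_op_def)
  qed
  have inj: "inj_on (rmul k \<beta>) ?F" using rmul_left_cancel by (rule inj_onI)
  have adj: "l2_inner ?F (bW_multi k m n \<beta> f) g = l2_inner ?F f (?S g)" if f: "f \<in> l2 ?F" for f g
  proof -
    let ?h = "\<lambda>\<omega>. cinner (bW_multi k m n \<beta> f \<omega>) (g \<omega>)"
    have f0: "f w = 0" if "w \<notin> ?F" for w using l2_outside[OF f that] .
    \<comment> \<open>The image of \<open>bW_multi\<close> is supported on the range of
      \<open>rmul k \<beta>\<close>; injectivity then allows the sum to be reindexed.\<close>
    have "infsum ?h ?F = infsum ?h (rmul k \<beta> ` ?F)"
      by (rule infsum_cong_neutral)
         (use rmul_in_Fn[OF b] bW_multi_outside[of k m n f, OF m f0] in \<open>auto simp del: rmul_apply\<close>)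
    also have "\<dots> = infsum (?h \<circ> rmul k \<beta>) ?F" by (rule infsum_reindex[OF inj])
    also have "\<dots> = infsum (\<lambda>\<gamma>. cinner (f \<gamma>) (?S g \<gamma>)) ?F"
    proof (rule infsum_cong)
      fix \<gamma> assume g: "\<gamma> \<in> ?F"
      have "bW_multi k m n \<beta> f (rmul k \<beta> \<gamma>) = of_real (?t \<gamma>) * f \<gamma>"
        by (rule bW_multi_rmul[OF m f0 b g])
      then show "(?h \<circ> rmul k \<beta>) \<gamma> = cinner (f \<gamma>) (?S g \<gamma>)"
        using g by (simp add: S_eq cinner_complex_def)
    qed
    finally show ?thesis by (simp add: l2_inner_def)
  qed
  let ?P = "\<lambda>S. l2_bounded_op ?F S \<and> (\<forall>f\<in>l2 ?F. \<forall>g\<in>l2 ?F. l2_inner ?F (bW_multi k m n \<beta> f) g = l2_inner ?F f (S g))"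
  have "?P ?S" by (intro conjI ballI mat_op_bounded_op[OF N] adj)
  then have "?P (SOME S. ?P S)" by (rule someI[where P = ?P])
  then have P: "?P (l2_adjoint ?F (bW_multi k m n \<beta>))" unfolding l2_adjoint_def .
  let ?A = "l2_adjoint ?F (bW_multi k m n \<beta>)"
  have "?A g \<gamma> = ?S g \<gamma>" for \<gamma>
  proof (cases "\<gamma> \<in> ?F")
    case True
    have s: "l2_single \<gamma> (1::complex) \<in> l2 ?F" by (rule l2_single(1)[OF True])
    have "l2_inner ?F (l2_single \<gamma> 1) (?A g) = l2_inner ?F (l2_single \<gamma> 1) (?S g)"
      unfolding adj[OF s, symmetric] by (rule bspec[OF bspec[OF conjunct2[OF P] s] g, symmetric])
    then show ?thesis unfolding l2_inner_single_left[OF True] by (simp add: cinner_complex_def)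
  next
    case False
    then show ?thesis
      using l2_outside[OF l2_bounded_opD(1)[OF conjunct1[OF P] g] False]
        l2_outside[OF mat_op_norm(1)[OF N g] False] by simp
  qed
  then show ?thesis unfolding S_eq[symmetric] by blast
qed

lemma l2_adjoint_bW_multi_outside:
  fixes g :: "multiword \<Rightarrow> complex"
  assumes m: "\<And>i. i \<in> {1..k} \<Longrightarrow> 0 < m i" and b: "\<beta> \<in> Fn k n" and g: "g \<in> l2 (Fn k n)"
    and w: "w \<notin> Fn k n"
  shows "l2_adjoint (Fn k n) (bW_multi k m n \<beta>) g w = 0"
  using l2_adjoint_bW_multi[OF m b g] w by simp

section \<open>Matrices of the terms and of the whole series\<close>

definition term_mat ::
    "nat \<Rightarrow> (nat \<Rightarrow> nat) \<Rightarrow> (nat \<Rightarrow> nat) \<Rightarrow> 'a::chilbert_space coeffs \<Rightarrow> multiword \<times> multiword \<Rightarrow>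
      multiword \<Rightarrow> multiword \<Rightarrow> 'a \<Rightarrow> 'a"
  where "term_mat k m n A p \<omega> \<gamma> x =
    (if (\<omega>, \<gamma>) \<in> comparable_pairs k n \<and> simplify_pair k (\<omega>, \<gamma>) = p then tau k m (\<omega>, \<gamma>) *\<^sub>R A p x else 0)"

text \<open>Defined for arbitrary coefficients, whether or not a bounded operator has this matrix.
  Its boundedness is the common form to which all four statements are reduced.\<close>

definition toeplitz_mat ::
    "nat \<Rightarrow> (nat \<Rightarrow> nat) \<Rightarrow> (nat \<Rightarrow> nat) \<Rightarrow> 'a::chilbert_space coeffs \<Rightarrow>
      multiword \<Rightarrow> multiword \<Rightarrow> 'a \<Rightarrow> 'a"
  where "toeplitz_mat k m n A \<omega> \<gamma> x =
    (if (\<omega>, \<gamma>) \<in> comparable_pairs k n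
     then tau k m (\<omega>, \<gamma>) *\<^sub>R A (simplify_pair k (\<omega>, \<gamma>)) x else 0)"

lemma term_mat_bounded_clinear:
  assumes "bounded_clinear (A p)"
  shows "bounded_clinear (term_mat k m n A p \<omega> \<gamma>)"
proof (cases "(\<omega>, \<gamma>) \<in> comparable_pairs k n \<and> simplify_pair k (\<omega>, \<gamma>) = p")
  case True
  then have "term_mat k m n A p \<omega> \<gamma> = (\<lambda>x. tau k m (\<omega>, \<gamma>) *\<^sub>R A p x)" by (simp add: term_mat_def fun_eq_iff)
  then show ?thesis using bounded_clinear_scaleR[OF assms] by simp
next
  case False
  then have "term_mat k m n A p \<omega> \<gamma> = (\<lambda>_. 0)" by (simp only: term_mat_def fun_eq_iff if_False) simp
  then show ?thesis using bounded_clinear_zero by simp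
qed

lemma toeplitz_mat_bounded_clinear:
  assumes "\<And>p. p \<in> J_pairs k n \<Longrightarrow> bounded_clinear (A p)"
  shows "bounded_clinear (toeplitz_mat k m n A \<omega> \<gamma>)"
proof (cases "(\<omega>, \<gamma>) \<in> comparable_pairs k n")
  case True
  then have "toeplitz_mat k m n A \<omega> \<gamma> = (\<lambda>x. tau k m (\<omega>, \<gamma>) *\<^sub>R A (simplify_pair k (\<omega>, \<gamma>)) x)"
    by (simp add: toeplitz_mat_def fun_eq_iff)
  then show ?thesis using bounded_clinear_scaleR[OF assms[OF simplify_pair_in_J[OF True]]] by simp
next
  case False
  then have "toeplitz_mat k m n A \<omega> \<gamma> = (\<lambda>_. 0)" by (simp add: toeplitz_mat_def fun_eq_iff)
  then show ?thesis using bounded_clinear_zero by simp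
qed

text \<open>The choice in \<open>tensor_op\<close> is resolved by a witness, the operator of a
  partial-injection matrix. Every admissible operator has the prescribed values on
  \<open>elem_tensor x (l2_basis \<gamma>)\<close>, that is on singles, and hence the same
  entries.\<close>

lemma series_term_entries:
  fixes A :: "'a::chilbert_space coeffs"
  assumes m: "\<And>i. i \<in> {1..k} \<Longrightarrow> 0 < m i" and p: "p \<in> J_pairs k n" and A: "bounded_clinear (A p)"
  shows "op_entries (Fn k n) (series_term k m n A p) (term_mat k m n A p)"
proof -
  let ?F = "Fn k n" and ?N = "term_mat k m n A p"
  let ?P = "\<lambda>\<omega> \<gamma>. (\<omega>, \<gamma>) \<in> comparable_pairs k n \<and> simplify_pair k (\<omega>, \<gamma>) = p"
  obtain \<alpha> \<beta> where ab: "p = (\<alpha>, \<beta>)" by (cases p)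
  have J: "(\<alpha>, \<beta>) \<in> J_pairs k n" using p ab by simp
  note abF = J_pairsD(1,2)[OF J]
  let ?B = "bW_multi k m n \<alpha> \<circ> l2_adjoint ?F (bW_multi k m n \<beta>)"
  obtain K where K: "0 \<le> K" "\<And>x. norm (A p x) \<le> norm x * K"
    using bounded_linear.nonneg_bounded[OF bounded_clinearD(1)[OF A]] by blast
  \<comment> \<open>Either word of such a position determines \<open>\<gamma>0\<close> and thereby
    the other word, so there is at most one position per row and column.\<close>
  have nz: "\<exists>\<gamma>0\<in>?F. \<omega> = rmul k \<alpha> \<gamma>0 \<and> \<gamma> = rmul k \<beta> \<gamma>0"
    if "?P \<omega> \<gamma>" for \<omega> \<gamma>
    using that simplify_pair_eq_iff[OF J] ab by blast
  have N: "mat_bounded ?F ?N K"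
  proof (rule mat_bounded_partial_injection[where P = ?P])
    show "bounded_clinear (?N \<omega> \<gamma>)" for \<omega> \<gamma> by (rule term_mat_bounded_clinear[of A p, OF A])
    show "norm (?N \<omega> \<gamma> x) \<le> K * norm x" for \<omega> \<gamma> x
    proof (cases "?P \<omega> \<gamma>")
      case True
      then have "norm (?N \<omega> \<gamma> x) = tau k m (\<omega>, \<gamma>) * norm (A p x)"
        using tau_bounds(1)[OF m] by (simp add: term_mat_def)
      also have "\<dots> \<le> 1 * norm (A p x)"
        using tau_bounds(2)[OF m] True by (intro mult_right_mono) auto
      finally show ?thesis using K(2)[of x] by (simp add: mult.commute)
    next
      case False
      then show ?thesis using K(1) by (simp only: term_mat_def if_False) simp
    qed
    show "?N \<omega> \<gamma> x = 0" if "\<not> ?P \<omega> \<gamma>" for \<omega> \<gamma> x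
      using that by (simp only: term_mat_def if_False)
    show "\<gamma> = \<gamma>'" if "?P \<omega> \<gamma>"
      "?P \<omega> \<gamma>'" for \<omega> \<gamma> \<gamma>'
      using nz[OF that(1)] nz[OF that(2)] rmul_left_cancel by metis
    show "\<omega> = \<omega>'" if "?P \<omega> \<gamma>"
      "?P \<omega>' \<gamma>" for \<omega> \<omega>' \<gamma>
      using nz[OF that(1)] nz[OF that(2)] rmul_left_cancel by metis
  qed (rule K(1))
  have B_in: "?B f (rmul k \<alpha> \<gamma>) = of_real (tau k m (rmul k \<alpha> \<gamma>, rmul k \<beta> \<gamma>)) * f (rmul k \<beta> \<gamma>)"
    if f: "f \<in> l2 ?F" and g: "\<gamma> \<in> ?F" for f \<gamma>
  proof -
    have "?B f (rmul k \<alpha> \<gamma>) = of_real (tau k m (rmul k \<alpha> \<gamma>, \<gamma>)) * l2_adjoint ?F (bW_multi k m n \<beta>) f \<gamma>"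
      unfolding comp_apply by (rule bW_multi_rmul[OF m l2_adjoint_bW_multi_outside[OF m abF(2) f] abF(1) g])
    also have "l2_adjoint ?F (bW_multi k m n \<beta>) f \<gamma> = of_real (tau k m (rmul k \<beta> \<gamma>, \<gamma>)) * f (rmul k \<beta> \<gamma>)"
      by (subst l2_adjoint_bW_multi[OF m abF(2) f]) (simp_all add: g)
    moreover have "tau k m (rmul k \<alpha> \<gamma>, rmul k \<beta> \<gamma>) = tau k m (rmul k \<alpha> \<gamma>, \<gamma>) * tau k m (rmul k \<beta> \<gamma>, \<gamma>)"
      by (rule tau_rmul_rmul[OF m J])
    ultimately show ?thesis by (simp only: of_real_mult mult.assoc)
  qed
  have B_out: "?B f \<omega> = 0" if f: "f \<in> l2 ?F" and w: "\<omega> \<notin> rmul k \<alpha> ` ?F" for f \<omega>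
    unfolding comp_apply by (rule bW_multi_outside[OF m l2_adjoint_bW_multi_outside[OF m abF(2) f] w])
  have tensor: "mat_op ?F ?N (elem_tensor x f) = elem_tensor (A p x) (?B f)" if f: "f \<in> l2 ?F" for x f
  proof
    fix \<omega>
    have eq: "?N \<omega> \<gamma> (elem_tensor x f \<gamma>) = 0"
      if "\<not> ?P \<omega> \<gamma>" for \<gamma>
      using that by (simp only: term_mat_def if_False)
    show "mat_op ?F ?N (elem_tensor x f) \<omega> = elem_tensor (A p x) (?B f) \<omega>"
    proof (cases "\<omega> \<in> rmul k \<alpha> ` ?F")
      case True
      then obtain \<gamma>0 where g0: "\<gamma>0 \<in> ?F" "\<omega> = rmul k \<alpha> \<gamma>0" by blast
      let ?g = "rmul k \<beta> \<gamma>0"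
      have w: "\<omega> \<in> ?F" using rmul_in_Fn[OF abF(1) g0(1)] g0(2) by simp
      have nN: "?N \<omega> ?g = (\<lambda>x. tau k m (\<omega>, ?g) *\<^sub>R A p x)"
      proof -
        have "(\<omega>, ?g) \<in> comparable_pairs k n \<and> simplify_pair k (\<omega>, ?g) = p"
          using rmul_J_pairs[OF J g0(1)] unfolding g0(2) ab by blast
        then show ?thesis by (intro ext) (simp add: term_mat_def)
      qed
      have "((\<lambda>\<gamma>. ?N \<omega> \<gamma> (elem_tensor x f \<gamma>)) has_sum tau k m (\<omega>, ?g) *\<^sub>R A p (f ?g *\<^sub>C x)) ?F"
      proof (rule has_sum_finite_neutralI[of "{?g}"])
        fix \<gamma> assume "\<gamma> \<in> ?F - {?g}"
        then have "\<not> ?P \<omega> \<gamma>"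
          using nz[of \<omega> \<gamma>] g0 rmul_left_cancel by blast
        then show "?N \<omega> \<gamma> (elem_tensor x f \<gamma>) = 0" by (rule eq)
      qed (use rmul_in_Fn[OF abF(2) g0(1)] in \<open>simp_all add: nN elem_tensor_def\<close>)
      then have "mat_op ?F ?N (elem_tensor x f) \<omega> = tau k m (\<omega>, ?g) *\<^sub>R A p (f ?g *\<^sub>C x)"
        using w by (simp add: mat_op_def infsumI)
      also have "\<dots> = elem_tensor (A p x) (?B f) \<omega>"
        unfolding elem_tensor_def g0(2) B_in[OF f g0(1)]
        by (simp only: bounded_clinearD(4)[OF A] scaleR_scaleC scaleC_scaleC)
      finally show ?thesis .
    next
      case False
      have "?N \<omega> \<gamma> (elem_tensor x f \<gamma>) = 0" for \<gamma> by (rule eq) (use nz False in blast)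
      then have "mat_op ?F ?N (elem_tensor x f) \<omega> = 0" by (simp add: mat_op_def)
      then show ?thesis using B_out[OF f False] by (simp add: elem_tensor_def)
    qed
  qed
  have T: "l2_bounded_op ?F (series_term k m n A p) \<and>
    (\<forall>x. \<forall>f\<in>l2 ?F. series_term k m n A p (elem_tensor x f) = elem_tensor (A p x) (?B f))"
    unfolding ab series_term_def prod.case tensor_op_def
    by (rule someI[where x = "mat_op ?F ?N"]) (use mat_op_bounded_op[OF N] tensor ab in auto)
  show ?thesis
  proof (rule op_entriesI)
    fix \<omega> \<gamma> x assume wg: "\<omega> \<in> ?F" "\<gamma> \<in> ?F"
    have "l2_basis \<gamma> = l2_single \<gamma> (1::complex)" by (simp add: l2_basis_def l2_single_def)
    then have b: "l2_basis \<gamma> \<in> l2 ?F" using l2_single(1)[OF wg(2)] by metis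
    have "series_term k m n A p (l2_single \<gamma> x) = mat_op ?F ?N (l2_single \<gamma> x)"
      unfolding elem_tensor_l2_basis[symmetric] tensor[OF b] using T b by blast
    then show "series_term k m n A p (l2_single \<gamma> x) \<omega> = ?N \<omega> \<gamma> x"
      using op_entriesD(3)[OF op_entries_mat_op[OF N] wg] by simp
  qed (use T term_mat_bounded_clinear[of A p, OF A] in blast)+
qed

section \<open>The matrix of the formal series\<close>

lemma mat_bounded_scaleR:
  assumes N: "mat_bounded F N C"
  shows "mat_bounded F (\<lambda>\<omega> \<gamma> x. r *\<^sub>R N \<omega> \<gamma> x) (\<bar>r\<bar> * C)"
proof (rule mat_boundedI)
  fix X Y f g assume XY: "finite X" "X \<subseteq> F" "finite Y" "Y \<subseteq> F"
  have "(\<Sum>\<omega>\<in>Y. \<Sum>\<gamma>\<in>X. cinner (r *\<^sub>R N \<omega> \<gamma> (f \<gamma>)) (g \<omega>)) =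
      of_real r * (mform N X Y f g)"
    by (simp add: cinner_scaleR_left sum_distrib_left)
  then show "cmod (\<Sum>\<omega>\<in>Y. \<Sum>\<gamma>\<in>X. cinner (r *\<^sub>R N \<omega> \<gamma> (f \<gamma>)) (g \<omega>)) \<le>
      \<bar>r\<bar> * C * fnorm f X * fnorm g Y"
    using mult_left_mono[OF mat_boundedD(3)[OF N XY, of f g], of "\<bar>r\<bar>"]
    by (simp add: norm_mult mult.assoc)
qed (use mat_boundedD(1)[OF N] in \<open>auto intro!: bounded_clinear_scaleR mat_boundedD(2)[OF N]\<close>)

text \<open>Evaluation at a vector and a coordinate is continuous for the operator norm; this is how
  the entries of norm limits are read off.\<close>

lemma l2_op_has_sum_apply:
  assumes s: "l2_op_has_sum F G J L" and G: "\<And>j. j \<in> J \<Longrightarrow> l2_bounded_op F (G j)" and f: "f \<in> l2 F"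
  shows "((\<lambda>j. G j f \<omega>) has_sum L f \<omega>) J"
proof -
  let ?D = "\<lambda>X f \<omega>. L f \<omega> - (\<Sum>j\<in>X. G j f \<omega>)"
  have L: "l2_bounded_op F L" and lim: "((\<lambda>X. l2_opnorm F (?D X)) \<longlongrightarrow> 0) (finite_subsets_at_top J)"
    using s by (auto simp: l2_op_has_sum_def)
  have lim0: "((\<lambda>X. l2_opnorm F (?D X) * l2_norm F f) \<longlongrightarrow> 0) (finite_subsets_at_top J)"
    using tendsto_mult_right[OF lim, of "l2_norm F f"] by simp
  have "((\<lambda>X. L f \<omega> - (\<Sum>j\<in>X. G j f \<omega>)) \<longlongrightarrow> 0) (finite_subsets_at_top J)"
  proof (rule Lim_null_comparison[OF _ lim0], rule eventually_finite_subsets_at_top_weakI)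
    fix X assume X: "finite X" "X \<subseteq> J"
    have D: "l2_bounded_op F (?D X)"
      by (rule l2_bounded_op_minus[OF L l2_bounded_op_finite_sum]) (use X G in auto)
    show "norm (L f \<omega> - (\<Sum>j\<in>X. G j f \<omega>)) \<le> l2_opnorm F (?D X) * l2_norm F f"
      using norm_le_l2_norm[OF l2_bounded_opD(1)[OF D f], of \<omega>] l2_norm_le_opnorm[OF D f] by linarith
  qed
  then have "((\<lambda>X. L f \<omega> - (L f \<omega> - (\<Sum>j\<in>X. G j f \<omega>))) \<longlongrightarrow> L f \<omega> - 0) (finite_subsets_at_top J)"
    by (intro tendsto_intros)
  then show ?thesis by (simp add: has_sum_def)
qed

lemma power_nat_abs_summable:
  fixes r :: real
  assumes "0 \<le> r" "r < 1"
  shows "(\<lambda>j::int. r ^ nat \<bar>j\<bar>) summable_on UNIV"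
proof -
  have s: "(\<lambda>l::nat. r ^ l) summable_on UNIV"
    by (rule norm_summable_imp_summable_on) (use assms in \<open>simp add: norm_power summable_geometric\<close>)
  have "(\<lambda>j::int. r ^ nat \<bar>j\<bar>) summable_on range int"
    by (subst summable_on_reindex) (use s in \<open>simp_all add: o_def\<close>)
  moreover have "(\<lambda>j::int. r ^ nat \<bar>j\<bar>) summable_on range (\<lambda>l. - int l)"
    by (subst summable_on_reindex) (use s in \<open>simp_all add: o_def inj_on_def\<close>)
  then have "(\<lambda>j::int. r ^ nat \<bar>j\<bar>) summable_on (range (\<lambda>l. - int l) - range int)"
    by (rule summable_on_subset_banach) auto
  ultimately have "(\<lambda>j::int. r ^ nat \<bar>j\<bar>) summable_on (range int \<union> (range (\<lambda>l. - int l) - range int))"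
    by (rule summable_on_Un_disjoint) auto
  moreover have "range int \<union> (range (\<lambda>l. - int l) - range int) = UNIV"
  proof -
    have "j \<in> range int \<or> j \<in> range (\<lambda>l. - int l)" for j :: int
      by (cases j rule: int_cases2) auto
    then show ?thesis by auto
  qed
  ultimately show ?thesis by simp
qed

section \<open>Homogeneous parts and the iterated series\<close>

definition degree_diff :: "multiword \<Rightarrow> multiword \<Rightarrow> nat \<Rightarrow> int"
  where "degree_diff \<omega> \<gamma> i = int (length (\<omega> i)) - int (length (\<gamma> i))"

definition total_degree :: "nat \<Rightarrow> multiword \<Rightarrow> multiword \<Rightarrow> nat"
  where "total_degree k \<omega> \<gamma> = (\<Sum>i\<in>{1..k}. nat \<bar>degree_diff \<omega> \<gamma> i\<bar>)"

text \<open>A locale, because the results are also instantiated at the damped coefficients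
  \<open>radial_coeffs k r A\<close>.\<close>

locale formal_series =
  fixes k :: nat and m n :: "nat \<Rightarrow> nat" and A :: "'a::chilbert_space coeffs"
  assumes m_pos: "i \<in> {1..k} \<Longrightarrow> 0 < m i"
    and A_clinear: "p \<in> J_pairs k n \<Longrightarrow> bounded_clinear (A p)"
begin

abbreviation "F \<equiv> Fn k n"
abbreviation "M \<equiv> toeplitz_mat k m n A"

abbreviation "radial_mat r \<equiv> \<lambda>\<omega> \<gamma> x. r ^ total_degree k \<omega> \<gamma> *\<^sub>R M \<omega> \<gamma> x"

text \<open>\<open>I\<close> holds the coordinates whose degree is still prescribed, so this follows
  the iterated series: \<open>I = {1..k}\<close> gives the scaled homogeneous part,
  \<open>I = {}\<close> the whole radial matrix.\<close>

definition component :: "nat set \<Rightarrow> (nat \<Rightarrow> int) \<Rightarrow> real \<Rightarrow> multiword \<Rightarrow> multiword \<Rightarrow> 'a \<Rightarrow> 'a"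
  where "component I s r \<omega> \<gamma> x =
    (if \<forall>i\<in>I. degree_diff \<omega> \<gamma> i = s i then r ^ total_degree k \<omega> \<gamma> *\<^sub>R M \<omega> \<gamma> x else 0)"

lemma M_clinear: "bounded_clinear (M \<omega> \<gamma>)"
  by (rule toeplitz_mat_bounded_clinear[OF A_clinear])

lemma component_clinear: "bounded_clinear (component I s r \<omega> \<gamma>)"
proof (cases "\<forall>i\<in>I. degree_diff \<omega> \<gamma> i = s i")
  case True
  then have "component I s r \<omega> \<gamma> = (\<lambda>x. r ^ total_degree k \<omega> \<gamma> *\<^sub>R M \<omega> \<gamma> x)"
    by (simp add: component_def fun_eq_iff)
  then show ?thesis using bounded_clinear_scaleR[OF M_clinear] by simp
next
  case False
  then have "component I s r \<omega> \<gamma> = (\<lambda>_. 0)" by (simp only: component_def fun_eq_iff if_False) simp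
  then show ?thesis using bounded_clinear_zero by simp
qed

lemma term_entries: "p \<in> J_pairs k n \<Longrightarrow> op_entries F (series_term k m n A p) (term_mat k m n A p)"
  by (rule series_term_entries[OF m_pos _ A_clinear])

text \<open>At a comparable position the only \<open>p\<close> that can contribute is its reduced
  pair, which lies in the class exactly when the length differences are given by
  \<open>s\<close>.\<close>

lemma q_op_entries: "op_entries F (q_op k m n A s) (component {1..k} s 1)"
proof (rule op_entriesI)
  have J: "p \<in> J_pairs k n" if "p \<in> degree_pairs k n s" for p
    using that degree_pairs_subset_J by blast
  show "l2_bounded_op F (q_op k m n A s)"
    unfolding q_op_def by (rule l2_bounded_op_finite_sum) (rule op_entriesD(1)[OF term_entries[OF J]])
  show "bounded_clinear (component {1..k} s 1 \<omega> \<gamma>)" for \<omega> \<gamma> by (rule component_clinear)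
  fix \<omega> \<gamma> and x :: 'a assume wg: "\<omega> \<in> F" "\<gamma> \<in> F"
  let ?D = "degree_pairs k n s"
  have "q_op k m n A s (l2_single \<gamma> x) \<omega> = (\<Sum>p\<in>?D. term_mat k m n A p \<omega> \<gamma> x)"
    unfolding q_op_def by (intro sum.cong refl op_entriesD(3)[OF term_entries[OF J] wg])
  also have "\<dots> = component {1..k} s 1 \<omega> \<gamma> x"
  proof (cases "(\<omega>, \<gamma>) \<in> comparable_pairs k n")
    case True
    have "(\<Sum>p\<in>?D. term_mat k m n A p \<omega> \<gamma> x) =
        (\<Sum>p\<in>?D. if simplify_pair k (\<omega>, \<gamma>) = p then tau k m (\<omega>, \<gamma>) *\<^sub>R A p x else 0)"
      by (intro sum.cong refl) (simp add: term_mat_def True)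
    also have "\<dots> = (if simplify_pair k (\<omega>, \<gamma>) \<in> ?D then M \<omega> \<gamma> x else 0)"
      by (subst sum.delta'[OF finite_degree_pairs]) (simp add: toeplitz_mat_def True)
    also have "\<dots> = component {1..k} s 1 \<omega> \<gamma> x"
      by (simp add: simplify_pair_degree_iff[OF True] component_def degree_diff_def)
    finally show ?thesis .
  next
    case False
    then show ?thesis by (simp add: term_mat_def component_def toeplitz_mat_def)
  qed
  finally show "q_op k m n A s (l2_single \<gamma> x) \<omega> = component {1..k} s 1 \<omega> \<gamma> x" .
qed

abbreviation "rterm r \<equiv> \<lambda>s f \<omega>. r ^ (\<Sum>i\<in>{1..k}. nat \<bar>s i\<bar>) *\<^sub>R q_op k m n A s f \<omega>"

lemma scaled_component:
  "r ^ (\<Sum>i\<in>{1..k}. nat \<bar>s i\<bar>) *\<^sub>R component {1..k} s 1 \<omega> \<gamma> x = component {1..k} s r \<omega> \<gamma> x"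
proof (cases "\<forall>i\<in>{1..k}. degree_diff \<omega> \<gamma> i = s i")
  case True
  then have "total_degree k \<omega> \<gamma> = (\<Sum>i\<in>{1..k}. nat \<bar>s i\<bar>)" by (simp add: total_degree_def)
  then show ?thesis using True by (simp add: component_def)
qed (simp only: component_def if_False scaleR_zero_right)

lemma rterm_entries: "op_entries F (rterm r s) (component {1..k} s r)"
proof (rule op_entries_cong)
  show "op_entries F (rterm r s) (\<lambda>\<omega> \<gamma> x. r ^ (\<Sum>i\<in>{1..k}. nat \<bar>s i\<bar>) *\<^sub>R component {1..k} s 1 \<omega> \<gamma> x)"
    by (rule op_entries_scaleR[OF q_op_entries])
qed (intro ext scaled_component)

lemma component_Cons:
  assumes "i \<in> {1..k}" "i \<notin> I"
  shows "component ({1..k} - I) (s(i := j)) r \<omega> \<gamma> x =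
    (if degree_diff \<omega> \<gamma> i = j then component ({1..k} - insert i I) s r \<omega> \<gamma> x else 0)"
proof -
  have "(\<forall>i'\<in>{1..k} - I. degree_diff \<omega> \<gamma> i' = (s(i := j)) i') \<longleftrightarrow>
    degree_diff \<omega> \<gamma> i = j \<and> (\<forall>i'\<in>{1..k} - insert i I. degree_diff \<omega> \<gamma> i' = s i')"
    using assms by auto
  then show ?thesis by (simp only: component_def) simp
qed

text \<open>\<open>l2_op_iter_sum\<close> leaves the inner limits \<open>G\<close> free, but an
  entry lies on a single diagonal in coordinate \<open>i\<close>: of the sum over \<open>j\<close>
  only the term \<open>j = degree_diff \<omega> \<gamma> i\<close> can survive. So all iterated
  limits have the same entries.\<close>

lemma iter_sum_entries:
  assumes "l2_op_iter_sum F I (rterm r) s L" "distinct I" "set I \<subseteq> {1..k}"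
  shows "op_entries F L (component ({1..k} - set I) s r)"
  using assms
proof (induction I arbitrary: s L)
  case Nil
  then show ?case using rterm_entries[of r s] by simp
next
  case (Cons i I)
  obtain G where it: "\<And>j. l2_op_iter_sum F I (rterm r) (s(i := j)) (G j)"
    and hs: "l2_op_has_sum F G (UNIV :: int set) L"
    using Cons.prems(1) by auto
  have i: "i \<in> {1..k}" "i \<notin> set I" using Cons.prems by auto
  have G: "op_entries F (G j) (component ({1..k} - set I) (s(i := j)) r)" for j
    by (rule Cons.IH[OF it]) (use Cons.prems in auto)
  show ?case
  proof (rule op_entriesI[OF _ component_clinear])
    show "l2_bounded_op F L" using hs by (simp add: l2_op_has_sum_def)
    fix \<omega> \<gamma> and x :: 'a assume wg: "\<omega> \<in> F" "\<gamma> \<in> F"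
    have "((\<lambda>j. G j (l2_single \<gamma> x) \<omega>) has_sum L (l2_single \<gamma> x) \<omega>) UNIV"
      by (rule l2_op_has_sum_apply[OF hs op_entriesD(1)[OF G] l2_single(1)[OF wg(2)]])
    moreover have "((\<lambda>j. G j (l2_single \<gamma> x) \<omega>) has_sum component ({1..k} - set (i # I)) s r \<omega> \<gamma> x) UNIV"
      by (rule has_sum_finite_neutralI[of "{degree_diff \<omega> \<gamma> i}"])
         (simp_all only: op_entriesD(3)[OF G wg] component_Cons[OF i], simp_all)
    ultimately show "L (l2_single \<gamma> x) \<omega> = component ({1..k} - set (i # I)) s r \<omega> \<gamma> x"
      by (rule has_sum_unique)
  qed
qed

lemma radial_limit_entries:
  assumes "radial_has_limit k m n A r L"
  shows "op_entries F L (radial_mat r)"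
proof -
  \<comment> \<open>Every coordinate is summed over, so the initial multi-index
    \<open>\<lambda>_. 0\<close> leaves no trace.\<close>
  have "op_entries F L (component ({1..k} - set [1..<Suc k]) (\<lambda>_. 0) r)"
    by (rule iter_sum_entries) (use assms in \<open>auto simp: radial_has_limit_def\<close>)
  moreover have "{1..k} - set [1..<Suc k] = {}" by auto
  ultimately have "op_entries F L (component {} (\<lambda>_. 0) r)" by metis
  then show ?thesis
    by (rule op_entries_cong[rotated]) (simp add: component_def fun_eq_iff)
qed

text \<open>Existence and a bound are proved together. Each summation costs the factor
  \<open>c\<close>; the powers of \<open>r\<close> of the coordinates not yet summed are kept in the
  bound, since they make the next geometric series converge.\<close>

lemma iter_sum_exists:
  assumes r: "0 \<le> r" "r < 1" and B: "\<And>s. mat_bounded F (component {1..k} s 1) B"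
    and I: "distinct I" "set I \<subseteq> {1..k}"
  defines "c \<equiv> \<Sum>\<^sub>\<infinity>j::int. r ^ nat \<bar>j\<bar>"
  shows "(\<exists>L. l2_op_iter_sum F I (rterm r) s L) \<and>
    mat_bounded F (component ({1..k} - set I) s r)
      (B * c ^ length I * r ^ (\<Sum>i\<in>{1..k} - set I. nat \<bar>s i\<bar>))"
  using I
proof (induction I arbitrary: s)
  case Nil
  have "mat_bounded F (component {1..k} s r) (\<bar>r ^ (\<Sum>i\<in>{1..k}. nat \<bar>s i\<bar>)\<bar> * B)"
    by (rule mat_bounded_cong[OF _ mat_bounded_scaleR[OF B[of s]]]) (intro ext scaled_component)
  then show ?case using r by (simp add: mult.commute)
next
  case (Cons i I)
  have i: "i \<in> {1..k}" "i \<notin> set I" using Cons.prems by auto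
  let ?N = "component ({1..k} - set (i # I)) s r"
  \<comment> \<open>The part of the bound shared by all diagonals in coordinate \<open>i\<close>,
    with \<open>r ^ nat \<bar>j\<bar>\<close> split off.\<close>
  define D where "D = B * c ^ length I * r ^ (\<Sum>i\<in>{1..k} - set (i # I). nat \<bar>s i\<bar>)"
  have IH: "\<exists>L. l2_op_iter_sum F I (rterm r) (s(i := j)) L"
    "mat_bounded F (component ({1..k} - set I) (s(i := j)) r)
      (B * c ^ length I * r ^ (\<Sum>i'\<in>{1..k} - set I. nat \<bar>(s(i := j)) i'\<bar>))" for j
  proof -
    have I: "distinct I" "set I \<subseteq> {1..k}" using Cons.prems by auto
    show "\<exists>L. l2_op_iter_sum F I (rterm r) (s(i := j)) L" by (rule conjunct1[OF Cons.IH[OF I]])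
    show "mat_bounded F (component ({1..k} - set I) (s(i := j)) r)
      (B * c ^ length I * r ^ (\<Sum>i'\<in>{1..k} - set I. nat \<bar>(s(i := j)) i'\<bar>))"
      by (rule conjunct2[OF Cons.IH[OF I]])
  qed
  have "\<forall>j. \<exists>L. l2_op_iter_sum F I (rterm r) (s(i := j)) L" by (rule allI) (rule IH(1))
  from choice[OF this] obtain G where G': "\<forall>j. l2_op_iter_sum F I (rterm r) (s(i := j)) (G j)" ..
  note G = spec[OF G']
  have comp: "mat_bounded F (\<lambda>\<omega> \<gamma> x. if degree_diff \<omega> \<gamma> i = j then ?N \<omega> \<gamma> x else 0) (D * r ^ nat \<bar>j\<bar>)" for j
  proof -
    have "{1..k} - set I = insert i ({1..k} - set (i # I))" using i by auto
    then have "(\<Sum>i'\<in>{1..k} - set I. nat \<bar>(s(i := j)) i'\<bar>) =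
        (\<Sum>i'\<in>insert i ({1..k} - set (i # I)). nat \<bar>(s(i := j)) i'\<bar>)" by (rule arg_cong)
    also have "\<dots> = nat \<bar>j\<bar> + (\<Sum>i'\<in>{1..k} - set (i # I). nat \<bar>(s(i := j)) i'\<bar>)"
      by (subst sum.insert) auto
    also have "(\<Sum>i'\<in>{1..k} - set (i # I). nat \<bar>(s(i := j)) i'\<bar>) = (\<Sum>i'\<in>{1..k} - set (i # I). nat \<bar>s i'\<bar>)"
      by (intro sum.cong) auto
    finally have "B * c ^ length I * r ^ (\<Sum>i'\<in>{1..k} - set I. nat \<bar>(s(i := j)) i'\<bar>) = D * r ^ nat \<bar>j\<bar>"
      unfolding D_def by (simp add: power_add mult_ac)
    then have "mat_bounded F (component ({1..k} - set I) (s(i := j)) r) (D * r ^ nat \<bar>j\<bar>)"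
      using IH(2)[of j] by (simp only:)
    then show ?thesis
      by (rule mat_bounded_cong[rotated]) (intro ext, simp only: component_Cons[OF i] list.set)
  qed
  have D0: "0 \<le> D" using mat_boundedD(1)[OF comp[of 0]] by simp
  have hs: "((\<lambda>j::int. r ^ nat \<bar>j\<bar>) has_sum c) UNIV"
    unfolding c_def by (rule has_sum_infsum[OF power_nat_abs_summable[OF r]])
  have fin: "(\<Sum>j\<in>Z. r ^ nat \<bar>j\<bar>) \<le> c" if "finite Z" for Z :: "int set"
    by (rule finite_sum_le_has_sum[OF hs that]) (use r in auto)
  \<comment> \<open>The error after the diagonals in \<open>X\<close> is the matrix of the remaining
    diagonals, bounded by the tail of the geometric series. For empty \<open>X\<close> this is
    boundedness of the whole sum.\<close>
  have tail: "mat_bounded F (\<lambda>\<omega> \<gamma> x. if degree_diff \<omega> \<gamma> i \<in> X then 0 else ?N \<omega> \<gamma> x)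
      (D * (c - (\<Sum>j\<in>X. r ^ nat \<bar>j\<bar>)))" if X: "finite X" for X
  proof (rule mat_bounded_sum_components[where d = "\<lambda>\<omega> \<gamma>. degree_diff \<omega> \<gamma> i" and J = "- X"])
    show "bounded_clinear (\<lambda>x. if degree_diff \<omega> \<gamma> i \<in> X then 0 else ?N \<omega> \<gamma> x)" for \<omega> \<gamma>
      by (cases "degree_diff \<omega> \<gamma> i \<in> X") (simp_all add: bounded_clinear_zero component_clinear)
    show "mat_bounded F (\<lambda>\<omega> \<gamma> x. if degree_diff \<omega> \<gamma> i = j then
        if degree_diff \<omega> \<gamma> i \<in> X then 0 else ?N \<omega> \<gamma> x else 0) (D * r ^ nat \<bar>j\<bar>)" if "j \<in> - X" for j
      by (rule mat_bounded_cong[OF _ comp]) (use that in \<open>auto simp: fun_eq_iff\<close>)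
    show "(\<Sum>j\<in>Z. D * r ^ nat \<bar>j\<bar>) \<le> D * (c - (\<Sum>j\<in>X. r ^ nat \<bar>j\<bar>))" if Z: "finite Z" "Z \<subseteq> - X" for Z
    proof -
      have "(\<Sum>j\<in>Z. r ^ nat \<bar>j\<bar>) + (\<Sum>j\<in>X. r ^ nat \<bar>j\<bar>) = (\<Sum>j\<in>Z \<union> X. r ^ nat \<bar>j\<bar>)"
        by (rule sum.union_disjoint[symmetric]) (use X Z in auto)
      then have "(\<Sum>j\<in>Z. r ^ nat \<bar>j\<bar>) \<le> c - (\<Sum>j\<in>X. r ^ nat \<bar>j\<bar>)"
        using fin[of "Z \<union> X"] X Z by simp
      then show ?thesis unfolding sum_distrib_left[symmetric] by (rule mult_left_mono[OF _ D0])
    qed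
  qed auto
  have bdN: "mat_bounded F ?N (D * c)"
    using tail[of "{}"] by simp
  have Gent: "op_entries F (G j) (component ({1..k} - set I) (s(i := j)) r)" for j
    by (rule iter_sum_entries[OF G]) (use Cons.prems in auto)
  have "l2_op_has_sum F G UNIV (mat_op F ?N)"
    unfolding l2_op_has_sum_def
  proof
    show L: "l2_bounded_op F (mat_op F ?N)" by (rule mat_op_bounded_op[OF bdN])
    let ?D = "\<lambda>X f \<omega>. mat_op F ?N f \<omega> - (\<Sum>j\<in>X. G j f \<omega>)"
    have bop: "l2_bounded_op F (?D X)" for X
      by (rule l2_bounded_op_minus[OF L l2_bounded_op_finite_sum]) (rule op_entriesD(1)[OF Gent])
    have le: "l2_opnorm F (?D X) \<le> D * (c - (\<Sum>j\<in>X. r ^ nat \<bar>j\<bar>))" if X: "finite X" for X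
    proof (rule op_entries_norm(2)[OF op_entriesI[OF bop mat_boundedD(2)[OF tail[OF X]]] tail[OF X]])
      fix \<omega> \<gamma> and x :: 'a assume wg: "\<omega> \<in> F" "\<gamma> \<in> F"
      have "(\<Sum>j\<in>X. G j (l2_single \<gamma> x) \<omega>) = (\<Sum>j\<in>X. if degree_diff \<omega> \<gamma> i = j then ?N \<omega> \<gamma> x else 0)"
        by (intro sum.cong refl) (simp only: op_entriesD(3)[OF Gent wg] component_Cons[OF i] list.set)
      also have "\<dots> = (if degree_diff \<omega> \<gamma> i \<in> X then ?N \<omega> \<gamma> x else 0)"
        by (rule sum.delta'[OF X])
      finally show "?D X (l2_single \<gamma> x) \<omega> = (if degree_diff \<omega> \<gamma> i \<in> X then 0 else ?N \<omega> \<gamma> x)"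
        using op_entriesD(3)[OF op_entries_mat_op[OF bdN] wg, of x] by simp
    qed
    have "((\<lambda>X. D * (c - (\<Sum>j\<in>X. r ^ nat \<bar>j\<bar>))) \<longlongrightarrow> D * (c - c)) (finite_subsets_at_top (UNIV :: int set))"
      using hs unfolding has_sum_def by (intro tendsto_intros)
    then have lim: "((\<lambda>X. D * (c - (\<Sum>j\<in>X. r ^ nat \<bar>j\<bar>))) \<longlongrightarrow> 0) (finite_subsets_at_top (UNIV :: int set))"
      by simp
    show "((\<lambda>X. l2_opnorm F (?D X)) \<longlongrightarrow> 0) (finite_subsets_at_top UNIV)"
    proof (rule tendsto_sandwich[OF _ _ tendsto_const lim])
      show "\<forall>\<^sub>F X in finite_subsets_at_top UNIV. 0 \<le> l2_opnorm F (?D X)"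
        by (rule eventually_finite_subsets_at_top_weakI) (rule l2_opnorm_nonneg[OF bop])
      show "\<forall>\<^sub>F X in finite_subsets_at_top UNIV. l2_opnorm F (?D X) \<le> D * (c - (\<Sum>j\<in>X. r ^ nat \<bar>j\<bar>))"
        by (rule eventually_finite_subsets_at_top_weakI) (rule le)
    qed
  qed
  then have "l2_op_iter_sum F (i # I) (rterm r) s (mat_op F ?N)" using G' by (auto simp only: l2_op_iter_sum.simps)
  moreover have "D * c = B * c ^ length (i # I) * r ^ (\<Sum>i\<in>{1..k} - set (i # I). nat \<bar>s i\<bar>)"
    by (simp add: D_def mult_ac)
  ultimately show ?case using bdN by (simp only:) blast
qed

lemma radial_limit_exists:
  assumes "0 \<le> r" "r < 1" "\<And>s. mat_bounded F (component {1..k} s 1) B"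
  shows "\<exists>L. radial_has_limit k m n A r L"
  unfolding radial_has_limit_def
  by (rule conjunct1[OF iter_sum_exists[OF assms distinct_upt]]) auto

end

section \<open>Convergence in the norm of vectors\<close>

lemma l2_has_sum_apply:
  assumes s: "l2_has_sum F t J f" and t: "\<And>j. j \<in> J \<Longrightarrow> t j \<in> l2 F"
  shows "((\<lambda>j. t j \<omega>) has_sum f \<omega>) J"
proof -
  let ?D = "\<lambda>X \<omega>. f \<omega> - (\<Sum>j\<in>X. t j \<omega>)"
  have f: "f \<in> l2 F" and lim: "((\<lambda>X. l2_norm F (?D X)) \<longlongrightarrow> 0) (finite_subsets_at_top J)"
    using s by (auto simp: l2_has_sum_def)
  have "((\<lambda>X. ?D X \<omega>) \<longlongrightarrow> 0) (finite_subsets_at_top J)"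
  proof (rule Lim_null_comparison[OF _ lim], rule eventually_finite_subsets_at_top_weakI)
    fix X assume X: "finite X" "X \<subseteq> J"
    have "?D X \<in> l2 F" by (rule l2_diff(1)[OF f l2_sum(1)]) (use X t in auto)
    then show "norm (?D X \<omega>) \<le> l2_norm F (?D X)" by (rule norm_le_l2_norm)
  qed
  then have "((\<lambda>X. f \<omega> - ?D X \<omega>) \<longlongrightarrow> f \<omega> - 0) (finite_subsets_at_top J)"
    by (intro tendsto_intros)
  then show ?thesis by (simp add: has_sum_def)
qed

text \<open>Justifies the definite description in \<open>series_apply\<close>.\<close>

lemma l2_has_sum_unique:
  assumes "l2_has_sum F t J f" "l2_has_sum F t J g" "\<And>j. j \<in> J \<Longrightarrow> t j \<in> l2 F"
  shows "f = g"
  by (rule ext) (rule has_sum_unique[OF l2_has_sum_apply[OF assms(1,3)] l2_has_sum_apply[OF assms(2,3)]])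

text \<open>Dominated convergence by hand: on a finite set the factor tends to 0, and off it
  \<open>v\<close> is small while the factor has modulus at most one. The exponents may be
  unbounded.\<close>

lemma l2_radial_tendsto_0:
  assumes v: "v \<in> l2 F"
  shows "((\<lambda>r::real. l2_norm F (\<lambda>\<omega>. (r ^ e \<omega> - 1) *\<^sub>R v \<omega>)) \<longlongrightarrow> 0) (at_left 1)"
proof (rule tendstoI)
  fix \<epsilon> :: real assume \<epsilon>: "\<epsilon> > 0"
  obtain Y where Y: "finite Y" "Y \<subseteq> F" "l2_norm F (\<lambda>\<omega>. if \<omega> \<in> Y then 0 else v \<omega>) < \<epsilon> / 2"
    using l2_norm_cofinite_less[OF v, of "\<epsilon> / 2"] \<epsilon> by auto
  have "((\<lambda>r::real. r) \<longlongrightarrow> 1) (at_left 1)" by (rule tendsto_ident_at)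
  then have "((\<lambda>r. L2_set (\<lambda>\<omega>. norm ((r ^ e \<omega> - 1) *\<^sub>R v \<omega>)) Y) \<longlongrightarrow>
      L2_set (\<lambda>\<omega>. norm ((1 ^ e \<omega> - 1) *\<^sub>R v \<omega>)) Y) (at_left 1)"
    unfolding L2_set_def by (intro tendsto_intros)
  moreover have "L2_set (\<lambda>\<omega>. norm ((1 ^ e \<omega> - 1 :: real) *\<^sub>R v \<omega>)) Y = 0" by (simp add: L2_set_def)
  ultimately have "\<forall>\<^sub>F r in at_left 1. L2_set (\<lambda>\<omega>. norm ((r ^ e \<omega> - 1) *\<^sub>R v \<omega>)) Y < \<epsilon> / 2"
    using \<epsilon> by (intro order_tendstoD(2)) auto
  moreover have "\<forall>\<^sub>F r in at_left (1::real). 0 < r \<and> r < 1"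
    using eventually_at_left_real[of 0 1] by (auto elim: eventually_mono)
  ultimately show "\<forall>\<^sub>F r in at_left 1. dist (l2_norm F (\<lambda>\<omega>. (r ^ e \<omega> - 1) *\<^sub>R v \<omega>)) 0 < \<epsilon>"
  proof eventually_elim
    case (elim r)
    let ?w = "\<lambda>\<omega>. (r ^ e \<omega> - 1) *\<^sub>R v \<omega>" and ?u = "\<lambda>\<omega>. if \<omega> \<in> Y then 0 else v \<omega>"
    have u: "?u \<in> l2 F" by (rule l2_cut_compl[OF v])
    have le: "fnorm ?w X \<le> fnorm ?w Y + l2_norm F ?u"
      if X: "finite X" "X \<subseteq> F" for X
    proof -
      let ?a = "\<lambda>\<omega>. if \<omega> \<in> Y then ?w \<omega> else 0" and ?b = "\<lambda>\<omega>. if \<omega> \<in> Y then 0 else ?w \<omega>"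
      have "fnorm ?w X = L2_set (\<lambda>\<omega>. norm (?a \<omega> + ?b \<omega>)) X"
        by (intro L2_set_cong) auto
      also have "\<dots> \<le> fnorm ?a X + fnorm ?b X"
        by (rule L2_set_norm_triangle)
      also have "fnorm ?a X \<le> fnorm ?w Y"
      proof -
        have "(\<Sum>\<omega>\<in>X. (norm (?a \<omega>))\<^sup>2) = (\<Sum>\<omega>\<in>X \<inter> Y. (norm (?w \<omega>))\<^sup>2)"
          by (rule sum.mono_neutral_cong_right) (use X in auto)
        also have "\<dots> \<le> (\<Sum>\<omega>\<in>Y. (norm (?w \<omega>))\<^sup>2)" by (rule sum_mono2) (use Y in auto)
        finally show ?thesis unfolding L2_set_def by (rule real_sqrt_le_mono)
      qed
      also have "fnorm ?b X \<le> fnorm ?u X"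
      proof (rule L2_set_mono)
        fix \<omega>
        have "r ^ e \<omega> \<le> 1" "0 \<le> r ^ e \<omega>" using elim by (auto intro: power_le_one)
        then have "\<bar>r ^ e \<omega> - 1\<bar> * norm (v \<omega>) \<le> 1 * norm (v \<omega>)"
          by (intro mult_right_mono) auto
        then show "norm (?b \<omega>) \<le> norm (?u \<omega>)" by simp
      qed auto
      also have "\<dots> \<le> l2_norm F ?u" by (rule L2_set_le_l2_norm[OF u X])
      finally show ?thesis by linarith
    qed
    have "l2_norm F ?w \<le> fnorm ?w Y + l2_norm F ?u"
      by (rule l2_bounded_finite(2)[OF _ le]) (use l2_outside[OF v] in auto)
    then show ?case using elim Y(3) by (simp add: dist_real_def)
  qed
qed

text \<open>With \<open>poly_space_finite_support\<close>, the span of the elementary tensors is the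
  space of finitely supported vectors. The pairs \<open>(p \<gamma>, \<gamma>)\<close> with
  coefficients 1 form the linear combination.\<close>

lemma finite_support_in_poly_space:
  assumes "finite X" "X \<subseteq> Fn k n" "\<And>\<omega>. \<omega> \<notin> X \<Longrightarrow> p \<omega> = 0"
  shows "p \<in> poly_space k n"
proof -
  let ?Z = "(\<lambda>\<gamma>. (p \<gamma>, \<gamma>)) ` X"
  have "p = (\<lambda>\<omega>. \<Sum>(h, \<alpha>)\<in>?Z. (\<lambda>_. 1) (h, \<alpha>) *\<^sub>C elem_tensor h (l2_basis \<alpha>) \<omega>)"
  proof -
    have "inj_on (\<lambda>\<gamma>. (p \<gamma>, \<gamma>)) X" by (auto simp: inj_on_def)
    then have eq: "(\<Sum>(h, \<alpha>)\<in>?Z. (\<lambda>_. 1) (h, \<alpha>) *\<^sub>C elem_tensor h (l2_basis \<alpha>) \<omega>) = (\<Sum>\<gamma>\<in>X. l2_single \<gamma> (p \<gamma>) \<omega>)" for \<omega>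
      by (simp add: sum.reindex elem_tensor_l2_basis)
    have p: "p = (\<lambda>\<omega>. \<Sum>\<gamma>\<in>X. l2_single \<gamma> (p \<gamma>) \<omega>)" by (rule finite_support_sum_single[OF assms(1,3)])
    show ?thesis by (rule ext) (rule trans[OF fun_cong[OF p] eq[symmetric]])
  qed
  moreover have "finite ?Z" "?Z \<subseteq> UNIV \<times> Fn k n" using assms by auto
  ultimately show ?thesis
    unfolding poly_space_def by (intro CollectI exI[of _ "\<lambda>_. 1"] exI[of _ ?Z] conjI)
qed

lemma poly_space_finite_support:
  assumes "p \<in> poly_space k n"
  shows "\<exists>X. finite X \<and> X \<subseteq> Fn k n \<and> (\<forall>\<omega>. \<omega> \<notin> X \<longrightarrow> p \<omega> = 0)"
proof -
  obtain c Z where Z: "finite Z" "Z \<subseteq> UNIV \<times> Fn k n"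
    and p: "p = (\<lambda>\<omega>. \<Sum>(h, \<alpha>)\<in>Z. c (h, \<alpha>) *\<^sub>C elem_tensor h (l2_basis \<alpha>) \<omega>)"
    using assms unfolding poly_space_def by blast
  have "p \<omega> = 0" if "\<omega> \<notin> snd ` Z" for \<omega>
    unfolding p elem_tensor_l2_basis
    by (rule sum.neutral) (use that in \<open>force simp: l2_single_def\<close>)
  moreover have "finite (snd ` Z)" "snd ` Z \<subseteq> Fn k n" using Z by auto
  ultimately show ?thesis by (intro exI[of _ "snd ` Z"] conjI allI impI)
qed

context formal_series
begin

section \<open>Contractive passage to components and radial matrices\<close>

lemma component_bounded:
  assumes M: "mat_bounded F M C"
  shows "mat_bounded F (component {1..k} s 1) C"
proof -
  have "mat_bounded F (component I s 1) C" if "finite I" for I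
    using that
  proof (induction I rule: finite_induct)
    case empty
    show ?case by (rule mat_bounded_cong[OF _ M]) (simp add: component_def fun_eq_iff)
  next
    case (insert i I)
    show ?case
      by (rule mat_bounded_cong[OF _ Schur_multiplier_level[OF insert.IH, of "\<lambda>\<omega>. length (\<omega> i)" "s i"]])
         (simp add: component_def degree_diff_def fun_eq_iff)
  qed
  then show ?thesis by simp
qed

text \<open>The estimate in \<open>iter_sum_exists\<close> has factors \<open>c\<close> that blow up
  as \<open>r -> 1\<close>. Here the exponent is a sum over coordinates, so the kernel is a product
  of one-coordinate kernels, and each Schur multiplication keeps \<open>C\<close>.\<close>

lemma radial_bounded:
  assumes M: "mat_bounded F M C" and r: "0 \<le> r" "r \<le> 1"
  shows "mat_bounded F (radial_mat r) C"
proof -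
  have "mat_bounded F (\<lambda>\<omega> \<gamma> x. r ^ (\<Sum>i\<in>I. nat \<bar>degree_diff \<omega> \<gamma> i\<bar>) *\<^sub>R M \<omega> \<gamma> x) C" if "finite I" for I
    using that
  proof (induction I rule: finite_induct)
    case (insert i I)
    show ?case
      by (rule mat_bounded_cong[OF _ Schur_multiplier_radial[OF insert.IH r, of "\<lambda>\<omega>. length (\<omega> i)"]])
         (simp add: insert.hyps degree_diff_def power_add fun_eq_iff)
  qed (simp add: M)
  then show ?thesis unfolding total_degree_def by simp
qed

section \<open>The series on finitely supported vectors\<close>

lemma series_term_finite_support:
  assumes X: "finite X" "X \<subseteq> F" "\<And>\<omega>. \<omega> \<notin> X \<Longrightarrow> p \<omega> = 0"
    and J: "j \<in> J_pairs k n"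
  shows "series_term k m n A j p \<in> l2 F"
    "\<omega> \<in> F \<Longrightarrow> series_term k m n A j p \<omega> = (\<Sum>\<gamma>\<in>X. term_mat k m n A j \<omega> \<gamma> (p \<gamma>))"
proof -
  show "series_term k m n A j p \<in> l2 F"
    by (rule l2_bounded_opD(1)[OF op_entriesD(1)[OF term_entries[OF J]] l2_finite_support(1)[OF X]])
  show "series_term k m n A j p \<omega> = (\<Sum>\<gamma>\<in>X. term_mat k m n A j \<omega> \<gamma> (p \<gamma>))" if "\<omega> \<in> F"
    by (rule op_entries_finite_support[OF term_entries[OF J] X that])
qed

lemma sum_term_mat:
  assumes "finite Z"
  shows "(\<Sum>j\<in>Z. term_mat k m n A j \<omega> \<gamma> x) = (if simplify_pair k (\<omega>, \<gamma>) \<in> Z then M \<omega> \<gamma> x else 0)"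
proof (cases "(\<omega>, \<gamma>) \<in> comparable_pairs k n")
  case True
  have "(\<Sum>j\<in>Z. term_mat k m n A j \<omega> \<gamma> x) =
      (\<Sum>j\<in>Z. if simplify_pair k (\<omega>, \<gamma>) = j then tau k m (\<omega>, \<gamma>) *\<^sub>R A j x else 0)"
    by (intro sum.cong refl) (simp add: term_mat_def True)
  also have "\<dots> = (if simplify_pair k (\<omega>, \<gamma>) \<in> Z then M \<omega> \<gamma> x else 0)"
    by (subst sum.delta'[OF assms]) (simp add: toeplitz_mat_def True)
  finally show ?thesis .
qed (simp add: term_mat_def toeplitz_mat_def)

text \<open>In a fixed column, different indices of the series occupy disjoint sets of rows, so the
  remainder after \<open>Z\<close> is the column with the rows of the classes in \<open>Z\<close>
  deleted. Square summability of the columns makes it small.\<close>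

lemma series_has_sum:
  assumes col: "\<And>\<gamma> x. \<gamma> \<in> F \<Longrightarrow> (\<lambda>\<omega>. if \<omega> \<in> F then M \<omega> \<gamma> x else 0) \<in> l2 F"
    and X: "finite X" "X \<subseteq> F" "\<And>\<omega>. \<omega> \<notin> X \<Longrightarrow> p \<omega> = 0"
  shows "l2_has_sum F (\<lambda>j. series_term k m n A j p) (J_pairs k n)
    (\<lambda>\<omega>. if \<omega> \<in> F then \<Sum>\<gamma>\<in>X. M \<omega> \<gamma> (p \<gamma>) else 0)"
proof -
  let ?J = "J_pairs k n"
  let ?f = "\<lambda>\<omega>. if \<omega> \<in> F then \<Sum>\<gamma>\<in>X. M \<omega> \<gamma> (p \<gamma>) else 0"
  let ?v = "\<lambda>\<gamma> \<omega>. if \<omega> \<in> F then M \<omega> \<gamma> (p \<gamma>) else 0"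
  let ?R = "\<lambda>Z \<gamma> \<omega>. if simplify_pair k (\<omega>, \<gamma>) \<in> Z then 0 else ?v \<gamma> \<omega>"
  have v: "?v \<gamma> \<in> l2 F" if "\<gamma> \<in> X" for \<gamma> using col X(2) that by blast
  have R: "?R Z \<gamma> \<in> l2 F" if "\<gamma> \<in> X" for Z \<gamma>
    by (rule l2_cut_compl[OF v[OF that]])
  have f: "?f = (\<lambda>\<omega>. \<Sum>\<gamma>\<in>X. ?v \<gamma> \<omega>)" by (auto simp: fun_eq_iff)
  have fl2: "?f \<in> l2 F" unfolding f by (rule l2_sum(1)[OF v])
  have rem: "(\<lambda>\<omega>. ?f \<omega> - (\<Sum>j\<in>Z. series_term k m n A j p \<omega>)) = (\<lambda>\<omega>. \<Sum>\<gamma>\<in>X. ?R Z \<gamma> \<omega>)"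
    if Z: "finite Z" "Z \<subseteq> ?J" for Z
  proof
    fix \<omega>
    show "?f \<omega> - (\<Sum>j\<in>Z. series_term k m n A j p \<omega>) = (\<Sum>\<gamma>\<in>X. ?R Z \<gamma> \<omega>)"
    proof (cases "\<omega> \<in> F")
      case True
      have "(\<Sum>j\<in>Z. series_term k m n A j p \<omega>) = (\<Sum>j\<in>Z. \<Sum>\<gamma>\<in>X. term_mat k m n A j \<omega> \<gamma> (p \<gamma>))"
        by (intro sum.cong refl series_term_finite_support(2)[OF X _ True]) (use Z in auto)
      also have "\<dots> = (\<Sum>\<gamma>\<in>X. if simplify_pair k (\<omega>, \<gamma>) \<in> Z then M \<omega> \<gamma> (p \<gamma>) else 0)"
        by (subst sum.swap) (simp only: sum_term_mat[OF Z(1)])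
      finally show ?thesis
        using True by (simp add: sum_subtractf[symmetric] if_distrib cong: if_cong sum.cong)
    next
      case False
      have "series_term k m n A j p \<omega> = 0" if "j \<in> Z" for j
      proof (rule l2_outside[OF _ False])
        show "series_term k m n A j p \<in> l2 F"
          by (rule series_term_finite_support(1)[OF X]) (use that Z in auto)
      qed
      then show ?thesis unfolding if_not_P[OF False] by simp
    qed
  qed
  have lim: "((\<lambda>Z. l2_norm F (?R Z \<gamma>)) \<longlongrightarrow> 0) (finite_subsets_at_top ?J)" if g: "\<gamma> \<in> X" for \<gamma>
  proof (rule tendstoI)
    fix e :: real assume e: "e > 0"
    obtain Y where Y: "finite Y" "Y \<subseteq> F" "l2_norm F (\<lambda>\<omega>. if \<omega> \<in> Y then 0 else ?v \<gamma> \<omega>) < e"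
      by (rule l2_norm_cofinite_less[OF v[OF g] e])
    \<comment> \<open>The classes of the rows in \<open>Y\<close>: once \<open>Z\<close> contains
      them, all that remains of the column lies off \<open>Y\<close>. A row whose class is not in
      \<open>?J\<close> has entry 0, so the intersection loses nothing.\<close>
    let ?Z0 = "(\<lambda>\<omega>. simplify_pair k (\<omega>, \<gamma>)) ` Y \<inter> ?J"
    have "\<forall>\<^sub>F Z in finite_subsets_at_top ?J. finite Z \<and> ?Z0 \<subseteq> Z \<and> Z \<subseteq> ?J"
      unfolding eventually_finite_subsets_at_top using Y(1) by (intro exI[of _ ?Z0]) auto
    then show "\<forall>\<^sub>F Z in finite_subsets_at_top ?J. dist (l2_norm F (?R Z \<gamma>)) 0 < e"
    proof eventually_elim
      case (elim Z)
      have M0: "?v \<gamma> \<omega> = 0" if "simplify_pair k (\<omega>, \<gamma>) \<notin> ?J" for \<omega>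
        using that simplify_pair_in_J by (auto simp: toeplitz_mat_def)
      have "?R Z \<gamma> = (\<lambda>\<omega>. if simplify_pair k (\<omega>, \<gamma>) \<in> Z then 0 else if \<omega> \<in> Y then 0 else ?v \<gamma> \<omega>)"
      proof
        fix \<omega>
        show "?R Z \<gamma> \<omega> = (if simplify_pair k (\<omega>, \<gamma>) \<in> Z then 0 else if \<omega> \<in> Y then 0 else ?v \<gamma> \<omega>)"
        proof (cases "\<omega> \<in> Y \<and> simplify_pair k (\<omega>, \<gamma>) \<notin> Z")
          case True
          then have "simplify_pair k (\<omega>, \<gamma>) \<notin> ?J" using elim by blast
          from M0[OF this] show ?thesis using True by simp
        qed auto
      qed
      moreover have "l2_norm F (\<lambda>\<omega>. if \<not> simplify_pair k (\<omega>, \<gamma>) \<in> Z then if \<omega> \<in> Y then 0 else ?v \<gamma> \<omega> else 0)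
          \<le> l2_norm F (\<lambda>\<omega>. if \<omega> \<in> Y then 0 else ?v \<gamma> \<omega>)"
        by (rule l2_cut(2)[OF l2_cut_compl[OF v[OF g]]])
      moreover have "(\<lambda>\<omega>. if simplify_pair k (\<omega>, \<gamma>) \<in> Z then 0 else if \<omega> \<in> Y then 0 else ?v \<gamma> \<omega>) =
        (\<lambda>\<omega>. if \<not> simplify_pair k (\<omega>, \<gamma>) \<in> Z then if \<omega> \<in> Y then 0 else ?v \<gamma> \<omega> else 0)"
        by (auto simp: fun_eq_iff)
      ultimately have "l2_norm F (?R Z \<gamma>) < e" using Y(3) by (simp only:)
      then show ?case by (simp add: dist_real_def)
    qed
  qed
  have lim': "((\<lambda>Z. \<Sum>\<gamma>\<in>X. l2_norm F (?R Z \<gamma>)) \<longlongrightarrow> 0) (finite_subsets_at_top ?J)"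
    using tendsto_sum[of X "\<lambda>\<gamma> Z. l2_norm F (?R Z \<gamma>)" "\<lambda>_. 0", OF lim] by simp
  have "((\<lambda>Z. l2_norm F (\<lambda>\<omega>. ?f \<omega> - (\<Sum>j\<in>Z. series_term k m n A j p \<omega>))) \<longlongrightarrow> 0) (finite_subsets_at_top ?J)"
  proof (rule Lim_null_comparison[OF _ lim'], rule eventually_finite_subsets_at_top_weakI)
    fix Z assume Z: "finite Z" "Z \<subseteq> ?J"
    show "norm (l2_norm F (\<lambda>\<omega>. ?f \<omega> - (\<Sum>j\<in>Z. series_term k m n A j p \<omega>))) \<le> (\<Sum>\<gamma>\<in>X. l2_norm F (?R Z \<gamma>))"
      unfolding rem[OF Z] using l2_sum(2)[of X "?R Z" F, OF R] by simp
  qed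
  then show ?thesis unfolding l2_has_sum_def using fl2 by blast
qed

lemma series_apply_eq:
  assumes col: "\<And>\<gamma> x. \<gamma> \<in> F \<Longrightarrow> (\<lambda>\<omega>. if \<omega> \<in> F then M \<omega> \<gamma> x else 0) \<in> l2 F"
    and X: "finite X" "X \<subseteq> F" "\<And>\<omega>. \<omega> \<notin> X \<Longrightarrow> p \<omega> = 0"
  shows "series_apply k m n A p = (\<lambda>\<omega>. if \<omega> \<in> F then \<Sum>\<gamma>\<in>X. M \<omega> \<gamma> (p \<gamma>) else 0)"
  unfolding series_apply_def
proof (rule the_equality, rule series_has_sum[OF col X])
  fix f assume "l2_has_sum F (\<lambda>j. series_term k m n A j p) (J_pairs k n) f"
  then show "f = (\<lambda>\<omega>. if \<omega> \<in> F then \<Sum>\<gamma>\<in>X. M \<omega> \<gamma> (p \<gamma>) else 0)"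
    proof (rule l2_has_sum_unique)
    show "l2_has_sum F (\<lambda>j. series_term k m n A j p) (J_pairs k n) (\<lambda>\<omega>. if \<omega> \<in> F then \<Sum>\<gamma>\<in>X. M \<omega> \<gamma> (p \<gamma>) else 0)"
      by (rule series_has_sum[OF col X])
  qed (rule series_term_finite_support(1)[OF X])
qed

lemma bounded_column:
  assumes M: "mat_bounded F M C" and g: "\<gamma> \<in> F"
  shows "(\<lambda>\<omega>. if \<omega> \<in> F then M \<omega> \<gamma> x else 0) \<in> l2 F"
proof -
  have "mat_op F M (l2_single \<gamma> x) = (\<lambda>\<omega>. if \<omega> \<in> F then M \<omega> \<gamma> x else 0)"
    by (rule ext) (rule mat_op_single[OF M_clinear g])
  then show ?thesis using mat_op_norm(1)[OF M l2_single(1)[OF g, of x]] by simp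
qed

section \<open>Radial coefficients\<close>

lemma radial_formal_series: "formal_series k m n (radial_coeffs k r A)"
proof
  show "0 < m i" if "i \<in> {1..k}" for i by (rule m_pos[OF that])
  fix p assume p: "p \<in> J_pairs k n"
  obtain \<alpha> \<beta> where ab: "p = (\<alpha>, \<beta>)" by (cases p)
  show "bounded_clinear (radial_coeffs k r A p)"
    unfolding ab radial_coeffs_def prod.case using bounded_clinear_scaleR[OF A_clinear[OF p]] ab by simp
qed

text \<open>By \<open>simplify_pair_length\<close>, the word lengths of the reduced pair add up to
  the total length difference, so damping the coefficients damps the entries by the same
  power.\<close>

lemma radial_toeplitz_mat:
  "toeplitz_mat k m n (radial_coeffs k r A) \<omega> \<gamma> x = r ^ total_degree k \<omega> \<gamma> *\<^sub>R M \<omega> \<gamma> x"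
proof (cases "(\<omega>, \<gamma>) \<in> comparable_pairs k n")
  case True
  obtain \<alpha> \<beta> where ab: "simplify_pair k (\<omega>, \<gamma>) = (\<alpha>, \<beta>)" by (cases "simplify_pair k (\<omega>, \<gamma>)")
  show ?thesis
    using True simplify_pair_length[OF True ab]
    by (simp add: toeplitz_mat_def radial_coeffs_def ab total_degree_def degree_diff_def mult.commute)
qed (simp add: toeplitz_mat_def)

abbreviation "radial_apply r p \<equiv> series_apply k m n (radial_coeffs k r A) p"

abbreviation "Mcol \<gamma> x \<equiv> \<lambda>\<omega>. if \<omega> \<in> F then M \<omega> \<gamma> x else 0"

lemma radial_column:
  assumes v: "Mcol \<gamma> x \<in> l2 F" and r: "0 \<le> r" "r \<le> 1"
  shows "(\<lambda>\<omega>. if \<omega> \<in> F then toeplitz_mat k m n (radial_coeffs k r A) \<omega> \<gamma> x else 0) \<in> l2 F"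
proof (rule l2_bounded_finite(1))
  fix X assume X: "finite X" "X \<subseteq> F"
  let ?v = "\<lambda>\<omega>. if \<omega> \<in> F then M \<omega> \<gamma> x else 0"
  have "L2_set (\<lambda>\<omega>. norm (if \<omega> \<in> F then toeplitz_mat k m n (radial_coeffs k r A) \<omega> \<gamma> x else 0)) X \<le>
      fnorm ?v X"
  proof (rule L2_set_mono)
    fix \<omega>
    have "r ^ total_degree k \<omega> \<gamma> * norm (M \<omega> \<gamma> x) \<le> 1 * norm (M \<omega> \<gamma> x)"
      using r by (intro mult_right_mono) (auto intro: power_le_one)
    then show "norm (if \<omega> \<in> F then toeplitz_mat k m n (radial_coeffs k r A) \<omega> \<gamma> x else 0) \<le> norm (?v \<omega>)"
      using r by (simp add: radial_toeplitz_mat)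
  qed auto
  also have "\<dots> \<le> l2_norm F ?v" by (rule L2_set_le_l2_norm[OF v X])
  finally show "L2_set (\<lambda>\<omega>. norm (if \<omega> \<in> F then toeplitz_mat k m n (radial_coeffs k r A) \<omega> \<gamma> x else 0)) X \<le> l2_norm F ?v" .
qed simp

lemma radial_series_apply:
  assumes col: "\<And>\<gamma> x. \<gamma> \<in> F \<Longrightarrow> Mcol \<gamma> x \<in> l2 F"
    and r: "0 \<le> r" "r \<le> 1" and X: "finite X" "X \<subseteq> F" "\<And>\<omega>. \<omega> \<notin> X \<Longrightarrow> p \<omega> = 0"
  shows "radial_apply r p =
      (\<lambda>\<omega>. if \<omega> \<in> F then \<Sum>\<gamma>\<in>X. r ^ total_degree k \<omega> \<gamma> *\<^sub>R M \<omega> \<gamma> (p \<gamma>) else 0)"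
    and "radial_apply r p \<in> l2 F"
proof -
  \<comment> \<open>The locale is instantiated a second time, at the damped coefficients, whose
    columns are dominated by the original ones.\<close>
  interpret R: formal_series k m n "radial_coeffs k r A" by (rule radial_formal_series)
  have col': "(\<lambda>\<omega>. if \<omega> \<in> F then toeplitz_mat k m n (radial_coeffs k r A) \<omega> \<gamma> x else 0) \<in> l2 F"
    if "\<gamma> \<in> F" for \<gamma> x by (rule radial_column[OF col[OF that] r])
  have eq: "radial_apply r p =
      (\<lambda>\<omega>. if \<omega> \<in> F then \<Sum>\<gamma>\<in>X. toeplitz_mat k m n (radial_coeffs k r A) \<omega> \<gamma> (p \<gamma>) else 0)"
    by (rule R.series_apply_eq[OF col' X])
  then show "radial_apply r p =
      (\<lambda>\<omega>. if \<omega> \<in> F then \<Sum>\<gamma>\<in>X. r ^ total_degree k \<omega> \<gamma> *\<^sub>R M \<omega> \<gamma> (p \<gamma>) else 0)"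
    by (simp only: radial_toeplitz_mat)
  have "l2_has_sum F (\<lambda>j. series_term k m n (radial_coeffs k r A) j p) (J_pairs k n)
      (radial_apply r p)"
    unfolding eq by (rule R.series_has_sum[OF col' X])
  then show "radial_apply r p \<in> l2 F" by (simp add: l2_has_sum_def)
qed

section \<open>Toeplitz operators with a given Fourier representation\<close>

lemma toeplitz_representation:
  assumes M: "mat_bounded F M C"
  shows "multi_toeplitz k m n (mat_op F M)" "fourier_representation k m n A (mat_op F M)"
proof -
  note ent = op_entries_mat_op[OF M]
  show "multi_toeplitz k m n (mat_op F M)"
    unfolding multi_toeplitz_def
  \<comment> \<open>The coefficients of the series are themselves the operators \<open>B\<close> of
    the definition.\<close>
  proof (intro conjI exI[of _ A] ballI allI)
    show "l2_bounded_op F (mat_op F M)" by (rule op_entriesD(1)[OF ent])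
    show "bounded_clinear (A p)" if "p \<in> J_pairs k n" for p by (rule A_clinear[OF that])
    fix \<omega> \<gamma> and x y :: 'a assume wg: "\<omega> \<in> F" "\<gamma> \<in> F"
    show "l2_inner F (mat_op F M (elem_tensor x (l2_basis \<gamma>))) (elem_tensor y (l2_basis \<omega>)) =
      (if (\<omega>, \<gamma>) \<in> comparable_pairs k n
       then complex_of_real (tau k m (\<omega>, \<gamma>)) * cinner (A (simplify_pair k (\<omega>, \<gamma>)) x) y else 0)"
      unfolding elem_tensor_l2_basis l2_inner_single_right[OF wg(1)] op_entriesD(3)[OF ent wg]
      by (simp add: toeplitz_mat_def cinner_scaleR_left)
  qed
  show "fourier_representation k m n A (mat_op F M)"
    unfolding fourier_representation_def
  proof
    fix p :: "multiword \<Rightarrow> 'a" assume "p \<in> poly_space k n"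
    then have "\<exists>X. finite X \<and> X \<subseteq> F \<and> (\<forall>\<omega>. \<omega> \<notin> X \<longrightarrow> p \<omega> = 0)"
      by (rule poly_space_finite_support)
    then obtain X where X0: "finite X \<and> X \<subseteq> F \<and> (\<forall>\<omega>. \<omega> \<notin> X \<longrightarrow> p \<omega> = 0)" ..
    note X = conjunct1[OF X0] conjunct1[OF conjunct2[OF X0]] conjunct2[OF conjunct2[OF X0], rule_format]
    have "mat_op F M p = (\<lambda>\<omega>. if \<omega> \<in> F then \<Sum>\<gamma>\<in>X. M \<omega> \<gamma> (p \<gamma>) else 0)"
    proof
      fix \<omega> show "mat_op F M p \<omega> = (if \<omega> \<in> F then \<Sum>\<gamma>\<in>X. M \<omega> \<gamma> (p \<gamma>) else 0)"
      proof (cases "\<omega> \<in> F")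
        case True
        then show ?thesis using op_entries_finite_support[OF ent X True] by simp
      qed (simp add: mat_op_def)
    qed
    then show "l2_has_sum F (\<lambda>j. series_term k m n A j p) (J_pairs k n) (mat_op F M p)"
      using series_has_sum[OF bounded_column[OF M] X] by simp
  qed
qed

text \<open>Norm convergence on singles implies convergence at each coordinate
  \<open>\<omega>\<close>, where only the index \<open>simplify_pair k (\<omega>, \<gamma>)\<close>
  can contribute. The coefficients therefore fix all entries of \<open>T\<close>.\<close>

lemma representation_entries:
  assumes T: "multi_toeplitz k m n T" and R: "fourier_representation k m n A T"
  shows "op_entries F T M"
proof (rule op_entriesI[OF _ M_clinear])
  show "l2_bounded_op F T" using T by (simp add: multi_toeplitz_def)
  fix \<omega> \<gamma> and x :: 'a assume wg: "\<omega> \<in> F" "\<gamma> \<in> F"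
  have X: "finite {\<gamma>}" "{\<gamma>} \<subseteq> F" "\<And>\<omega>. \<omega> \<notin> {\<gamma>} \<Longrightarrow> l2_single \<gamma> x \<omega> = 0"
    using wg by (auto simp: l2_single_def)
  have "l2_has_sum F (\<lambda>j. series_term k m n A j (l2_single \<gamma> x)) (J_pairs k n) (T (l2_single \<gamma> x))"
    by (rule bspec[OF R[unfolded fourier_representation_def] finite_support_in_poly_space[OF X]])
  then have "((\<lambda>j. series_term k m n A j (l2_single \<gamma> x) \<omega>) has_sum T (l2_single \<gamma> x) \<omega>) (J_pairs k n)"
    by (rule l2_has_sum_apply) (rule series_term_finite_support(1)[OF X])
  moreover have "((\<lambda>j. series_term k m n A j (l2_single \<gamma> x) \<omega>) has_sum M \<omega> \<gamma> x) (J_pairs k n)"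
  \<comment> \<open>For an incomparable pair \<open>simplify_pair\<close> is a default value that
    may fall outside \<open>J_pairs\<close>; the intersection covers this case, with sum 0.\<close>
  proof (rule has_sum_finite_neutralI[of "{simplify_pair k (\<omega>, \<gamma>)} \<inter> J_pairs k n"])
    have t: "series_term k m n A j (l2_single \<gamma> x) \<omega> = term_mat k m n A j \<omega> \<gamma> x" if "j \<in> J_pairs k n" for j
      by (rule op_entriesD(3)[OF term_entries[OF that] wg])
    show "series_term k m n A j (l2_single \<gamma> x) \<omega> = 0"
      if "j \<in> J_pairs k n - {simplify_pair k (\<omega>, \<gamma>)} \<inter> J_pairs k n" for j
      using that t[of j] by (auto simp: term_mat_def)
    have "(\<Sum>j\<in>{simplify_pair k (\<omega>, \<gamma>)} \<inter> J_pairs k n. series_term k m n A j (l2_single \<gamma> x) \<omega>) =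
      (\<Sum>j\<in>{simplify_pair k (\<omega>, \<gamma>)} \<inter> J_pairs k n. term_mat k m n A j \<omega> \<gamma> x)"
      by (rule sum.cong[OF refl]) (use t in auto)
    also have "\<dots> = M \<omega> \<gamma> x"
      using simplify_pair_in_J[of \<omega> \<gamma> k n] by (subst sum_term_mat) (auto simp: toeplitz_mat_def)
    finally show "M \<omega> \<gamma> x = (\<Sum>j\<in>{simplify_pair k (\<omega>, \<gamma>)} \<inter> J_pairs k n. series_term k m n A j (l2_single \<gamma> x) \<omega>)" ..
  qed auto
  ultimately show "T (l2_single \<gamma> x) \<omega> = M \<omega> \<gamma> x" by (rule has_sum_unique)
qed

lemma representation_iff:
  "(\<exists>T. multi_toeplitz k m n T \<and> fourier_representation k m n A T) \<longleftrightarrow> (\<exists>C. mat_bounded F M C)"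
  using toeplitz_representation representation_entries op_entries_mat_bounded_opnorm by blast

section \<open>Norm convergence of the radial series\<close>

lemma radial_op_entries:
  assumes "\<exists>L. radial_has_limit k m n A r L"
  shows "op_entries F (radial_op k m n A r) (radial_mat r)"
  using radial_limit_entries[OF someI_ex[OF assms]] unfolding radial_op_def .

text \<open>The same \<open>C\<close> on both sides makes this serve twice, for the existence of a
  bound and for the value of the norm. The first conjunct gives sense to the second, since
  \<open>radial_op\<close> is an arbitrary choice where the series diverges.\<close>

lemma radial_limit_iff:
  "(\<forall>r\<in>{0..<1}. \<exists>L. radial_has_limit k m n A r L) \<and>
    (\<forall>r\<in>{0..<1}. l2_opnorm F (radial_op k m n A r) \<le> C) \<longleftrightarrow> mat_bounded F M C" (is "?L \<longleftrightarrow> _")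
proof
  assume a: ?L
  show "mat_bounded F M C"
  proof (rule mat_bounded_radial_limit[OF M_clinear])
    fix r :: real assume "0 \<le> r" "r < 1"
    then have r: "r \<in> {0..<1}" by simp
    show "mat_bounded F (radial_mat r) C"
      by (rule mat_bounded_mono[OF op_entries_mat_bounded_opnorm[OF radial_op_entries]]) (use a r in auto)
  qed
next
  assume M: "mat_bounded F M C"
  show ?L
  proof (intro conjI ballI)
    fix r :: real assume r: "r \<in> {0..<1}"
    show ex: "\<exists>L. radial_has_limit k m n A r L"
      by (rule radial_limit_exists[OF _ _ component_bounded[OF M]]) (use r in auto)
    show "l2_opnorm F (radial_op k m n A r) \<le> C"
      by (rule op_entries_norm(2)[OF radial_op_entries[OF ex] radial_bounded[OF M]]) (use r in auto)
  qed
qed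

lemma bdd_above_radial_norms_iff:
  "bdd_above ((\<lambda>r. l2_opnorm F (radial_op k m n A r)) ` {0..<1}) \<longleftrightarrow>
    (\<exists>C. \<forall>r\<in>{0..<1}. l2_opnorm F (radial_op k m n A r) \<le> C)"
  by (auto simp: bdd_above_def)

lemma norm_convergence_iff:
  "(\<forall>r\<in>{0..<1}. \<exists>L. radial_has_limit k m n A r L) \<and>
    bdd_above ((\<lambda>r. l2_opnorm F (radial_op k m n A r)) ` {0..<1}) \<longleftrightarrow> (\<exists>C. mat_bounded F M C)"
  unfolding bdd_above_radial_norms_iff radial_limit_iff[symmetric] by blast

text \<open>Convergence is not postulated here: the bound on the homogeneous parts supplies it
  through \<open>radial_limit_exists\<close>, and only then do the norms of \<open>radial_op\<close>
  speak about limits. Conversely, a homogeneous part is a Schur multiple of the matrix.\<close>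

lemma homogeneous_bound_iff:
  "(\<exists>B>0. \<forall>s. l2_opnorm F (q_op k m n A s) \<le> B) \<and>
    bdd_above ((\<lambda>r. l2_opnorm F (radial_op k m n A r)) ` {0..<1}) \<longleftrightarrow> (\<exists>C. mat_bounded F M C)"
  (is "?H \<and> ?B \<longleftrightarrow> _")
proof
  assume a: "?H \<and> ?B"
  then obtain B where B: "\<And>s. l2_opnorm F (q_op k m n A s) \<le> B" by blast
  have comp: "mat_bounded F (component {1..k} s 1) B" for s
    by (rule mat_bounded_mono[OF op_entries_mat_bounded_opnorm[OF q_op_entries] B])
  have "\<exists>L. radial_has_limit k m n A r L" if "r \<in> {0..<1}" for r
    by (rule radial_limit_exists[OF _ _ comp]) (use that in auto)
  then show "\<exists>C. mat_bounded F M C" using a norm_convergence_iff by blast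
next
  assume "\<exists>C. mat_bounded F M C"
  then obtain C where M: "mat_bounded F M C" by blast
  \<comment> \<open>\<open>C\<close> may be 0, whereas the bound asked for is positive.\<close>
  have "l2_opnorm F (q_op k m n A s) \<le> C + 1" for s
    using op_entries_norm(2)[OF q_op_entries component_bounded[OF M], of s] by simp
  moreover have "C + 1 > 0" using mat_boundedD(1)[OF M] by simp
  ultimately have ?H by blast
  moreover have ?B
    by (rule conjunct2[OF norm_convergence_iff[THEN iffD2]]) (rule exI[of _ C], rule M)
  ultimately show "?H \<and> ?B" ..
qed

section \<open>The WOT condition and the bound on polynomials\<close>

text \<open>The adjoint moves across the inner product and one factor \<open>tau\<close> goes to
  each side; the WOT series becomes the Gram form of the columns at \<open>\<gamma>\<close>.\<close>

lemma wot_term: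
  assumes C: "(\<omega>, \<gamma>) \<in> comparable_pairs k n"
  shows "cinner ((tau k m (\<omega>, \<gamma>))\<^sup>2 *\<^sub>R
      cadjoint (A (simplify_pair k (\<omega>, \<gamma>))) (A (simplify_pair k (\<omega>, \<gamma>)) x)) y =
    cinner (M \<omega> \<gamma> x) (M \<omega> \<gamma> y)"
proof -
  let ?A = "A (simplify_pair k (\<omega>, \<gamma>))"
  have "cinner (cadjoint ?A (?A x)) y = cnj (cinner y (cadjoint ?A (?A x)))"
    by (rule cinner_commute)
  also have "\<dots> = cnj (cinner (?A y) (?A x))"
    by (simp only: cinner_cadjoint[OF A_clinear[OF simplify_pair_in_J[OF C]]])
  also have "\<dots> = cinner (?A x) (?A y)" by (rule cinner_commute[symmetric])
  finally show ?thesis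
    using C by (simp add: toeplitz_mat_def cinner_scaleR_left cinner_scaleR_right power2_eq_square mult.assoc)
qed

abbreviation "wot_series \<gamma> \<equiv> \<lambda>\<omega> x. (tau k m (\<omega>, \<gamma>))\<^sup>2 *\<^sub>R
  cadjoint (A (simplify_pair k (\<omega>, \<gamma>))) (A (simplify_pair k (\<omega>, \<gamma>)) x)"

lemma wot_has_sum_iff:
  "((\<lambda>\<omega>. cinner (wot_series \<gamma> \<omega> x) y) has_sum c) {\<omega> \<in> F. (\<omega>, \<gamma>) \<in> comparable_pairs k n} \<longleftrightarrow>
    ((\<lambda>\<omega>. cinner (M \<omega> \<gamma> x) (M \<omega> \<gamma> y)) has_sum c) F"
  by (rule has_sum_cong_neutral) (auto simp: wot_term, auto simp: toeplitz_mat_def)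

abbreviation "wot_summable \<gamma> \<equiv>
  wot_summable_on (wot_series \<gamma>) {\<omega> \<in> F. (\<omega>, \<gamma>) \<in> comparable_pairs k n}"

text \<open>At \<open>y = x\<close> the Gram form is the sum of the square norms of the
  column.\<close>

lemma wot_summable_column:
  assumes w: "wot_summable \<gamma>"
  shows "Mcol \<gamma> x \<in> l2 F"
proof -
  obtain S where S: "((\<lambda>\<omega>. cinner (M \<omega> \<gamma> x) (M \<omega> \<gamma> x)) has_sum cinner (S x) x) F"
    using w unfolding wot_summable_on_def wot_has_sum_iff by blast
  have "((\<lambda>\<omega>. Re (cinner (M \<omega> \<gamma> x) (M \<omega> \<gamma> x))) has_sum Re (cinner (S x) x)) F"
    by (rule has_sum_bounded_linear[OF bounded_linear_Re S])
  then have "(\<lambda>\<omega>. (norm (M \<omega> \<gamma> x))\<^sup>2) summable_on F"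
    by (simp add: cinner_self summable_on_def del: of_real_power) blast
  then have "(\<lambda>\<omega>. (norm (if \<omega> \<in> F then M \<omega> \<gamma> x else 0))\<^sup>2) summable_on F"
    by (rule summable_on_cong[THEN iffD1, rotated]) simp
  then show ?thesis by (simp add: l2_def)
qed

text \<open>The column map \<open>v\<close> is bounded by \<open>C\<close>, so its Gram form is
  bounded and represented by an operator; the WOT sum is the adjoint of the column composed with the
  column.\<close>

lemma bounded_wot_summable:
  assumes M: "mat_bounded F M C" and g: "\<gamma> \<in> F"
  shows "wot_summable \<gamma>"
proof -
  define v where "v x = Mcol \<gamma> x" for x
  note lin = bounded_clinearD[OF M_clinear]
  have vl2: "v x \<in> l2 F" for x unfolding v_def by (rule bounded_column[OF M g])
  have vn: "l2_norm F (v x) \<le> C * norm x" for x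
  proof -
    have "mat_op F M (l2_single \<gamma> x) = v x"
      unfolding v_def by (rule ext) (rule mat_op_single[OF M_clinear g])
    then show ?thesis using mat_op_norm(2)[OF M l2_single(1)[OF g, of x]] l2_single(2)[OF g, of x] by simp
  qed
  have hs: "((\<lambda>\<omega>. cinner (v x \<omega>) (v y \<omega>)) has_sum l2_inner F (v x) (v y)) F" for x y
    by (rule l2_inner_has_sum(1)[OF vl2 vl2])
  have vadd: "v (x + y) \<omega> = v x \<omega> + v y \<omega>" and vsc: "v (c *\<^sub>C x) \<omega> = c *\<^sub>C v x \<omega>" for x y c \<omega>
    by (simp_all add: v_def lin(3,4))
  obtain S where S: "bounded_clinear S" "\<And>x y. cinner (S x) y = l2_inner F (v x) (v y)"
  proof (rule bounded_sesquilinear_representation[where Q = "\<lambda>x y. l2_inner F (v x) (v y)" and C = "C * C"])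
    fix x y x' y' :: 'a and c
    show "l2_inner F (v (x + x')) (v y) = l2_inner F (v x) (v y) + l2_inner F (v x') (v y)"
      using hs[of "x + x'" y] has_sum_add[OF hs hs, of x y x' y]
      by (simp only: vadd cinner_add_left) (rule has_sum_unique)
    show "l2_inner F (v x) (v (y + y')) = l2_inner F (v x) (v y) + l2_inner F (v x) (v y')"
      using hs[of x "y + y'"] has_sum_add[OF hs hs, of x y x y']
      by (simp only: vadd cinner_add_right) (rule has_sum_unique)
    show "l2_inner F (v (c *\<^sub>C x)) (v y) = c * l2_inner F (v x) (v y)"
      using hs[of "c *\<^sub>C x" y] has_sum_cmult_right[OF hs, of c x y]
      by (simp only: vsc cinner_scaleC_left) (rule has_sum_unique)
    show "l2_inner F (v x) (v (c *\<^sub>C y)) = cnj c * l2_inner F (v x) (v y)"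
      using hs[of x "c *\<^sub>C y"] has_sum_cmult_right[OF hs, of "cnj c" x y]
      by (simp only: vsc cinner_scaleC_right) (rule has_sum_unique)
    have "cmod (l2_inner F (v x) (v y)) \<le> l2_norm F (v x) * l2_norm F (v y)"
      by (rule l2_inner_has_sum(2)[OF vl2 vl2])
    also have "\<dots> \<le> (C * norm x) * (C * norm y)"
      using mat_boundedD(1)[OF M] by (intro mult_mono vn) auto
    finally show "cmod (l2_inner F (v x) (v y)) \<le> C * C * norm x * norm y" by (simp add: mult_ac)
  qed (use that in blast)
  have "((\<lambda>\<omega>. cinner (M \<omega> \<gamma> x) (M \<omega> \<gamma> y)) has_sum cinner (S x) y) F" for x y
    unfolding S(2) by (rule has_sum_cong[THEN iffD1, OF _ hs]) (simp add: v_def)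
  then show ?thesis unfolding wot_summable_on_def wot_has_sum_iff using S(1) by blast
qed

text \<open>WOT convergence puts the columns into \<open>l2 F\<close>, so
  \<open>series_apply\<close> returns a true sum. Its values on normalized finitely supported
  vectors, cut to finitely many rows, give the estimate for \<open>radial_mat r\<close>, and
  \<open>r\<close> may then tend to 1.\<close>

lemma polynomial_bound_iff:
  "(\<forall>\<gamma>\<in>F. wot_summable \<gamma>) \<and>
    bdd_above {l2_norm F (radial_apply r p) | r p.
      r \<in> {0..<1} \<and> p \<in> poly_space k n \<and> l2_norm F p \<le> 1} \<longleftrightarrow> (\<exists>C. mat_bounded F M C)"
  (is "?W \<and> ?B \<longleftrightarrow> _")
proof
  assume a: "?W \<and> ?B"
  have col: "Mcol \<gamma> x \<in> l2 F" if "\<gamma> \<in> F" for \<gamma> x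
    by (rule wot_summable_column) (use a that in blast)
  obtain C0 where C0: "\<And>r p. r \<in> {0..<1} \<Longrightarrow> p \<in> poly_space k n \<Longrightarrow> l2_norm F p \<le> 1 \<Longrightarrow>
      l2_norm F (radial_apply r p) \<le> C0"
    using conjunct2[OF a] unfolding bdd_above_def by blast
  \<comment> \<open>\<open>mat_bounded\<close> asks for a nonnegative constant.\<close>
  define C where "C = max C0 0"
  have "mat_bounded F M C"
  proof (rule mat_bounded_radial_limit[OF M_clinear])
    fix r :: real assume r: "0 \<le> r" "r < 1"
    let ?N = "radial_mat r"
    have bc: "bounded_clinear (?N \<omega> \<gamma>)" for \<omega> \<gamma> by (rule bounded_clinear_scaleR[OF M_clinear])
    show "mat_bounded F ?N C"
    proof (rule mat_boundedI_norm[OF _ bc])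
      show "0 \<le> C" by (simp add: C_def)
      fix X Y and f :: "multiword \<Rightarrow> 'a" assume XY: "finite X" "X \<subseteq> F" "finite Y" "Y \<subseteq> F"
      let ?n = "fnorm f X" and ?h = "\<lambda>\<omega>. \<Sum>\<gamma>\<in>X. ?N \<omega> \<gamma> (f \<gamma>)"
      show "fnorm ?h Y \<le> C * ?n"
      proof (cases "?n = 0")
        case True
        then have "\<forall>\<gamma>\<in>X. f \<gamma> = 0" using XY(1) by (simp add: L2_set_eq_0_iff)
        then have "?h \<omega> = 0" for \<omega> by (simp add: bounded_clinearD(2)[OF M_clinear])
        then show ?thesis using True by (simp add: L2_set_def)
      next
        case False
        then have n: "?n > 0" using L2_set_nonneg[of "\<lambda>\<gamma>. norm (f \<gamma>)" X] by linarith
        \<comment> \<open>\<open>f\<close> cut to \<open>X\<close> and scaled to norm one, since the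
          assumed bound concerns vectors of norm at most one; the zero vector was treated apart for
          this reason.\<close>
        define p where "p = (\<lambda>\<gamma>. if \<gamma> \<in> X then (1 / ?n) *\<^sub>R f \<gamma> else 0)"
        have p0: "p \<omega> = 0" if "\<omega> \<notin> X" for \<omega> using that by (simp add: p_def)
        have "l2_norm F p = fnorm p X" by (rule l2_finite_support(2)[OF XY(1,2) p0])
        also have "\<dots> = L2_set (\<lambda>\<gamma>. (1 / ?n) * norm (f \<gamma>)) X"
          by (intro L2_set_cong) (simp_all add: p_def)
        also have "\<dots> = (1 / ?n) * ?n" by (rule L2_set_right_distrib[symmetric]) simp
        finally have pn: "l2_norm F p \<le> 1" using n by simp
        have r': "r \<in> {0..<1}" "r \<le> 1" using r by auto
        let ?s = "radial_apply r p"
        note sa = radial_series_apply[OF col r(1) r'(2) XY(1,2) p0]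
        have hp: "norm (?s \<omega>) = (1 / ?n) * norm (?h \<omega>)" if "\<omega> \<in> Y" for \<omega>
        proof -
          have "?s \<omega> = (\<Sum>\<gamma>\<in>X. ?N \<omega> \<gamma> (p \<gamma>))" using that XY(4) by (subst sa(1)) auto
          also have "\<dots> = (\<Sum>\<gamma>\<in>X. (1 / ?n) *\<^sub>R ?N \<omega> \<gamma> (f \<gamma>))"
            by (intro sum.cong refl) (simp add: p_def bounded_clinearD(5)[OF M_clinear])
          also have "\<dots> = (1 / ?n) *\<^sub>R ?h \<omega>" by (rule scaleR_sum_right[symmetric])
          finally show ?thesis by simp
        qed
        have "(1 / ?n) * fnorm ?h Y = L2_set (\<lambda>\<omega>. (1 / ?n) * norm (?h \<omega>)) Y"
          by (rule L2_set_right_distrib) simp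
        also have "\<dots> = fnorm ?s Y" by (intro L2_set_cong refl) (simp add: hp)
        also have "\<dots> \<le> l2_norm F ?s" by (rule L2_set_le_l2_norm[OF sa(2) XY(3,4)])
        also have "\<dots> \<le> C0" by (rule C0[OF r'(1) finite_support_in_poly_space[OF XY(1,2) p0] pn])
        also have "\<dots> \<le> C" by (simp add: C_def)
        finally show ?thesis using n by (simp add: divide_le_eq)
      qed
    qed
  qed
  then show "\<exists>C. mat_bounded F M C" by blast
next
  assume "\<exists>C. mat_bounded F M C"
  then obtain C where M: "mat_bounded F M C" by blast
  show "?W \<and> ?B"
  proof
    show ?W
      by (rule ballI) (rule bounded_wot_summable[OF M])
    have le: "l2_norm F (radial_apply r p) \<le> C"
      if r: "r \<in> {0..<1}" and p: "p \<in> poly_space k n" "l2_norm F p \<le> 1" for r p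
    proof -
      have r': "0 \<le> r" "r \<le> 1" using r by auto
      note N = radial_bounded[OF M r']
      let ?N = "radial_mat r"
      from poly_space_finite_support[OF p(1)]
      obtain X where X0: "finite X \<and> X \<subseteq> F \<and> (\<forall>\<omega>. \<omega> \<notin> X \<longrightarrow> p \<omega> = 0)" ..
      note X = conjunct1[OF X0] conjunct1[OF conjunct2[OF X0]] conjunct2[OF conjunct2[OF X0], rule_format]
      have pl2: "p \<in> l2 F" by (rule l2_finite_support(1)[OF X])
      have "radial_apply r p = mat_op F ?N p"
      proof
        fix \<omega>
        have sa: "radial_apply r p =
            (\<lambda>\<omega>. if \<omega> \<in> F then \<Sum>\<gamma>\<in>X. ?N \<omega> \<gamma> (p \<gamma>) else 0)"
          by (rule radial_series_apply(1)[OF bounded_column[OF M] r' X])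
        show "radial_apply r p \<omega> = mat_op F ?N p \<omega>"
        proof (cases "\<omega> \<in> F")
          case True
          have "mat_op F ?N p \<omega> = (\<Sum>\<gamma>\<in>X. ?N \<omega> \<gamma> (p \<gamma>))"
            by (rule op_entries_finite_support[OF op_entries_mat_op[OF N] X True])
          then show ?thesis using True by (simp add: sa)
        qed (simp add: sa mat_op_def)
      qed
      then have "l2_norm F (radial_apply r p) \<le> C * l2_norm F p"
        using mat_op_norm(2)[OF N pl2] by simp
      also have "\<dots> \<le> C * 1" by (rule mult_left_mono[OF p(2) mat_boundedD(1)[OF M]])
      finally show ?thesis by simp
    qed
    show ?B
      by (rule bdd_aboveI[of _ C]) (use le in blast)
  qed
qed

section \<open>The limit as \<open>r -> 1\<close>\<close>

text \<open>The differences from \<open>T\<close> are bounded by twice the norm of \<open>T\<close>,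
  uniformly in \<open>r\<close>. On a single the difference is a column multiplied entrywise by
  \<open>r ^ total_degree k \<omega> \<gamma> - 1\<close>, and density does the rest.\<close>

lemma radial_sot_limit:
  assumes T: "op_entries F T M"
  shows "l2_sot_tendsto F (radial_op k m n A) T (at_left 1)"
proof -
  note M = op_entries_mat_bounded_opnorm[OF T]
  let ?C = "l2_opnorm F T"
  have lim: "\<exists>L. radial_has_limit k m n A r L" if "r \<in> {0..<1}" for r
    using M that unfolding radial_limit_iff[symmetric] by blast
  have ev: "\<forall>\<^sub>F r in at_left (1::real). r \<in> {0..<1}"
    using eventually_at_left_real[of 0 1] by (auto elim: eventually_mono)
  let ?D = "\<lambda>r f \<omega>. radial_op k m n A r f \<omega> - T f \<omega>"
  have "((\<lambda>r. l2_norm F (?D r f)) \<longlongrightarrow> 0) (at_left 1)" if f: "f \<in> l2 F" for f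
  proof (rule l2_tendsto_0_dense[OF _ _ f])
    show "\<forall>\<^sub>F r in at_left 1. l2_bounded_op F (?D r) \<and> (\<forall>f\<in>l2 F. l2_norm F (?D r f) \<le> (2 * ?C) * l2_norm F f)"
      using ev
    proof eventually_elim
      case (elim r)
      note R = radial_op_entries[OF lim[OF elim]]
      show ?case
      proof (intro conjI ballI l2_bounded_op_minus op_entriesD(1)[OF R] op_entriesD(1)[OF T])
        fix f :: "multiword \<Rightarrow> 'a" assume f: "f \<in> l2 F"
        have "l2_norm F (radial_op k m n A r f) \<le> ?C * l2_norm F f"
          by (rule op_entries_norm(1)[OF R radial_bounded[OF M] f]) (use elim in auto)
        moreover have "l2_norm F (T f) \<le> ?C * l2_norm F f"
          by (rule l2_norm_le_opnorm[OF op_entriesD(1)[OF T] f])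
        moreover have "l2_norm F (?D r f) \<le> l2_norm F (radial_op k m n A r f) + l2_norm F (T f)"
          by (intro l2_diff(2) l2_bounded_opD(1)[OF op_entriesD(1)[OF R] f] l2_bounded_opD(1)[OF op_entriesD(1)[OF T] f])
        ultimately show "l2_norm F (?D r f) \<le> (2 * ?C) * l2_norm F f" by linarith
      qed
    qed
    fix \<gamma> and x :: 'a assume g: "\<gamma> \<in> F"
    let ?v = "\<lambda>\<omega>. if \<omega> \<in> F then M \<omega> \<gamma> x else 0"
    have "\<forall>\<^sub>F r in at_left 1. l2_norm F (\<lambda>\<omega>. (r ^ total_degree k \<omega> \<gamma> - 1) *\<^sub>R ?v \<omega>) = l2_norm F (?D r (l2_single \<gamma> x))"
      using ev
    proof eventually_elim
      case (elim r)
      note R = radial_op_entries[OF lim[OF elim]]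
      have "(r ^ total_degree k \<omega> \<gamma> - 1) *\<^sub>R ?v \<omega> = ?D r (l2_single \<gamma> x) \<omega>" for \<omega>
      proof (cases "\<omega> \<in> F")
        case True
        then show ?thesis
          unfolding op_entriesD(3)[OF R True g] op_entriesD(3)[OF T True g] by (simp add: scaleR_diff_left)
      next
        case False
        show ?thesis
          unfolding l2_outside[OF l2_bounded_opD(1)[OF op_entriesD(1)[OF R] l2_single(1)[OF g]] False]
            l2_outside[OF l2_bounded_opD(1)[OF op_entriesD(1)[OF T] l2_single(1)[OF g]] False]
          using False by simp
      qed
      then show ?case by (simp only:)
    qed
    with l2_radial_tendsto_0[OF bounded_column[OF M g]]
    show "((\<lambda>r. l2_norm F (?D r (l2_single \<gamma> x))) \<longlongrightarrow> 0) (at_left 1)"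
      by (rule Lim_transform_eventually)
  qed
  then show ?thesis unfolding l2_sot_tendsto_def by blast
qed

text \<open>\<open>radial_limit_iff\<close> is read twice: at the norm of \<open>T\<close> it bounds
  every radial norm, and at the supremum of the radial norms it bounds the matrix and hence
  \<open>T\<close>.\<close>

lemma opnorm_eq_SUP_radial:
  assumes T: "op_entries F T M"
  shows "l2_opnorm F T = (SUP r\<in>{0..<1}. l2_opnorm F (radial_op k m n A r))"
proof (rule antisym)
  note M = op_entries_mat_bounded_opnorm[OF T]
  have le: "\<forall>r\<in>{0..<1}. l2_opnorm F (radial_op k m n A r) \<le> l2_opnorm F T"
    and ex: "\<forall>r\<in>{0..<1}. \<exists>L. radial_has_limit k m n A r L"
    using M unfolding radial_limit_iff[symmetric] by blast+
  show "(SUP r\<in>{0..<1}. l2_opnorm F (radial_op k m n A r)) \<le> l2_opnorm F T"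
    by (rule cSUP_least) (use le in auto)
  have "bdd_above ((\<lambda>r. l2_opnorm F (radial_op k m n A r)) ` {0..<1})"
    unfolding bdd_above_radial_norms_iff using le by blast
  then have "\<forall>r\<in>{0..<1}. l2_opnorm F (radial_op k m n A r) \<le> (SUP r\<in>{0..<1}. l2_opnorm F (radial_op k m n A r))"
    by (intro ballI cSUP_upper)
  with ex have "mat_bounded F M (SUP r\<in>{0..<1}. l2_opnorm F (radial_op k m n A r))"
    unfolding radial_limit_iff[symmetric] by (rule conjI)
  then show "l2_opnorm F T \<le> (SUP r\<in>{0..<1}. l2_opnorm F (radial_op k m n A r))"
    by (rule op_entries_norm(2)[OF T])
qed

end

theorem theorem3p8:
  fixes k :: nat and m n :: "nat \<Rightarrow> nat"
    and A :: "multiword \<times> multiword \<Rightarrow> 'a::chilbert_space \<Rightarrow> 'a"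
  assumes "1 \<le> k" and "\<forall>i\<in>{1..k}. 1 \<le> m i \<and> 1 \<le> n i"
    and separable: "\<exists>D :: 'a set. countable D \<and> closure D = UNIV"
    and "\<forall>p\<in>J_pairs k n. bounded_clinear (A p)"
  shows
    "let
      stmt_i =
        (\<forall>\<gamma>\<in>Fn k n.
          wot_summable_on
            (\<lambda>\<omega> x. (tau k m (\<omega>, \<gamma>))\<^sup>2 *\<^sub>R
              cadjoint (A (simplify_pair k (\<omega>, \<gamma>))) (A (simplify_pair k (\<omega>, \<gamma>)) x))
            {\<omega> \<in> Fn k n. (\<omega>, \<gamma>) \<in> comparable_pairs k n}) \<and>
        bdd_above {l2_norm (Fn k n) (series_apply k m n (radial_coeffs k r A) p) | r p.
          r \<in> {0..<1} \<and> p \<in> poly_space k n \<and> l2_norm (Fn k n) p \<le> 1};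
      stmt_ii =
        (\<exists>T. multi_toeplitz k m n T \<and> fourier_representation k m n A T);
      stmt_iii =
        (\<forall>r\<in>{0..<1}. \<exists>L. radial_has_limit k m n A r L) \<and>
        bdd_above ((\<lambda>r. l2_opnorm (Fn k n) (radial_op k m n A r)) ` {0..<1});
      stmt_iv =
        (\<exists>M>0. \<forall>s. l2_opnorm (Fn k n) (q_op k m n A s) \<le> M) \<and>
        bdd_above ((\<lambda>r. l2_opnorm (Fn k n) (radial_op k m n A r)) ` {0..<1})
     in
      (stmt_i \<longleftrightarrow> stmt_ii) \<and> (stmt_ii \<longleftrightarrow> stmt_iii) \<and> (stmt_iii \<longleftrightarrow> stmt_iv) \<and>
      (\<forall>T. multi_toeplitz k m n T \<and> fourier_representation k m n A T \<longrightarrow>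
        l2_sot_tendsto (Fn k n) (radial_op k m n A) T (at_left 1) \<and>
        l2_opnorm (Fn k n) T =
          (SUP r\<in>{0..<1}. l2_opnorm (Fn k n) (radial_op k m n A r)))"
proof -
  interpret formal_series k m n A
  proof
    show "0 < m i" if "i \<in> {1..k}" for i using bspec[OF assms(2) that] by simp
    show "bounded_clinear (A p)" if "p \<in> J_pairs k n" for p using bspec[OF assms(4) that] .
  qed
  show ?thesis
    \<comment> \<open>Each of the four statements turns into the same assertion, that
      \<open>M\<close> is bounded by some constant.\<close>
    unfolding Let_def polynomial_bound_iff representation_iff norm_convergence_iff homogeneous_bound_iff
    using representation_entries radial_sot_limit opnorm_eq_SUP_radial by blast
qed

end
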